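(* Let $k$ be a commutative field. The functor $\widetilde{\Psi}:\mathcal{E}_q^{deg}\to Sp(\mathcal{E}^f_{inj})$ given on objects by $\widetilde{\Psi}(D)=\mathrm{Rad}(D)$ and on morphisms by $$\widetilde{\Psi}(D\xrightarrow{f}D')=\big[\mathrm{Rad}(D)\hookleftarrow f^{-1}(\mathrm{Rad}(D'))\xrightarrow{\widetilde f}\mathrm{Rad}(D')\big],$$ where the left arrow is the inclusion and $\widetilde f$ is the restriction of $f$, induces an equivalence of categories $$\Psi:\mathcal{E}_q^{deg}[(-\perp\mathbf{H})^{-1}]\xrightarrow{\ \simeq\ }Sp(\mathcal{E}^f_{inj}).$$
   Context: $\mathcal{E}_q^{deg}$ is the category of finite-dimensional quadratic spaces over $k$ (possibly degenerate; a quadratic form on $V$ is an element of $S^2(V^* )$), with morphisms the injective linear maps compatible with the quadratic forms. $\perp$ is the orthogonal sum. $\mathrm{Rad}(D)$ is the radical of the quadratic space $D$, a subspace on which the quadratic form vanishes, i.e. $\mathrm{Rad}(D)=\{v\in D : q(v+w)=q(w)\ \forall w\in D\}$; for $f:D\to D'$ in $\mathcal{E}_q^{deg}$ one has $f^{-1}(\mathrm{Rad}(D'))\subset\mathrm{Rad}(D)$. A hyperbolic space is an orthogonal sum of finitely many copies of the hyperbolic plane $\mathbf{H}=(k^2,(x,y)\mapsto xy)$. $(-\perp\mathbf{H})$ is the set of canonical inclusions $D\to D\perp H$ with $H$ a hyperbolic space, and $\mathcal{E}_q^{deg}[(-\perp\mathbf{H})^{-1}]$ is the category of fractions obtained by formally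 inverting these morphisms. $\mathcal{E}^f_{inj}$ is the category of finite-dimensional $k$-vector spaces and injective linear maps. For a category $\mathcal{C}$ with pullbacks, $Sp(\mathcal{C})$ (Burnside category) has the same objects as $\mathcal{C}$; $\mathrm{Hom}_{Sp(\mathcal{C})}(A,B)$ is the set of equivalence classes $[A\leftarrow D\to B]$ of diagrams $A\leftarrow D\to B$ in $\mathcal{C}$, modulo isomorphisms of $D$ compatible with both legs; composition is given by pullback: $[B\leftarrow D'\to C]\circ[A\leftarrow D\to B]=[A\leftarrow D\times_B D'\to C]$.
   Formalization: The equivalence is asserted only when k has characteristic different from 2; in characteristic 2 it is false, since (k, x²) has zero radical but is not isomorphic to 0 in the localization. Functoriality and the induced functor Ψ are stated for every field. *)

theory Defs
  imports "HOL-Algebra.Module"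
begin

section \<open>Categories, functors, equivalences\<close>

text \<open>\<open>cmp C g f\<close> is the composite "g after f".\<close>

record ('o, 'm) cat =
  obj :: "'o set"
  arr :: "'m set"
  src :: "'m \<Rightarrow> 'o"
  tgt :: "'m \<Rightarrow> 'o"
  idn :: "'o \<Rightarrow> 'm"
  cmp :: "'m \<Rightarrow> 'm \<Rightarrow> 'm"

definition homs :: "('o, 'm) cat \<Rightarrow> 'o \<Rightarrow> 'o \<Rightarrow> 'm set" where
  "homs C A B = {f \<in> arr C. src C f = A \<and> tgt C f = B}"

locale category =
  fixes C :: "('o, 'm) cat"
  assumes src_obj: "f \<in> arr C \<Longrightarrow> src C f \<in> obj C"
    and tgt_obj: "f \<in> arr C \<Longrightarrow> tgt C f \<in> obj C"
    and idn_homs: "A \<in> obj C \<Longrightarrow> idn C A \<in> homs C A A"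
    and cmp_homs: "\<lbrakk>f \<in> homs C A B; g \<in> homs C B D\<rbrakk> \<Longrightarrow> cmp C g f \<in> homs C A D"
    and cmp_idn_left: "f \<in> homs C A B \<Longrightarrow> cmp C (idn C B) f = f"
    and cmp_idn_right: "f \<in> homs C A B \<Longrightarrow> cmp C f (idn C A) = f"
    and cmp_assoc: "\<lbrakk>f \<in> homs C A B; g \<in> homs C B D; h \<in> homs C D E\<rbrakk>
      \<Longrightarrow> cmp C h (cmp C g f) = cmp C (cmp C h g) f"

definition is_iso :: "('o, 'm) cat \<Rightarrow> 'm \<Rightarrow> bool" where
  "is_iso C f \<longleftrightarrow> f \<in> arr C \<and>
     (\<exists>g \<in> homs C (tgt C f) (src C f).
        cmp C g f = idn C (src C f) \<and> cmp C f g = idn C (tgt C f))"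

definition isomorphic :: "('o, 'm) cat \<Rightarrow> 'o \<Rightarrow> 'o \<Rightarrow> bool" where
  "isomorphic C A B \<longleftrightarrow> (\<exists>f \<in> homs C A B. is_iso C f)"

record ('o, 'm, 'p, 'n) fctr =
  on_obj :: "'o \<Rightarrow> 'p"
  on_arr :: "'m \<Rightarrow> 'n"

locale is_functor = dom: category C + cod: category D
  for C :: "('o, 'm) cat" and D :: "('p, 'n) cat" +
  fixes F :: "('o, 'm, 'p, 'n) fctr"
  assumes on_obj_obj: "A \<in> obj C \<Longrightarrow> on_obj F A \<in> obj D"
    and on_arr_homs: "f \<in> homs C A B \<Longrightarrow> on_arr F f \<in> homs D (on_obj F A) (on_obj F B)"
    and on_arr_idn: "A \<in> obj C \<Longrightarrow> on_arr F (idn C A) = idn D (on_obj F A)"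
    and on_arr_cmp: "\<lbrakk>f \<in> homs C A B; g \<in> homs C B E\<rbrakk>
      \<Longrightarrow> on_arr F (cmp C g f) = cmp D (on_arr F g) (on_arr F f)"

definition functor_id :: "('o, 'm, 'o, 'm) fctr" where
  "functor_id = \<lparr>on_obj = (\<lambda>A. A), on_arr = (\<lambda>f. f)\<rparr>"

definition functor_comp ::
  "('p, 'n, 'q, 'l) fctr \<Rightarrow> ('o, 'm, 'p, 'n) fctr \<Rightarrow> ('o, 'm, 'q, 'l) fctr" where
  "functor_comp G F = \<lparr>on_obj = on_obj G \<circ> on_obj F, on_arr = on_arr G \<circ> on_arr F\<rparr>"

text \<open>Equality of functors with source \<open>C\<close>: the values outside of \<open>C\<close> are irrelevant.\<close>

definition functor_eq ::
  "('o, 'm) cat \<Rightarrow> ('o, 'm, 'p, 'n) fctr \<Rightarrow> ('o, 'm, 'p, 'n) fctr \<Rightarrow> bool" where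
  "functor_eq C F G \<longleftrightarrow>
     (\<forall>A \<in> obj C. on_obj F A = on_obj G A) \<and> (\<forall>f \<in> arr C. on_arr F f = on_arr G f)"

definition naturally_isomorphic ::
  "('o, 'm) cat \<Rightarrow> ('p, 'n) cat \<Rightarrow> ('o, 'm, 'p, 'n) fctr \<Rightarrow> ('o, 'm, 'p, 'n) fctr \<Rightarrow> bool" where
  "naturally_isomorphic C D F G \<longleftrightarrow>
     (\<exists>\<eta>. (\<forall>A \<in> obj C. \<eta> A \<in> homs D (on_obj F A) (on_obj G A) \<and> is_iso D (\<eta> A)) \<and>
          (\<forall>f \<in> arr C. cmp D (\<eta> (tgt C f)) (on_arr F f) = cmp D (on_arr G f) (\<eta> (src C f))))"

definition is_equivalence ::
  "('o, 'm) cat \<Rightarrow> ('p, 'n) cat \<Rightarrow> ('o, 'm, 'p, 'n) fctr \<Rightarrow> bool" where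
  "is_equivalence C D F \<longleftrightarrow> is_functor C D F \<and>
     (\<exists>G. is_functor D C G \<and>
          naturally_isomorphic C C (functor_comp G F) functor_id \<and>
          naturally_isomorphic D D (functor_comp F G) functor_id)"


section \<open>Categories of fractions\<close>

text \<open>Gabriel--Zisman construction of the category of fractions: same objects; a morphism is a
  path of arrows \<open>Fwd f\<close> of \<open>C\<close> and formal inverses \<open>Bwd s\<close> of arrows \<open>s\<close> in \<open>S\<close>, modulo the
  congruence generated by the relations below. Paths are listed in the order in which they are
  travelled, so the letters of a composite \<open>g f\<close> are \<open>[Fwd f, Fwd g]\<close>.\<close>

datatype 'm letter = Fwd 'm | Bwd 'm

fun is_letter :: "('o, 'm) cat \<Rightarrow> 'm set \<Rightarrow> 'm letter \<Rightarrow> bool" where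
  "is_letter C S (Fwd f) \<longleftrightarrow> f \<in> arr C"
| "is_letter C S (Bwd s) \<longleftrightarrow> s \<in> S \<and> s \<in> arr C"

fun letter_src :: "('o, 'm) cat \<Rightarrow> 'm letter \<Rightarrow> 'o" where
  "letter_src C (Fwd f) = src C f"
| "letter_src C (Bwd s) = tgt C s"

fun letter_tgt :: "('o, 'm) cat \<Rightarrow> 'm letter \<Rightarrow> 'o" where
  "letter_tgt C (Fwd f) = tgt C f"
| "letter_tgt C (Bwd s) = src C s"

fun is_path :: "('o, 'm) cat \<Rightarrow> 'm set \<Rightarrow> 'o \<Rightarrow> 'm letter list \<Rightarrow> 'o \<Rightarrow> bool" where
  "is_path C S A [] B \<longleftrightarrow> A \<in> obj C \<and> A = B"
| "is_path C S A (l # ls) B \<longleftrightarrow>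
     is_letter C S l \<and> letter_src C l = A \<and> is_path C S (letter_tgt C l) ls B"

inductive path_relation :: "('o, 'm) cat \<Rightarrow> 'm letter list \<Rightarrow> 'm letter list \<Rightarrow> bool"
  for C where
  "path_relation C [Fwd (idn C A)] []"
| "tgt C f = src C g \<Longrightarrow> path_relation C [Fwd f, Fwd g] [Fwd (cmp C g f)]"
| "path_relation C [Fwd s, Bwd s] []"
| "path_relation C [Bwd s, Fwd s] []"

inductive path_equiv ::
  "('o, 'm) cat \<Rightarrow> 'm set \<Rightarrow> 'o \<Rightarrow> 'o \<Rightarrow> 'm letter list \<Rightarrow> 'm letter list \<Rightarrow> bool"
  for C S A B where
  elementary: "\<lbrakk>path_relation C l r;
     is_path C S A (us @ l @ vs) B; is_path C S A (us @ r @ vs) B\<rbrakk>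
     \<Longrightarrow> path_equiv C S A B (us @ l @ vs) (us @ r @ vs)"
| refl: "is_path C S A us B \<Longrightarrow> path_equiv C S A B us us"
| sym: "path_equiv C S A B us vs \<Longrightarrow> path_equiv C S A B vs us"
| trans: "\<lbrakk>path_equiv C S A B us vs; path_equiv C S A B vs ws\<rbrakk> \<Longrightarrow> path_equiv C S A B us ws"

definition path_class :: "('o, 'm) cat \<Rightarrow> 'm set \<Rightarrow> 'o \<Rightarrow> 'o \<Rightarrow> 'm letter list \<Rightarrow> 'm letter list set" where
  "path_class C S A B us = {vs. path_equiv C S A B us vs}"

definition fractions ::
  "('o, 'm) cat \<Rightarrow> 'm set \<Rightarrow> ('o, 'o \<times> 'm letter list set \<times> 'o) cat" where
  "fractions C S = \<lparr>
     obj = obj C,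
     arr = {(A, path_class C S A B us, B) | A us B. is_path C S A us B},
     src = (\<lambda>(A, X, B). A),
     tgt = (\<lambda>(A, X, B). B),
     idn = (\<lambda>A. (A, path_class C S A A [], A)),
     cmp = (\<lambda>(B', Y, D) (A, X, B).
       (A, {ws. \<exists>us \<in> X. \<exists>vs \<in> Y. path_equiv C S A D (us @ vs) ws}, D))\<rparr>"

definition to_fractions ::
  "('o, 'm) cat \<Rightarrow> 'm set \<Rightarrow> ('o, 'm, 'o, 'o \<times> 'm letter list set \<times> 'o) fctr" where
  "to_fractions C S = \<lparr>
     on_obj = (\<lambda>A. A),
     on_arr = (\<lambda>f. (src C f, path_class C S (src C f) (tgt C f) [Fwd f], tgt C f))\<rparr>"


definition inverts :: "('o, 'm) cat \<Rightarrow> 'm set \<Rightarrow> ('p, 'n) cat \<Rightarrow> ('o, 'm, 'p, 'n) fctr \<Rightarrow> bool" where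
  "inverts C S D F \<longleftrightarrow> (\<forall>s \<in> S. is_iso D (on_arr F s))"

text \<open>\<open>G\<close> is the unique functor on the category of fractions through which \<open>F\<close> factors.\<close>

definition is_induced_functor :: "('o, 'm) cat \<Rightarrow> 'm set \<Rightarrow> ('p, 'n) cat \<Rightarrow> ('o, 'm, 'p, 'n) fctr \<Rightarrow>
    ('o, 'o \<times> 'm letter list set \<times> 'o, 'p, 'n) fctr \<Rightarrow> bool" where
  "is_induced_functor C S D F G \<longleftrightarrow>
     is_functor (fractions C S) D G \<and>
     functor_eq C (functor_comp G (to_fractions C S)) F \<and>
     (\<forall>G'. is_functor (fractions C S) D G' \<and>
           functor_eq C (functor_comp G' (to_fractions C S)) F
        \<longrightarrow> functor_eq (fractions C S) G' G)"


section \<open>The Burnside category of a category with pullbacks\<close>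

definition is_pullback :: "('o, 'm) cat \<Rightarrow> 'm \<Rightarrow> 'm \<Rightarrow> 'm \<Rightarrow> 'm \<Rightarrow> bool" where
  "is_pullback C f g p q \<longleftrightarrow>
     f \<in> arr C \<and> g \<in> arr C \<and> tgt C f = tgt C g \<and>
     p \<in> homs C (src C p) (src C f) \<and> q \<in> homs C (src C p) (src C g) \<and>
     cmp C f p = cmp C g q \<and>
     (\<forall>P a b. a \<in> homs C P (src C f) \<and> b \<in> homs C P (src C g) \<and> cmp C f a = cmp C g b
        \<longrightarrow> (\<exists>!h. h \<in> homs C P (src C p) \<and> cmp C p h = a \<and> cmp C q h = b))"

text \<open>The pair \<open>(f, g)\<close> stands for the diagram \<open>A \<leftarrow> D \<rightarrow> B\<close> with left leg \<open>f\<close> and right leg \<open>g\<close>.\<close>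

definition spans :: "('o, 'm) cat \<Rightarrow> 'o \<Rightarrow> 'o \<Rightarrow> ('m \<times> 'm) set" where
  "spans C A B = {(f, g). f \<in> arr C \<and> g \<in> arr C \<and> src C f = src C g \<and> tgt C f = A \<and> tgt C g = B}"

definition span_class :: "('o, 'm) cat \<Rightarrow> 'm \<times> 'm \<Rightarrow> ('m \<times> 'm) set" where
  "span_class C = (\<lambda>(f, g). {(f', g') \<in> spans C (tgt C f) (tgt C g).
     \<exists>h \<in> homs C (src C f) (src C f'). is_iso C h \<and> cmp C f' h = f \<and> cmp C g' h = g})"

text \<open>Pullbacks are only unique up to isomorphism; the composite of two classes is the set of
  all spans obtained from representatives by means of some pullback, which is again one class
  if \<open>C\<close> has pullbacks.\<close>

definition Sp :: "('o, 'm) cat \<Rightarrow> ('o, 'o \<times> ('m \<times> 'm) set \<times> 'o) cat" where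
  "Sp C = \<lparr>
     obj = obj C,
     arr = {(A, span_class C s, B) | A s B. A \<in> obj C \<and> B \<in> obj C \<and> s \<in> spans C A B},
     src = (\<lambda>(A, X, B). A),
     tgt = (\<lambda>(A, X, B). B),
     idn = (\<lambda>A. (A, span_class C (idn C A, idn C A), A)),
     cmp = (\<lambda>(B', Y, D) (A, X, B).
       (A, {(cmp C f p, cmp C g' q) | f g f' g' p q.
              (f, g) \<in> X \<and> (f', g') \<in> Y \<and> is_pullback C g f' p q}, D))\<rparr>"


section \<open>Vector spaces and quadratic spaces over a field\<close>

text \<open>Universe for the underlying sets of the spaces: it contains the scalars of type
  \<open>'k\<close> and the elements of an arbitrary further type \<open>'x\<close>, and is closed under pairing, so that
  \<open>k\<^sup>2\<close>, external orthogonal sums and fibre products are available literally.\<close>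

datatype ('k, 'x) elt = Scalar 'k | Atom 'x | Couple "('k, 'x) elt" "('k, 'x) elt"

type_synonym ('k, 'x) vec_space = "('k, ('k, 'x) elt) module"

record ('k, 'a) quadratic_module = "('k, 'a) module" +
  qform :: "'a \<Rightarrow> 'k"

type_synonym ('k, 'x) quad_space = "('k, ('k, 'x) elt) quadratic_module"

definition finite_dim :: "('k, 'r) ring_scheme \<Rightarrow> ('k, 'a, 'v) module_scheme \<Rightarrow> bool" where
  "finite_dim K V \<longleftrightarrow>
     (\<exists>S. finite S \<and> S \<subseteq> carrier V \<and>
        (\<forall>v \<in> carrier V. \<exists>c \<in> S \<rightarrow> carrier K. v = (\<Oplus>\<^bsub>V\<^esub>s\<in>S. c s \<odot>\<^bsub>V\<^esub> s)))"

definition is_linear :: "('k, 'r) ring_scheme \<Rightarrow> ('k, 'a, 'v) module_scheme \<Rightarrow>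
    ('k, 'b, 'w) module_scheme \<Rightarrow> ('a \<Rightarrow> 'b) \<Rightarrow> bool" where
  "is_linear K V W f \<longleftrightarrow>
     f \<in> carrier V \<rightarrow> carrier W \<and>
     (\<forall>x \<in> carrier V. \<forall>y \<in> carrier V. f (x \<oplus>\<^bsub>V\<^esub> y) = f x \<oplus>\<^bsub>W\<^esub> f y) \<and>
     (\<forall>c \<in> carrier K. \<forall>x \<in> carrier V. f (c \<odot>\<^bsub>V\<^esub> x) = c \<odot>\<^bsub>W\<^esub> f x)"

definition is_linear_form :: "('k, 'r) ring_scheme \<Rightarrow> ('k, 'a, 'v) module_scheme \<Rightarrow>
    ('a \<Rightarrow> 'k) \<Rightarrow> bool" where
  "is_linear_form K V l \<longleftrightarrow>
     l \<in> carrier V \<rightarrow> carrier K \<and>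
     (\<forall>x \<in> carrier V. \<forall>y \<in> carrier V. l (x \<oplus>\<^bsub>V\<^esub> y) = l x \<oplus>\<^bsub>K\<^esub> l y) \<and>
     (\<forall>c \<in> carrier K. \<forall>x \<in> carrier V. l (c \<odot>\<^bsub>V\<^esub> x) = c \<otimes>\<^bsub>K\<^esub> l x)"

text \<open>The elements of \<open>S\<^sup>2(V\<^sup>*)\<close> are the finite sums of products of two linear forms. They are
  identified with functions on \<open>V\<close>; this is injective over every field, including finite fields
  and characteristic 2, since the coefficients are recovered from the values at the vectors
  \<open>e\<^sub>i\<close> and \<open>e\<^sub>i + e\<^sub>j\<close> of a basis.\<close>

definition is_quadratic_form :: "('k, 'r) ring_scheme \<Rightarrow> ('k, 'a, 'v) module_scheme \<Rightarrow>
    ('a \<Rightarrow> 'k) \<Rightarrow> bool" where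
  "is_quadratic_form K V q \<longleftrightarrow>
     (\<exists>n l m. (\<forall>i < n::nat. is_linear_form K V (l i) \<and> is_linear_form K V (m i)) \<and>
        (\<forall>v \<in> carrier V. q v = (\<Oplus>\<^bsub>K\<^esub>i\<in>{..<n}. l i v \<otimes>\<^bsub>K\<^esub> m i v)))"

text \<open>Categories whose objects have carrier sets and whose morphisms are maps between these. The
  maps are extensional, and an arrow records its source and target. (The \<open>mult\<close> and \<open>one\<close>
  components which modules of HOL-Algebra inherit from rings play no role anywhere; objects
  differing only there, or off the carrier, are isomorphic through the identity map.)\<close>

definition concrete_cat :: "('a, 'z) partial_object_scheme set \<Rightarrow>
    (('a, 'z) partial_object_scheme \<Rightarrow> ('a, 'z) partial_object_scheme \<Rightarrow> ('a \<Rightarrow> 'a) \<Rightarrow> bool) \<Rightarrow>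
    (('a, 'z) partial_object_scheme,
     ('a, 'z) partial_object_scheme \<times> ('a \<Rightarrow> 'a) \<times> ('a, 'z) partial_object_scheme) cat" where
  "concrete_cat Obs Mor = \<lparr>
     obj = Obs,
     arr = {(A, f, B). A \<in> Obs \<and> B \<in> Obs \<and> f \<in> carrier A \<rightarrow>\<^sub>E carrier B \<and> Mor A B f},
     src = (\<lambda>(A, f, B). A),
     tgt = (\<lambda>(A, f, B). B),
     idn = (\<lambda>A. (A, \<lambda>v\<in>carrier A. v, A)),
     cmp = (\<lambda>(B', g, D) (A, f, B). (A, compose (carrier A) g f, D))\<rparr>"

definition E_inj :: "('k, 'r) ring_scheme \<Rightarrow>
    (('k, 'x) vec_space,
     ('k, 'x) vec_space \<times> (('k, 'x) elt \<Rightarrow> ('k, 'x) elt) \<times> ('k, 'x) vec_space) cat" where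
  "E_inj K = concrete_cat
     {V. module K V \<and> finite_dim K V}
     (\<lambda>V W f. is_linear K V W f \<and> inj_on f (carrier V))"

definition Eq_deg :: "('k, 'r) ring_scheme \<Rightarrow>
    (('k, 'x) quad_space,
     ('k, 'x) quad_space \<times> (('k, 'x) elt \<Rightarrow> ('k, 'x) elt) \<times> ('k, 'x) quad_space) cat" where
  "Eq_deg K = concrete_cat
     {D. module K D \<and> finite_dim K D \<and> is_quadratic_form K D (qform D)}
     (\<lambda>D E f. is_linear K D E f \<and> inj_on f (carrier D) \<and>
        (\<forall>v \<in> carrier D. qform E (f v) = qform D v))"

fun pfst :: "('k, 'x) elt \<Rightarrow> ('k, 'x) elt" where
  "pfst (Couple a b) = a"
| "pfst u = u"

fun psnd :: "('k, 'x) elt \<Rightarrow> ('k, 'x) elt" where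
  "psnd (Couple a b) = b"
| "psnd u = u"

fun scalar_of :: "('k, 'x) elt \<Rightarrow> 'k" where
  "scalar_of (Scalar a) = a"
| "scalar_of u = undefined"

definition orth_sum :: "('k, 'r) ring_scheme \<Rightarrow>
    ('k, 'x) quad_space \<Rightarrow> ('k, 'x) quad_space \<Rightarrow> ('k, 'x) quad_space" where
  "orth_sum K D E = \<lparr>
     carrier = {Couple v w | v w. v \<in> carrier D \<and> w \<in> carrier E},
     mult = undefined, one = undefined,
     zero = Couple \<zero>\<^bsub>D\<^esub> \<zero>\<^bsub>E\<^esub>,
     add = (\<lambda>u u'. Couple (pfst u \<oplus>\<^bsub>D\<^esub> pfst u') (psnd u \<oplus>\<^bsub>E\<^esub> psnd u')),
     smult = (\<lambda>c u. Couple (c \<odot>\<^bsub>D\<^esub> pfst u) (c \<odot>\<^bsub>E\<^esub> psnd u)),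
     qform = (\<lambda>u. qform D (pfst u) \<oplus>\<^bsub>K\<^esub> qform E (psnd u))\<rparr>"

definition zero_space :: "('k, 'r) ring_scheme \<Rightarrow> ('k, 'x) quad_space" where
  "zero_space K = \<lparr>
     carrier = {Scalar \<zero>\<^bsub>K\<^esub>},
     mult = undefined, one = undefined,
     zero = Scalar \<zero>\<^bsub>K\<^esub>,
     add = (\<lambda>u u'. Scalar \<zero>\<^bsub>K\<^esub>),
     smult = (\<lambda>c u. Scalar \<zero>\<^bsub>K\<^esub>),
     qform = (\<lambda>u. \<zero>\<^bsub>K\<^esub>)\<rparr>"

definition hyperbolic_plane :: "('k, 'r) ring_scheme \<Rightarrow> ('k, 'x) quad_space" where
  "hyperbolic_plane K = \<lparr>
     carrier = {Couple (Scalar x) (Scalar y) | x y. x \<in> carrier K \<and> y \<in> carrier K},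
     mult = undefined, one = undefined,
     zero = Couple (Scalar \<zero>\<^bsub>K\<^esub>) (Scalar \<zero>\<^bsub>K\<^esub>),
     add = (\<lambda>u u'. Couple (Scalar (scalar_of (pfst u) \<oplus>\<^bsub>K\<^esub> scalar_of (pfst u')))
                       (Scalar (scalar_of (psnd u) \<oplus>\<^bsub>K\<^esub> scalar_of (psnd u')))),
     smult = (\<lambda>c u. Couple (Scalar (c \<otimes>\<^bsub>K\<^esub> scalar_of (pfst u)))
                       (Scalar (c \<otimes>\<^bsub>K\<^esub> scalar_of (psnd u)))),
     qform = (\<lambda>u. scalar_of (pfst u) \<otimes>\<^bsub>K\<^esub> scalar_of (psnd u))\<rparr>"

fun hyperbolic_sum :: "('k, 'r) ring_scheme \<Rightarrow> nat \<Rightarrow> ('k, 'x) quad_space" where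
  "hyperbolic_sum K 0 = zero_space K"
| "hyperbolic_sum K (Suc n) = orth_sum K (hyperbolic_sum K n) (hyperbolic_plane K)"

definition hyperbolic_space :: "('k, 'r) ring_scheme \<Rightarrow> ('k, 'x) quad_space \<Rightarrow> bool" where
  "hyperbolic_space K H \<longleftrightarrow> (\<exists>n. isomorphic (Eq_deg K) H (hyperbolic_sum K n))"

definition perp_inclusion :: "('k, 'r) ring_scheme \<Rightarrow> ('k, 'x) quad_space \<Rightarrow> ('k, 'x) quad_space \<Rightarrow>
    ('k, 'x) quad_space \<times> (('k, 'x) elt \<Rightarrow> ('k, 'x) elt) \<times> ('k, 'x) quad_space" where
  "perp_inclusion K D H = (D, \<lambda>v\<in>carrier D. Couple v \<zero>\<^bsub>H\<^esub>, orth_sum K D H)"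

definition perp_H :: "('k, 'r) ring_scheme \<Rightarrow>
    (('k, 'x) quad_space \<times> (('k, 'x) elt \<Rightarrow> ('k, 'x) elt) \<times> ('k, 'x) quad_space) set" where
  "perp_H K = {perp_inclusion K D H | D H. D \<in> obj (Eq_deg K) \<and> hyperbolic_space K H}"


section \<open>The radical functor\<close>

text \<open>In characteristic 2 the radical can be strictly smaller than the kernel of the polar form:
  for \<open>q(x) = x\<^sup>2\<close> on the line the polar form is zero, but the radical is zero as well.\<close>

definition rad :: "('k, 'a) quadratic_module \<Rightarrow> 'a set" where
  "rad D = {v \<in> carrier D. \<forall>w \<in> carrier D. qform D (v \<oplus>\<^bsub>D\<^esub> w) = qform D w}"

definition subspace_on :: "('k, 'a) quadratic_module \<Rightarrow> 'a set \<Rightarrow> ('k, 'a) module" where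
  "subspace_on D U = (module.truncate D)\<lparr>carrier := U\<rparr>"

definition Rad :: "('k, 'x) quad_space \<Rightarrow> ('k, 'x) vec_space" where
  "Rad D = subspace_on D (rad D)"

definition Psi_tilde :: "('k, 'r) ring_scheme \<Rightarrow>
    (('k, 'x) quad_space,
     ('k, 'x) quad_space \<times> (('k, 'x) elt \<Rightarrow> ('k, 'x) elt) \<times> ('k, 'x) quad_space,
     ('k, 'x) vec_space,
     ('k, 'x) vec_space \<times>
       (('k, 'x) vec_space \<times> (('k, 'x) elt \<Rightarrow> ('k, 'x) elt) \<times> ('k, 'x) vec_space) rel \<times>
       ('k, 'x) vec_space) fctr" where
  "Psi_tilde K = \<lparr>
     on_obj = Rad,
     on_arr = (\<lambda>(D, f, D').
       let U = {v \<in> carrier D. f v \<in> rad D'}; P = subspace_on D U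
       in (Rad D,
           span_class (E_inj K) ((P, \<lambda>v\<in>U. v, Rad D), (P, restrict f U, Rad D')),
           Rad D'))\<rparr>"

end

theory Submission
  imports Defs
begin

text \<open>
  Both categories can be described by partial linear maps. A span \<open>A \<leftarrow> D \<rightarrow> B\<close> of injections is, up to
  isomorphism, an injective linear map \<open>j\<close> from a subspace \<open>U\<close> of \<open>A\<close> to \<open>B\<close>, where \<open>U\<close> is the image of
  the left leg; since a pullback of injections is an intersection of images, composition of spans
  becomes composition of partial maps (\<open>span_class_iff\<close>, \<open>cmp_pmor\<close>). This makes \<open>Sp\<close> visibly a category
  and \<open>Psi_tilde\<close> a functor: it sends \<open>f\<close> to the restriction of \<open>f\<close> to the preimage of the radical.
  Hyperbolic spaces have a nondegenerate polar form, so an inclusion \<open>D \<rightarrow> D \<perp> H\<close> is a bijection on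
  radicals and is sent to an isomorphism; the factorisation \<open>\<Psi>\<close> is evaluation of zigzags.

  Let 2 be invertible. A line \<open>\<langle>a\<rangle>\<close> with \<open>a \<noteq> 0\<close> satisfies \<open>\<langle>a\<rangle> \<perp> \<langle>-a\<rangle> \<cong> H\<close>, so an inclusion
  \<open>D \<rightarrow> D \<perp> \<langle>a\<rangle>\<close> is the first of three composable arrows whose two consecutive composites are inverted;
  by two-out-of-six it is inverted itself (\<open>adds_line_iso\<close>). Splitting off anisotropic lines one by
  one shows that \<open>Rad D \<rightarrow> D\<close>, with the zero form on \<open>Rad D\<close>, is inverted for every \<open>D\<close>
  (\<open>rad_incl_iso\<close>). Hence only morphisms of fractions \<open>\<beta>\<close> from a totally isotropic space \<open>V\<close> to \<open>D'\<close>
  need to be understood.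

  By a calculus of left fractions such a \<open>\<beta>\<close> is \<open>t\<inverse> f\<close> with \<open>f : V \<rightarrow> X\<close> and \<open>t : D' \<rightarrow> X\<close>, where \<open>t\<close>
  is inverted and maps \<open>Rad D'\<close> onto \<open>Rad X\<close> (\<open>fraction_form\<close>). Put \<open>U = f\<inverse> (Rad X)\<close>. If \<open>e\<close> is a vector
  of \<open>V\<close> outside of a subspace \<open>V'\<close> containing \<open>U\<close>, with \<open>V = V' + k e\<close>, then \<open>f e\<close> has an isotropic dual vector in \<open>X\<close>
  orthogonal to \<open>f V'\<close>, so \<open>f\<close> extends along \<open>V \<rightarrow> V' \<perp> H\<close> (\<open>extend_to_hyperbolic\<close>). Therefore \<open>f\<close> equals its
  restriction to \<open>V'\<close> precomposed with the fixed morphism of fractions \<open>V \<rightarrow> V' \<perp> H \<leftarrow> V'\<close>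
  (\<open>retraction_along_line\<close>). Iterating down to \<open>U\<close>, \<open>f\<close> is its restriction to \<open>U\<close> precomposed with a
  morphism \<open>V \<rightarrow> U\<close> depending on \<open>V\<close> and \<open>U\<close> alone, and on \<open>U\<close> one has \<open>f = t j\<close> for the partial map \<open>j\<close>
  representing \<open>\<Psi> \<beta>\<close>. So \<open>\<beta>\<close> is determined by \<open>(U, j)\<close>, and every \<open>(U, j)\<close> occurs: \<open>\<Psi>\<close> is fully
  faithful. It is surjective on objects, since \<open>V\<close> with the zero form has radical \<open>V\<close>.
\<close>

section \<open>Isomorphisms and fully faithful functors\<close>

lemma homs_iff: "f \<in> homs C A B \<longleftrightarrow> f \<in> arr C \<and> src C f = A \<and> tgt C f = B"
  by (simp add: homs_def)

definition inv_arr :: "('o, 'm) cat \<Rightarrow> 'm \<Rightarrow> 'm" where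
  "inv_arr C f = (SOME g. g \<in> homs C (tgt C f) (src C f) \<and>
     cmp C g f = idn C (src C f) \<and> cmp C f g = idn C (tgt C f))"

context category
begin

lemma homs_obj: "f \<in> homs C A B \<Longrightarrow> A \<in> obj C" "f \<in> homs C A B \<Longrightarrow> B \<in> obj C"
  using src_obj tgt_obj by (auto simp: homs_iff)

lemma is_isoI:
  assumes "f \<in> homs C A B" "g \<in> homs C B A" "cmp C g f = idn C A" "cmp C f g = idn C B"
  shows "is_iso C f"
proof -
  have "f \<in> arr C" "src C f = A" "tgt C f = B" using assms(1) by (simp_all add: homs_iff)
  then show ?thesis unfolding is_iso_def using assms(2-4) by auto
qed

lemma inv_arr:
  assumes "is_iso C f" "f \<in> homs C A B"
  shows "inv_arr C f \<in> homs C B A" "cmp C (inv_arr C f) f = idn C A" "cmp C f (inv_arr C f) = idn C B"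
proof -
  have "\<exists>g. g \<in> homs C (tgt C f) (src C f) \<and>
     cmp C g f = idn C (src C f) \<and> cmp C f g = idn C (tgt C f)"
    using assms(1) unfolding is_iso_def by blast
  from someI_ex[OF this] assms(2)
  show "inv_arr C f \<in> homs C B A" "cmp C (inv_arr C f) f = idn C A" "cmp C f (inv_arr C f) = idn C B"
    unfolding inv_arr_def[symmetric] by (auto simp: homs_iff)
qed

lemma inv_arr_cancel:
  assumes "is_iso C f" "f \<in> homs C A B"
  shows "g \<in> homs C E A \<Longrightarrow> cmp C (inv_arr C f) (cmp C f g) = g"
    and "g \<in> homs C E B \<Longrightarrow> cmp C f (cmp C (inv_arr C f) g) = g"
    and "g \<in> homs C B E \<Longrightarrow> cmp C (cmp C g f) (inv_arr C f) = g"
    and "g \<in> homs C A E \<Longrightarrow> cmp C (cmp C g (inv_arr C f)) f = g"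
proof -
  note i = inv_arr[OF assms]
  show "cmp C (inv_arr C f) (cmp C f g) = g" if "g \<in> homs C E A"
    using cmp_assoc[OF that assms(2) i(1)] cmp_idn_left[OF that] i(2) by simp
  show "cmp C f (cmp C (inv_arr C f) g) = g" if "g \<in> homs C E B"
    using cmp_assoc[OF that i(1) assms(2)] cmp_idn_left[OF that] i(3) by simp
  show "cmp C (cmp C g f) (inv_arr C f) = g" if "g \<in> homs C B E"
    using cmp_assoc[OF i(1) assms(2) that] cmp_idn_right[OF that] i(3) by simp
  show "cmp C (cmp C g (inv_arr C f)) f = g" if "g \<in> homs C A E"
    using cmp_assoc[OF assms(2) i(1) that] cmp_idn_right[OF that] i(2) by simp
qed

lemma inv_arr_unique:
  assumes "is_iso C f" "f \<in> homs C A B" "g \<in> homs C B A" "cmp C f g = idn C B"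
  shows "g = inv_arr C f"
  using inv_arr_cancel(1)[OF assms(1,2) assms(3)] assms(4) cmp_idn_right[OF inv_arr(1)[OF assms(1,2)]]
  by simp

lemma is_iso_inv_arr: "is_iso C f \<Longrightarrow> f \<in> homs C A B \<Longrightarrow> is_iso C (inv_arr C f)"
  using is_isoI[OF inv_arr(1) _ inv_arr(3,2)] by blast

lemma is_iso_idn: "A \<in> obj C \<Longrightarrow> is_iso C (idn C A)"
  using is_isoI[OF idn_homs idn_homs cmp_idn_left cmp_idn_left] idn_homs by blast

lemma is_iso_cmp:
  assumes f: "is_iso C f" "f \<in> homs C A B" and g: "is_iso C g" "g \<in> homs C B E"
  shows "is_iso C (cmp C g f)"
proof (rule is_isoI)
  note i = inv_arr[OF f] and j = inv_arr[OF g]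
  show "cmp C g f \<in> homs C A E" using f g cmp_homs by blast
  show k: "cmp C (inv_arr C f) (inv_arr C g) \<in> homs C E A" using i j cmp_homs by blast
  show "cmp C (cmp C (inv_arr C f) (inv_arr C g)) (cmp C g f) = idn C A"
    using cmp_assoc[OF \<open>cmp C g f \<in> homs C A E\<close> j(1) i(1)] inv_arr_cancel(1)[OF g f(2)] i by simp
  show "cmp C (cmp C g f) (cmp C (inv_arr C f) (inv_arr C g)) = idn C E"
    using cmp_assoc[OF k f(2) g(2)] inv_arr_cancel(2)[OF f j(1)] j by simp
qed

text \<open>The middle arrow has a left and a right inverse, so it is invertible, and then so is the first one.\<close>

lemma two_of_six:
  assumes f: "f \<in> homs C A B" and g: "g \<in> homs C B E" and h: "h \<in> homs C E G"
    and gf: "is_iso C (cmp C g f)" and hg: "is_iso C (cmp C h g)"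
  shows "is_iso C f"
proof -
  have gf': "cmp C g f \<in> homs C A E" and hg': "cmp C h g \<in> homs C B G" using f g h cmp_homs by auto
  note i = inv_arr[OF gf gf'] and j = inv_arr[OF hg hg']
  define r where "r = cmp C f (inv_arr C (cmp C g f))"
  define l where "l = cmp C (inv_arr C (cmp C h g)) h"
  have r: "r \<in> homs C E B" and l: "l \<in> homs C E B" using f h i j cmp_homs r_def l_def by auto
  have gr: "cmp C g r = idn C E" unfolding r_def using cmp_assoc[OF i(1) f g] i(3) by simp
  have lg: "cmp C l g = idn C B" unfolding l_def using cmp_assoc[OF g h j(1)] j(2) by simp
  have lr: "l = r" using cmp_assoc[OF r g l] gr lg cmp_idn_left[OF r] cmp_idn_right[OF l] by simp
  have ig: "is_iso C g" using is_isoI[OF g r] gr lg lr by simp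
  have "f = cmp C (inv_arr C g) (cmp C g f)" using inv_arr_cancel(1)[OF ig g f] by simp
  then show ?thesis
    using is_iso_cmp[OF gf gf' is_iso_inv_arr[OF ig g] inv_arr(1)[OF ig g]] by simp
qed

end

context is_functor
begin

lemma is_iso_on_arr:
  assumes "is_iso C f" "f \<in> homs C A B"
  shows "is_iso D (on_arr F f)"
    and "on_arr F (inv_arr C f) = inv_arr D (on_arr F f)"
proof -
  note i = dom.inv_arr[OF assms]
  note o = dom.homs_obj[OF assms(2)]
  have Ff: "on_arr F f \<in> homs D (on_obj F A) (on_obj F B)"
    and Fi: "on_arr F (inv_arr C f) \<in> homs D (on_obj F B) (on_obj F A)"
    using assms(2) i(1) on_arr_homs by auto
  have 1: "cmp D (on_arr F (inv_arr C f)) (on_arr F f) = idn D (on_obj F A)"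
    using on_arr_cmp[OF assms(2) i(1)] i(2) on_arr_idn o by simp
  have 2: "cmp D (on_arr F f) (on_arr F (inv_arr C f)) = idn D (on_obj F B)"
    using on_arr_cmp[OF i(1) assms(2)] i(3) on_arr_idn o by simp
  show iso: "is_iso D (on_arr F f)" using cod.is_isoI[OF Ff Fi 1 2] .
  show "on_arr F (inv_arr C f) = inv_arr D (on_arr F f)"
    using cod.inv_arr_unique[OF iso Ff Fi 2] .
qed

text \<open>Since the objects of the target are hit on the nose, the quasi-inverse can be chosen
  strictly right inverse; the other natural isomorphism is the lift of the identities.\<close>

lemma is_equivalence_if_fully_faithful:
  assumes surj: "\<And>X. X \<in> obj D \<Longrightarrow> g X \<in> obj C \<and> on_obj F (g X) = X"
    and full: "\<And>A B h. A \<in> obj C \<Longrightarrow> B \<in> obj C \<Longrightarrow> h \<in> homs D (on_obj F A) (on_obj F B) \<Longrightarrow>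
      \<exists>f \<in> homs C A B. on_arr F f = h"
    and faithful: "\<And>A B f f'. f \<in> homs C A B \<Longrightarrow> f' \<in> homs C A B \<Longrightarrow>
      on_arr F f = on_arr F f' \<Longrightarrow> f = f'"
  shows "is_equivalence C D F"
proof -
  define lift where "lift A B h = (SOME f. f \<in> homs C A B \<and> on_arr F f = h)" for A B h
  have lift: "lift A B h \<in> homs C A B" "on_arr F (lift A B h) = h"
    if "A \<in> obj C" "B \<in> obj C" "h \<in> homs D (on_obj F A) (on_obj F B)" for A B h
    using someI_ex[of "\<lambda>f. f \<in> homs C A B \<and> on_arr F f = h"] full[OF that]
    unfolding lift_def by auto
  define G where "G = \<lparr>on_obj = g, on_arr = (\<lambda>h. lift (g (src D h)) (g (tgt D h)) h)\<rparr>"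
  have G: "on_arr G h \<in> homs C (g A) (g B)" "on_arr F (on_arr G h) = h"
    if "h \<in> homs D A B" for A B h
  proof -
    have "h \<in> homs D (on_obj F (g A)) (on_obj F (g B))" "src D h = A" "tgt D h = B"
      using that surj cod.homs_obj[OF that] by (auto simp: homs_iff)
    then show "on_arr G h \<in> homs C (g A) (g B)" "on_arr F (on_arr G h) = h"
      using lift surj cod.homs_obj[OF that] by (simp_all add: G_def)
  qed
  have fG: "is_functor D C G"
  proof
    show "on_obj G A \<in> obj C" if "A \<in> obj D" for A using that surj by (simp add: G_def)
    show "on_arr G f \<in> homs C (on_obj G A) (on_obj G B)" if "f \<in> homs D A B" for f A B
      using G that by (simp add: G_def)
    show "on_arr G (idn D A) = idn C (on_obj G A)" if "A \<in> obj D" for A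
    proof (rule faithful)
      show "on_arr G (idn D A) \<in> homs C (g A) (g A)" using G cod.idn_homs[OF that] by blast
      show "idn C (on_obj G A) \<in> homs C (g A) (g A)" using surj that dom.idn_homs by (simp add: G_def)
      show "on_arr F (on_arr G (idn D A)) = on_arr F (idn C (on_obj G A))"
        using G cod.idn_homs[OF that] on_arr_idn surj that by (simp add: G_def)
    qed
    show "on_arr G (cmp D k f) = cmp C (on_arr G k) (on_arr G f)"
      if "f \<in> homs D A B" "k \<in> homs D B E" for f A B k E
    proof (rule faithful)
      show "on_arr G (cmp D k f) \<in> homs C (g A) (g E)" using G cod.cmp_homs[OF that] by blast
      show "cmp C (on_arr G k) (on_arr G f) \<in> homs C (g A) (g E)"
        using G that dom.cmp_homs by blast
      show "on_arr F (on_arr G (cmp D k f)) = on_arr F (cmp C (on_arr G k) (on_arr G f))"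
        using G cod.cmp_homs[OF that] on_arr_cmp[OF G(1)[OF that(1)] G(1)[OF that(2)]] that by simp
    qed
  qed
  have surj': "A \<in> obj C \<Longrightarrow> g (on_obj F A) \<in> obj C \<and> on_obj F (g (on_obj F A)) = on_obj F A" for A
    using surj on_obj_obj by blast
  define \<eta> where "\<eta> A = lift (g (on_obj F A)) A (idn D (on_obj F A))" for A
  have \<eta>: "\<eta> A \<in> homs C (g (on_obj F A)) A" "on_arr F (\<eta> A) = idn D (on_obj F A)"
    if "A \<in> obj C" for A
    using lift[of "g (on_obj F A)" A "idn D (on_obj F A)"] that surj' cod.idn_homs on_obj_obj
    by (auto simp: \<eta>_def)
  have \<eta>_iso: "is_iso C (\<eta> A)" if A: "A \<in> obj C" for A
  proof -
    define \<theta> where "\<theta> = lift A (g (on_obj F A)) (idn D (on_obj F A))"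
    have \<theta>: "\<theta> \<in> homs C A (g (on_obj F A))" "on_arr F \<theta> = idn D (on_obj F A)"
      using lift[of A "g (on_obj F A)" "idn D (on_obj F A)"] A surj' cod.idn_homs on_obj_obj
      by (auto simp: \<theta>_def)
    have idem: "cmp D (idn D (on_obj F A)) (idn D (on_obj F A)) = idn D (on_obj F A)"
      using cod.cmp_idn_left[OF cod.idn_homs] on_obj_obj A by blast
    have "cmp C \<theta> (\<eta> A) = idn C (g (on_obj F A))"
      by (rule faithful[OF dom.cmp_homs[OF \<eta>(1)[OF A] \<theta>(1)]])
        (use A surj' dom.idn_homs on_arr_cmp[OF \<eta>(1)[OF A] \<theta>(1)] \<eta>(2) \<theta>(2) idem on_arr_idn in auto)
    moreover have "cmp C (\<eta> A) \<theta> = idn C A"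
      by (rule faithful[OF dom.cmp_homs[OF \<theta>(1) \<eta>(1)[OF A]]])
        (use A surj' dom.idn_homs on_arr_cmp[OF \<theta>(1) \<eta>(1)[OF A]] \<eta>(2) \<theta>(2) idem on_arr_idn in auto)
    ultimately show ?thesis using dom.is_isoI \<eta>(1)[OF A] \<theta>(1) by blast
  qed
  have "naturally_isomorphic C C (functor_comp G F) functor_id"
    unfolding naturally_isomorphic_def
  proof (intro exI[of _ \<eta>] conjI ballI)
    fix A assume "A \<in> obj C"
    then show "\<eta> A \<in> homs C (on_obj (functor_comp G F) A) (on_obj functor_id A)" "is_iso C (\<eta> A)"
      using \<eta> \<eta>_iso by (simp_all add: functor_comp_def functor_id_def G_def)
  next
    fix f assume "f \<in> arr C"
    then obtain A B where f: "f \<in> homs C A B" by (auto simp: homs_iff)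
    note Ff = on_arr_homs[OF f] and o = dom.homs_obj[OF f]
    note GFf = G[OF Ff]
    have "cmp C (\<eta> B) (on_arr G (on_arr F f)) = cmp C f (\<eta> A)"
    proof (rule faithful)
      show "cmp C (\<eta> B) (on_arr G (on_arr F f)) \<in> homs C (g (on_obj F A)) B"
        using dom.cmp_homs GFf \<eta> o by blast
      show "cmp C f (\<eta> A) \<in> homs C (g (on_obj F A)) B" using dom.cmp_homs f \<eta> o by blast
      show "on_arr F (cmp C (\<eta> B) (on_arr G (on_arr F f))) = on_arr F (cmp C f (\<eta> A))"
        using on_arr_cmp[OF GFf(1) \<eta>(1)[OF o(2)]] on_arr_cmp[OF \<eta>(1)[OF o(1)] f] GFf(2) \<eta>(2) o
          cod.cmp_idn_left[OF Ff] cod.cmp_idn_right[OF Ff] by simp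
    qed
    then show "cmp C (\<eta> (tgt C f)) (on_arr (functor_comp G F) f)
        = cmp C (on_arr functor_id f) (\<eta> (src C f))"
      using f by (simp add: functor_comp_def functor_id_def homs_iff)
  qed
  moreover have "naturally_isomorphic D D (functor_comp F G) functor_id"
    unfolding naturally_isomorphic_def
  proof (intro exI[of _ "idn D"] conjI ballI)
    fix A assume A: "A \<in> obj D"
    then show "idn D A \<in> homs D (on_obj (functor_comp F G) A) (on_obj functor_id A)"
      using cod.idn_homs surj by (simp add: functor_comp_def functor_id_def G_def)
    show "is_iso D (idn D A)" using A cod.is_iso_idn by blast
  next
    fix f assume "f \<in> arr D"
    then obtain A B where f: "f \<in> homs D A B" by (auto simp: homs_iff)
    show "cmp D (idn D (tgt D f)) (on_arr (functor_comp F G) f)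
        = cmp D (on_arr functor_id f) (idn D (src D f))"
      using f G[OF f] cod.cmp_idn_left[OF f] cod.cmp_idn_right[OF f]
      by (simp add: functor_comp_def functor_id_def homs_iff)
  qed
  ultimately show ?thesis unfolding is_equivalence_def using fG is_functor_axioms by blast
qed

end

section \<open>The universal property of the category of fractions\<close>

text \<open>The condition on identities makes the relation between an identity and the empty path speak about
  objects of the category only.\<close>

locale fractions_base = category C for C :: "('o, 'm) cat" +
  fixes S :: "'m set"
  assumes S_arr: "s \<in> S \<Longrightarrow> s \<in> arr C"
    and idn_arr_obj: "idn C A \<in> arr C \<Longrightarrow> A \<in> obj C"
begin

abbreviation "path \<equiv> is_path C S"
abbreviation "equi \<equiv> path_equiv C S"

lemma letter_obj: "is_letter C S l \<Longrightarrow> letter_src C l \<in> obj C \<and> letter_tgt C l \<in> obj C"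
  using src_obj tgt_obj by (cases l) auto

lemma path_obj: "path A us B \<Longrightarrow> A \<in> obj C \<and> B \<in> obj C"
proof (induction us arbitrary: A)
  case (Cons l us) then show ?case using letter_obj[of l] by auto
qed auto

lemma path_append: "path A (us @ vs) B \<longleftrightarrow> (\<exists>M. path A us M \<and> path M vs B)"
proof (induction us arbitrary: A)
  case Nil then show ?case using path_obj by auto
qed auto

lemma path_tgt_unique: "path A us M \<Longrightarrow> path A us M' \<Longrightarrow> M = M'"
  by (induction us arbitrary: A) auto

lemma equi_path: "equi A B us vs \<Longrightarrow> path A us B \<and> path A vs B"
  by (induction rule: path_equiv.induct) auto

lemma path_appendI: "path A us M \<Longrightarrow> path M vs B \<Longrightarrow> path A (us @ vs) B"
  using path_append by blast

lemma equi_append: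
  assumes "equi A M us us'" "equi M B vs vs'"
  shows "equi A B (us @ vs) (us' @ vs')"
proof -
  have 1: "path M vs B" "path A us' M" using equi_path assms by blast+
  have "equi A B (us @ vs) (us' @ vs)"
    using assms(1)
  proof (induction rule: path_equiv.induct)
    case (elementary l r xs ys)
    have "path A (xs @ l @ (ys @ vs)) B" "path A (xs @ r @ (ys @ vs)) B"
      using path_appendI[OF elementary(2) 1(1)] path_appendI[OF elementary(3) 1(1)] by simp_all
    then show ?case using path_equiv.elementary[OF elementary(1), of S A xs "ys @ vs" B] by simp
  next
    case (refl us) show ?case by (rule path_equiv.refl[OF path_appendI[OF refl 1(1)]])
  next
    case (sym us vs) show ?case by (rule path_equiv.sym[OF sym(2)])
  next
    case (trans us vs ws) show ?case by (rule path_equiv.trans[OF trans(3,4)])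
  qed
  moreover have "equi A B (us' @ vs) (us' @ vs')"
    using assms(2)
  proof (induction rule: path_equiv.induct)
    case (elementary l r xs ys)
    have "path A ((us' @ xs) @ l @ ys) B" "path A ((us' @ xs) @ r @ ys) B"
      using path_appendI[OF 1(2) elementary(2)] path_appendI[OF 1(2) elementary(3)] by simp_all
    then show ?case using path_equiv.elementary[OF elementary(1), of S A "us' @ xs" ys B] by simp
  next
    case (refl us) show ?case by (rule path_equiv.refl[OF path_appendI[OF 1(2) refl]])
  next
    case (sym us vs) show ?case by (rule path_equiv.sym[OF sym(2)])
  next
    case (trans us vs ws) show ?case by (rule path_equiv.trans[OF trans(3,4)])
  qed
  ultimately show ?thesis by (rule path_equiv.trans)
qed

lemma path_class_eq: "path A us B \<Longrightarrow> path_class C S A B us = path_class C S A B vs \<longleftrightarrow> equi A B us vs"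
  unfolding path_class_def
  by (auto dest: path_equiv.refl intro: path_equiv.sym path_equiv.trans)

abbreviation "Fr \<equiv> fractions C S"

definition frac :: "'o \<Rightarrow> 'm letter list \<Rightarrow> 'o \<Rightarrow> 'o \<times> 'm letter list set \<times> 'o" where
  "frac A us B = (A, path_class C S A B us, B)"

lemma frac_eqI: "equi A B us vs \<Longrightarrow> frac A us B = frac A vs B"
  using path_class_eq equi_path by (simp add: frac_def)

lemma obj_Fr [simp]: "obj Fr = obj C"
  by (simp add: fractions_def)

lemma homs_Fr: "\<alpha> \<in> homs Fr A B \<longleftrightarrow> (\<exists>us. path A us B \<and> \<alpha> = frac A us B)"
  by (auto simp: homs_iff fractions_def frac_def)

lemma frac_homs: "path A us B \<Longrightarrow> frac A us B \<in> homs Fr A B"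
  using homs_Fr by blast

lemma idn_Fr: "idn Fr A = frac A [] A"
  by (simp add: fractions_def frac_def)

lemma cmp_frac:
  assumes "path A us B" "path B vs E"
  shows "cmp Fr (frac B vs E) (frac A us B) = frac A (us @ vs) E"
proof -
  have "(\<exists>us' \<in> path_class C S A B us. \<exists>vs' \<in> path_class C S B E vs. equi A E (us' @ vs') ws)
     \<longleftrightarrow> equi A E (us @ vs) ws" (is "?L \<longleftrightarrow> ?R") for ws
  proof
    assume ?L
    then obtain us' vs' where "equi A B us us'" "equi B E vs vs'" "equi A E (us' @ vs') ws"
      by (auto simp: path_class_def)
    then show ?R using path_equiv.trans[OF equi_append] by blast
  next
    assume ?R
    then show ?L using path_equiv.refl[OF assms(1)] path_equiv.refl[OF assms(2)]
      by (auto simp: path_class_def)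
  qed
  then show ?thesis by (simp add: fractions_def frac_def path_class_def)
qed

lemma category_Fr: "category Fr"
proof
  show "src Fr \<alpha> \<in> obj Fr" "tgt Fr \<alpha> \<in> obj Fr" if "\<alpha> \<in> arr Fr" for \<alpha>
    using that path_obj by (auto simp: fractions_def)
  show "idn Fr A \<in> homs Fr A A" if "A \<in> obj Fr" for A
    using that by (auto simp: idn_Fr intro: frac_homs)
  show "cmp Fr \<beta> \<alpha> \<in> homs Fr A E" if "\<alpha> \<in> homs Fr A B" "\<beta> \<in> homs Fr B E" for \<alpha> \<beta> A B E
    using that cmp_frac path_appendI by (fastforce simp: homs_Fr)
  show "cmp Fr (idn Fr B) \<alpha> = \<alpha>" if "\<alpha> \<in> homs Fr A B" for \<alpha> A B
    using that path_obj cmp_frac[of A _ B "[]" B] by (auto simp: homs_Fr idn_Fr)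
  show "cmp Fr \<alpha> (idn Fr A) = \<alpha>" if "\<alpha> \<in> homs Fr A B" for \<alpha> A B
    using that path_obj cmp_frac[of A "[]" A _ B] by (auto simp: homs_Fr idn_Fr)
  show "cmp Fr \<gamma> (cmp Fr \<beta> \<alpha>) = cmp Fr (cmp Fr \<gamma> \<beta>) \<alpha>"
    if h: "\<alpha> \<in> homs Fr A B" "\<beta> \<in> homs Fr B D" "\<gamma> \<in> homs Fr D E" for \<alpha> \<beta> \<gamma> A B D E
  proof -
    obtain us vs ws where p: "path A us B" "path B vs D" "path D ws E"
      and e: "\<alpha> = frac A us B" "\<beta> = frac B vs D" "\<gamma> = frac D ws E"
      using h by (auto simp: homs_Fr)
    moreover have "path A (us @ vs) D" "path B (vs @ ws) E" using p path_append by blast+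
    ultimately show ?thesis by (simp add: cmp_frac)
  qed
qed

sublocale Fr: category Fr by (rule category_Fr)

abbreviation "loc \<equiv> on_arr (to_fractions C S)"

lemma loc_eq: "f \<in> homs C A B \<Longrightarrow> loc f = frac A [Fwd f] B"
  by (auto simp: to_fractions_def frac_def homs_iff)

lemma Fwd_path: "f \<in> homs C A B \<Longrightarrow> path A [Fwd f] B"
  using tgt_obj by (auto simp: homs_iff)

lemma loc_homs: "f \<in> homs C A B \<Longrightarrow> loc f \<in> homs Fr A B"
  by (simp only: loc_eq) (rule frac_homs[OF Fwd_path])

lemma loc_idn: "A \<in> obj C \<Longrightarrow> loc (idn C A) = idn Fr A"
proof -
  assume A: "A \<in> obj C"
  have "equi A A ([] @ [Fwd (idn C A)] @ []) ([] @ [] @ [])"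
    by (rule path_equiv.elementary[OF path_relation.intros(1)])
      (use A idn_homs[OF A] Fwd_path[of "idn C A"] in auto)
  then show ?thesis using loc_eq[OF idn_homs[OF A]] frac_eqI by (auto simp: idn_Fr)
qed

lemma loc_cmp:
  assumes f: "f \<in> homs C A B" and g: "g \<in> homs C B E"
  shows "loc (cmp C g f) = cmp Fr (loc g) (loc f)"
proof -
  have "equi A E ([] @ [Fwd f, Fwd g] @ []) ([] @ [Fwd (cmp C g f)] @ [])"
    by (rule path_equiv.elementary[OF path_relation.intros(2)])
      (use f g Fwd_path[OF cmp_homs[OF f g]] tgt_obj in \<open>auto simp: homs_iff\<close>)
  then show ?thesis
    using loc_eq[OF cmp_homs[OF f g]] loc_eq[OF f] loc_eq[OF g]
      cmp_frac[OF Fwd_path[OF f] Fwd_path[OF g]] frac_eqI by fastforce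
qed

sublocale loc: is_functor C Fr "to_fractions C S"
proof
  show "on_obj (to_fractions C S) A \<in> obj Fr" if "A \<in> obj C" for A
    using that by (simp add: to_fractions_def)
  show "loc f \<in> homs Fr (on_obj (to_fractions C S) A) (on_obj (to_fractions C S) B)"
    if "f \<in> homs C A B" for f A B
    using that loc_homs by (simp add: to_fractions_def)
  show "loc (idn C A) = idn Fr (on_obj (to_fractions C S) A)" if "A \<in> obj C" for A
    using that loc_idn by (simp add: to_fractions_def)
qed (rule loc_cmp)

lemma
  assumes s: "s \<in> S" "s \<in> homs C A B"
  shows Bwd_path: "path B [Bwd s] A"
    and loc_S_is_iso: "is_iso Fr (loc s)"
    and frac_Bwd: "frac B [Bwd s] A = inv_arr Fr (loc s)"
proof -
  show p: "path B [Bwd s] A" using s homs_obj by (auto simp: homs_iff)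
  note f = Fwd_path[OF s(2)]
  have 1: "equi A A ([] @ [Fwd s, Bwd s] @ []) ([] @ [] @ [])"
    by (rule path_equiv.elementary[OF path_relation.intros(3)])
      (use f p s homs_obj in \<open>auto simp: homs_iff\<close>)
  have 2: "equi B B ([] @ [Bwd s, Fwd s] @ []) ([] @ [] @ [])"
    by (rule path_equiv.elementary[OF path_relation.intros(4)])
      (use f p s homs_obj in \<open>auto simp: homs_iff\<close>)
  have 3: "cmp Fr (frac B [Bwd s] A) (loc s) = idn Fr A"
    using frac_eqI[OF 1] cmp_frac[OF f p] loc_eq[OF s(2)] by (simp add: idn_Fr)
  have 4: "cmp Fr (loc s) (frac B [Bwd s] A) = idn Fr B"
    using frac_eqI[OF 2] cmp_frac[OF p f] loc_eq[OF s(2)] by (simp add: idn_Fr)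
  show "is_iso Fr (loc s)" using Fr.is_isoI[OF loc_homs[OF s(2)] frac_homs[OF p] 3 4] .
  then show "frac B [Bwd s] A = inv_arr Fr (loc s)"
    using Fr.inv_arr_unique[OF _ loc_homs[OF s(2)] frac_homs[OF p] 4] by blast
qed

text \<open>A morphism of fractions is peeled off at its source, so that a fraction \<open>t\<inverse> f\<close> for the remaining part
  only has to be composed with one letter on the right.\<close>

lemma fractions_induct [consumes 1, case_names idn fwd bwd]:
  assumes "\<alpha> \<in> homs Fr A B"
    and "\<And>A. A \<in> obj C \<Longrightarrow> P A A (idn Fr A)"
    and "\<And>f \<alpha> A M B. \<lbrakk>f \<in> homs C A M; \<alpha> \<in> homs Fr M B; P M B \<alpha>\<rbrakk> \<Longrightarrow> P A B (cmp Fr \<alpha> (loc f))"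
    and "\<And>s \<alpha> A M B. \<lbrakk>s \<in> S; s \<in> homs C M A; \<alpha> \<in> homs Fr M B; P M B \<alpha>\<rbrakk>
      \<Longrightarrow> P A B (cmp Fr \<alpha> (inv_arr Fr (loc s)))"
  shows "P A B \<alpha>"
proof -
  have "path A us B \<Longrightarrow> P A B (frac A us B)" for us
  proof (induction us arbitrary: A)
    case Nil then show ?case using assms(2) by (auto simp: idn_Fr)
  next
    case (Cons l us)
    then have IH: "path (letter_tgt C l) us B" "P (letter_tgt C l) B (frac (letter_tgt C l) us B)"
      by auto
    show ?case
    proof (cases l)
      case (Fwd f)
      then have f: "f \<in> homs C A (tgt C f)" using Cons.prems by (auto simp: homs_iff)
      have IH': "path (tgt C f) us B" "P (tgt C f) B (frac (tgt C f) us B)" using IH Fwd by auto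
      show ?thesis using cmp_frac[OF Fwd_path[OF f] IH'(1)] assms(3)[OF f frac_homs[OF IH'(1)] IH'(2)]
        by (simp add: loc_eq[OF f] Fwd)
    next
      case (Bwd s)
      then have s: "s \<in> S" "s \<in> homs C (src C s) A" using Cons.prems by (auto simp: homs_iff)
      have IH': "path (src C s) us B" "P (src C s) B (frac (src C s) us B)" using IH Bwd by auto
      show ?thesis using cmp_frac[OF Bwd_path[OF s] IH'(1)] assms(4)[OF s frac_homs[OF IH'(1)] IH'(2)]
        by (simp add: frac_Bwd[OF s, symmetric] Bwd)
    qed
  qed
  then show ?thesis using assms(1) by (auto simp: homs_Fr)
qed

text \<open>The functor evaluates a path letter by letter; each generating relation becomes an identity in the
  target. Uniqueness is induction on paths, since functors preserve inverses.\<close>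

theorem induced_functor_exists:
  assumes F: "is_functor C D F" and inv: "inverts C S D F"
  shows "\<exists>G. is_induced_functor C S D F G"
proof -
  interpret F: is_functor C D F by (rule F)
  define ltr where "ltr l = (case l of Fwd f \<Rightarrow> on_arr F f | Bwd s \<Rightarrow> inv_arr D (on_arr F s))" for l
  define ev where "ev A us = fold (\<lambda>l x. cmp D (ltr l) x) us (idn D (on_obj F A))" for A us
  have iso: "is_iso D (on_arr F s)" if "s \<in> S" for s using inv that by (auto simp: inverts_def)
  have ltr: "ltr l \<in> homs D (on_obj F (letter_src C l)) (on_obj F (letter_tgt C l))"
    if "is_letter C S l" for l
  proof (cases l)
    case (Fwd f) then show ?thesis using that F.on_arr_homs[of f] by (auto simp: ltr_def homs_iff)
  next
    case (Bwd s)
    then have "s \<in> S" "s \<in> homs C (src C s) (tgt C s)" using that by (auto simp: homs_iff)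
    then show ?thesis using Bwd F.cod.inv_arr(1)[OF iso F.on_arr_homs] by (simp add: ltr_def)
  qed
  have fold_homs: "fold (\<lambda>l x. cmp D (ltr l) x) us x \<in> homs D Z (on_obj F B)"
    if "path A us B" "x \<in> homs D Z (on_obj F A)" for A us B x Z
    using that
  proof (induction us arbitrary: A x)
    case (Cons l us)
    then show ?case using F.cod.cmp_homs[OF Cons.prems(2)] ltr[of l] by auto
  qed auto
  have ev_homs: "ev A us \<in> homs D (on_obj F A) (on_obj F B)" if "path A us B" for A us B
    using fold_homs[OF that F.cod.idn_homs] path_obj[OF that] F.on_obj_obj by (simp add: ev_def)
  have fold_ev: "fold (\<lambda>l x. cmp D (ltr l) x) us x = cmp D (ev A us) x"
    if "path A us B" "x \<in> homs D Z (on_obj F A)" for A us B x Z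
    using that
  proof (induction us arbitrary: B rule: rev_induct)
    case Nil
    then show ?case using F.cod.cmp_idn_left by (simp add: ev_def)
  next
    case (snoc l us)
    then obtain M where p: "path A us M" "path M [l] B" using path_append by blast
    have "ltr l \<in> homs D (on_obj F M) (on_obj F B)" using ltr[of l] p(2) by auto
    then show ?case using snoc.IH[OF p(1) snoc.prems(2)]
        F.cod.cmp_assoc[OF snoc.prems(2) ev_homs[OF p(1)]] by (simp add: ev_def)
  qed
  have ev_append: "ev A (us @ vs) = cmp D (ev B vs) (ev A us)"
    if "path A us B" "path B vs E" for A us B vs E
    using fold_ev[OF that(2) ev_homs[OF that(1)]] by (simp add: ev_def)
  have ev_single: "ev A [l] = ltr l" if "path A [l] B" for A l B
    using that ltr[of l] F.cod.cmp_idn_right by (auto simp: ev_def)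
  have ev_rel: "ev M l = ev M r" if "path_relation C l r" "path M l N" "path M r N" for l r M N
    using that
  proof (induction rule: path_relation.induct)
    case (1 A)
    then have "A \<in> obj C" using idn_arr_obj by simp
    moreover have "M = A" using 1 idn_homs[OF \<open>A \<in> obj C\<close>] by (auto simp: homs_iff)
    ultimately show ?case using 1 ev_single[OF 1(1)] F.on_arr_idn by (simp add: ltr_def ev_def)
  next
    case (2 f g)
    then have f: "f \<in> homs C M (src C g)" "g \<in> homs C (src C g) N" by (auto simp: homs_iff)
    have "ev M [Fwd f, Fwd g] = cmp D (ev (src C g) [Fwd g]) (ev M [Fwd f])"
      using ev_append[OF Fwd_path[OF f(1)] Fwd_path[OF f(2)]] by simp
    then show ?case using ev_single[OF Fwd_path[OF f(1)]] ev_single[OF Fwd_path[OF f(2)]]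
        ev_single[OF 2(3)] F.on_arr_cmp[OF f] by (simp add: ltr_def)
  next
    case (3 s)
    then have s: "s \<in> S" "s \<in> homs C M (tgt C s)" and MN: "M = N" by (auto simp: homs_iff)
    have "ev M [Fwd s, Bwd s] = cmp D (ev (tgt C s) [Bwd s]) (ev M [Fwd s])"
      using ev_append[OF Fwd_path[OF s(2)] Bwd_path[OF s]] by simp
    then show ?case using ev_single[OF Fwd_path[OF s(2)]] ev_single[OF Bwd_path[OF s]]
        F.cod.inv_arr(2)[OF iso[OF s(1)] F.on_arr_homs[OF s(2)]] MN by (simp add: ltr_def ev_def)
  next
    case (4 s)
    then have s: "s \<in> S" "s \<in> homs C (src C s) M" and MN: "M = N" by (auto simp: homs_iff)
    have "ev M [Bwd s, Fwd s] = cmp D (ev (src C s) [Fwd s]) (ev M [Bwd s])"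
      using ev_append[OF Bwd_path[OF s] Fwd_path[OF s(2)]] by simp
    then show ?case using ev_single[OF Fwd_path[OF s(2)]] ev_single[OF Bwd_path[OF s]]
        F.cod.inv_arr(3)[OF iso[OF s(1)] F.on_arr_homs[OF s(2)]] MN by (simp add: ltr_def ev_def)
  qed
  have ev_equi: "ev A us = ev A vs" if "equi A B us vs" for A B us vs
    using that
  proof (induction rule: path_equiv.induct)
    case (elementary l r xs ys)
    obtain M N where p: "path A xs M" "path M l N" "path N ys B"
      using elementary(2) path_append by blast
    obtain M' N' where p': "path A xs M'" "path M' r N'" "path N' ys B"
      using elementary(3) path_append by blast
    have M: "M' = M" using p p' path_tgt_unique by blast
    \<comment> \<open>both sides of a relation end at the same object, also when one of them is empty\<close>
    have N: "N' = N"
      using elementary(1) p(2) p'(2) unfolding M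
    proof (induction rule: path_relation.induct)
      case (1 A)
      then have "A \<in> obj C" using idn_arr_obj by simp
      then show ?case using 1 idn_homs by (auto simp: homs_iff)
    next
      case (2 f g)
      then have f: "f \<in> homs C M (src C g)" "g \<in> homs C (src C g) N" by (auto simp: homs_iff)
      then show ?case using 2 cmp_homs[OF f] by (auto simp: homs_iff)
    qed auto
    note pr = p'[unfolded M N]
    have q: "path M (l @ ys) B" "path M (r @ ys) B" using p pr path_append by blast+
    show ?case
      using ev_append[OF p(1) q(1)] ev_append[OF p(1) q(2)] ev_append[OF p(2,3)]
        ev_append[OF pr(2,3)] ev_rel[OF elementary(1) p(2) pr(2)] by simp
  qed auto
  define G where "G = \<lparr>on_obj = on_obj F, on_arr = (\<lambda>(A :: 'o, X, B :: 'o). ev A (SOME us. us \<in> X))\<rparr>"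
  have G_frac: "on_arr G (frac A us B) = ev A us" if "path A us B" for A us B
  proof -
    have "us \<in> path_class C S A B us" using that path_equiv.refl by (auto simp: path_class_def)
    then have "(SOME vs. vs \<in> path_class C S A B us) \<in> path_class C S A B us" by (rule someI)
    then show ?thesis using ev_equi by (simp add: G_def frac_def path_class_def)
  qed
  have fG: "is_functor Fr D G"
  proof
    show "on_obj G A \<in> obj D" if "A \<in> obj Fr" for A
      using that F.on_obj_obj by (simp add: G_def)
    show "on_arr G \<alpha> \<in> homs D (on_obj G A) (on_obj G B)" if "\<alpha> \<in> homs Fr A B" for \<alpha> A B
      using that G_frac ev_homs by (auto simp: homs_Fr) (simp add: G_def)
    show "on_arr G (idn Fr A) = idn D (on_obj G A)" if "A \<in> obj Fr" for A
      using that G_frac[of A "[]" A] by (simp add: idn_Fr ev_def) (simp add: G_def)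
    show "on_arr G (cmp Fr \<beta> \<alpha>) = cmp D (on_arr G \<beta>) (on_arr G \<alpha>)"
      if h: "\<alpha> \<in> homs Fr A B" "\<beta> \<in> homs Fr B E" for \<alpha> \<beta> A B E
    proof -
      obtain us vs where p: "path A us B" "path B vs E" "\<alpha> = frac A us B" "\<beta> = frac B vs E"
        using h unfolding homs_Fr by blast
      moreover have "path A (us @ vs) E" using p path_append by blast
      ultimately show ?thesis by (simp add: cmp_frac ev_append[OF p(1,2)] G_frac)
    qed
  qed
  have GL: "functor_eq C (functor_comp G (to_fractions C S)) F"
  proof -
    have "on_arr G (loc f) = on_arr F f" if "f \<in> arr C" for f
    proof -
      have f: "f \<in> homs C (src C f) (tgt C f)" using that by (simp add: homs_iff)
      then show ?thesis
        using loc_eq[OF f] G_frac[OF Fwd_path[OF f]] ev_single[OF Fwd_path[OF f]] by (simp add: ltr_def)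
    qed
    then show ?thesis
      by (auto simp: functor_eq_def functor_comp_def) (simp add: G_def to_fractions_def)
  qed
  have "functor_eq Fr G' G" if G': "is_functor Fr D G'"
    and G'L: "functor_eq C (functor_comp G' (to_fractions C S)) F" for G'
  proof -
    interpret G': is_functor Fr D G' by (rule G')
    interpret G: is_functor Fr D G by (rule fG)
    have agree: "on_arr G' (loc f) = on_arr G (loc f)" if "f \<in> homs C A B" for f A B
      using that G'L GL by (auto simp: functor_eq_def functor_comp_def homs_iff)
    have obj: "on_obj G' A = on_obj G A" if "A \<in> obj C" for A
      using that G'L GL by (auto simp: functor_eq_def functor_comp_def to_fractions_def)
    have "on_arr G' \<alpha> = on_arr G \<alpha>" if "\<alpha> \<in> homs Fr A B" for \<alpha> A B
      using that
    proof (induction rule: fractions_induct)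
      case (idn A) then show ?case using obj G.on_arr_idn G'.on_arr_idn by simp
    next
      case (fwd f \<alpha> A M B)
      then show ?case
        using agree[OF fwd(1)] G.on_arr_cmp[OF loc_homs fwd(2)] G'.on_arr_cmp[OF loc_homs fwd(2)] by simp
    next
      case (bwd s \<alpha> A M B)
      note s = loc_homs[OF bwd(2)] and i = loc_S_is_iso[OF bwd(1,2)]
      note si = Fr.inv_arr(1)[OF i s]
      show ?case
        using agree[OF bwd(2)] G.is_iso_on_arr(2)[OF i s] G'.is_iso_on_arr(2)[OF i s] bwd(4)
          G.on_arr_cmp[OF si bwd(3)] G'.on_arr_cmp[OF si bwd(3)] by simp
    qed
    then show ?thesis using obj by (auto simp: functor_eq_def homs_iff)
  qed
  then show ?thesis unfolding is_induced_functor_def using fG GL by blast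
qed

end

section \<open>Spans, subspaces and linear maps\<close>

text \<open>Spans are taken of lists rather than of sets, to allow inductions that add one vector at a time.\<close>

fun lin :: "('k, 'r) ring_scheme \<Rightarrow> ('k, 'a, 'v) module_scheme \<Rightarrow> 'a list \<Rightarrow> 'a set" where
  "lin K V [] = {\<zero>\<^bsub>V\<^esub>}"
| "lin K V (x # xs) = {c \<odot>\<^bsub>V\<^esub> x \<oplus>\<^bsub>V\<^esub> v | c v. c \<in> carrier K \<and> v \<in> lin K V xs}"

lemma lin_carrier_update [simp]: "lin K (V\<lparr>carrier := U\<rparr>) xs = lin K V xs"
  by (induction xs) auto

lemma lin_cong:
  "\<lbrakk>zero V' = zero V; add V' = add V; smult V' = smult V\<rbrakk> \<Longrightarrow> lin K V' xs = lin K V xs"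
  by (induction xs) auto

lemma module_cong:
  assumes "module K V" "carrier V' = carrier V" "zero V' = zero V" "add V' = add V" "smult V' = smult V"
  shows "module K V'"
proof -
  interpret module K V by (rule assms(1))
  show ?thesis
  proof (rule moduleI)
    show "abelian_group V'"
      by (rule abelian_groupI)
        (use assms(2-) M.a_assoc M.a_comm M.l_neg in \<open>auto intro!: bexI[of _ "\<ominus>\<^bsub>V\<^esub> _"]\<close>)
  qed (use assms(2-) smult_l_distr smult_r_distr smult_assoc1 R.is_cring in auto)
qed

context module
begin

lemma submoduleI':
  assumes "H \<subseteq> carrier M" "\<zero>\<^bsub>M\<^esub> \<in> H" "\<And>a b. a \<in> H \<Longrightarrow> b \<in> H \<Longrightarrow> a \<oplus>\<^bsub>M\<^esub> b \<in> H"
    "\<And>a x. a \<in> carrier R \<Longrightarrow> x \<in> H \<Longrightarrow> a \<odot>\<^bsub>M\<^esub> x \<in> H"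
  shows "submodule H R M"
proof (rule submoduleI)
  fix a assume a: "a \<in> H"
  then have "(\<ominus> \<one>) \<odot>\<^bsub>M\<^esub> a = \<ominus>\<^bsub>M\<^esub> a" using assms(1) by (subst smult_l_minus) auto
  then show "\<ominus>\<^bsub>M\<^esub> a \<in> H" using assms(4)[of "\<ominus> \<one>" a] a by simp
qed (use assms in auto)

lemma submodule_zero: "submodule H R M \<Longrightarrow> \<zero>\<^bsub>M\<^esub> \<in> H"
  using subgroup.one_closed[of H "add_monoid M"] by (simp add: submodule_def)

lemma submodule_minus: "submodule H R M \<Longrightarrow> a \<in> H \<Longrightarrow> b \<in> H \<Longrightarrow> a \<ominus>\<^bsub>M\<^esub> b \<in> H"
  using submoduleE by (simp add: M.minus_eq)

lemma lin_submodule: "set xs \<subseteq> carrier M \<Longrightarrow> submodule (lin R M xs) R M"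
proof (induction xs)
  case Nil then show ?case by (auto intro!: submoduleI')
next
  case (Cons x xs)
  then have x: "x \<in> carrier M" and H: "submodule (lin R M xs) R M" by auto
  note S = submoduleE[OF H] submodule_zero[OF H]
  have sub: "\<And>v. v \<in> lin R M xs \<Longrightarrow> v \<in> carrier M" using S(1) by blast
  show ?case
  proof (rule submoduleI')
    show "lin R M (x # xs) \<subseteq> carrier M" using x sub by auto
    have "\<zero>\<^bsub>M\<^esub> = \<zero> \<odot>\<^bsub>M\<^esub> x \<oplus>\<^bsub>M\<^esub> \<zero>\<^bsub>M\<^esub>" using x by simp
    then show "\<zero>\<^bsub>M\<^esub> \<in> lin R M (x # xs)" using S(7) by auto
  next
    fix a b assume "a \<in> lin R M (x # xs)" "b \<in> lin R M (x # xs)"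
    then obtain c v d w where e: "a = c \<odot>\<^bsub>M\<^esub> x \<oplus>\<^bsub>M\<^esub> v" "b = d \<odot>\<^bsub>M\<^esub> x \<oplus>\<^bsub>M\<^esub> w"
      "c \<in> carrier R" "d \<in> carrier R" "v \<in> lin R M xs" "w \<in> lin R M xs" by auto
    then have "a \<oplus>\<^bsub>M\<^esub> b = (c \<oplus> d) \<odot>\<^bsub>M\<^esub> x \<oplus>\<^bsub>M\<^esub> (v \<oplus>\<^bsub>M\<^esub> w)"
      using x sub by (simp add: smult_l_distr M.a_ac)
    then show "a \<oplus>\<^bsub>M\<^esub> b \<in> lin R M (x # xs)" using e S(5) by auto
  next
    fix r a assume r: "r \<in> carrier R" and "a \<in> lin R M (x # xs)"
    then obtain c v where e: "a = c \<odot>\<^bsub>M\<^esub> x \<oplus>\<^bsub>M\<^esub> v" "c \<in> carrier R" "v \<in> lin R M xs" by auto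
    then have "r \<odot>\<^bsub>M\<^esub> a = (r \<otimes> c) \<odot>\<^bsub>M\<^esub> x \<oplus>\<^bsub>M\<^esub> r \<odot>\<^bsub>M\<^esub> v"
      using x sub r by (simp add: smult_r_distr smult_assoc1)
    then show "r \<odot>\<^bsub>M\<^esub> a \<in> lin R M (x # xs)" using e S(4) r by auto
  qed
qed

lemma lin_subset: "submodule H R M \<Longrightarrow> set xs \<subseteq> H \<Longrightarrow> lin R M xs \<subseteq> H"
  by (induction xs) (use submodule_zero submoduleE in auto)

lemma lin_incl: "set xs \<subseteq> carrier M \<Longrightarrow> set xs \<subseteq> lin R M xs"
proof (induction xs)
  case (Cons x xs)
  then have H: "submodule (lin R M xs) R M" and x: "x \<in> carrier M" using lin_submodule by auto
  have "x = \<one> \<odot>\<^bsub>M\<^esub> x \<oplus>\<^bsub>M\<^esub> \<zero>\<^bsub>M\<^esub>" using x by simp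
  moreover have "v = \<zero> \<odot>\<^bsub>M\<^esub> x \<oplus>\<^bsub>M\<^esub> v" if "v \<in> lin R M xs" for v
    using x that submoduleE(1)[OF H] by (auto simp: subset_iff)
  ultimately show ?case using Cons submodule_zero[OF H] by fastforce
qed simp

lemma lin_Cons_mono: "set (x # xs) \<subseteq> carrier M \<Longrightarrow> lin R M xs \<subseteq> lin R M (x # xs)"
  by (rule lin_subset[OF lin_submodule]) (use lin_incl[of "x # xs"] in auto)

text \<open>From lists to sets: coefficients of repeated entries have to be added up.\<close>

lemma finite_dim_iff: "finite_dim R M \<longleftrightarrow> (\<exists>xs. set xs \<subseteq> carrier M \<and> lin R M xs = carrier M)"
proof
  assume "finite_dim R M"
  then obtain S where S: "finite S" "S \<subseteq> carrier M"
    "\<And>v. v \<in> carrier M \<Longrightarrow> \<exists>c \<in> S \<rightarrow> carrier R. v = (\<Oplus>\<^bsub>M\<^esub>s\<in>S. c s \<odot>\<^bsub>M\<^esub> s)"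
    unfolding finite_dim_def by blast
  obtain xs where xs: "set xs = S" using finite_list[OF S(1)] by blast
  note H = lin_submodule[of xs]
  have "(\<Oplus>\<^bsub>M\<^esub>s\<in>F. c s \<odot>\<^bsub>M\<^esub> s) \<in> lin R M xs"
    if "finite F" "F \<subseteq> S" "c \<in> S \<rightarrow> carrier R" for F c
    using that
  proof (induction F rule: finite_induct)
    case empty then show ?case using submodule_zero[OF H] S xs by simp
  next
    case (insert s F)
    have cs: "c t \<in> carrier R" "t \<in> carrier M" if "t \<in> insert s F" for t
      using that insert.prems S(2) by auto
    have "(\<Oplus>\<^bsub>M\<^esub>t\<in>insert s F. c t \<odot>\<^bsub>M\<^esub> t) = c s \<odot>\<^bsub>M\<^esub> s \<oplus>\<^bsub>M\<^esub> (\<Oplus>\<^bsub>M\<^esub>t\<in>F. c t \<odot>\<^bsub>M\<^esub> t)"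
      using insert.hyps cs by (intro M.finsum_insert) auto
    moreover have "s \<in> lin R M xs" using lin_incl[of xs] xs S(2) insert.prems by auto
    ultimately show ?case using insert H submoduleE(4,5)[OF H] cs xs S(2) by simp
  qed
  then have "carrier M \<subseteq> lin R M xs" using S by fastforce
  then show "\<exists>xs. set xs \<subseteq> carrier M \<and> lin R M xs = carrier M"
    using xs S(2) submoduleE(1)[OF H] by (intro exI[of _ xs]) auto
next
  have *: "\<exists>c \<in> set xs \<rightarrow> carrier R. v = (\<Oplus>\<^bsub>M\<^esub>s\<in>set xs. c s \<odot>\<^bsub>M\<^esub> s)"
    if "set xs \<subseteq> carrier M" "v \<in> lin R M xs" for xs v
    using that
  proof (induction xs arbitrary: v)
    case (Cons x xs)
    then obtain a w where v: "v = a \<odot>\<^bsub>M\<^esub> x \<oplus>\<^bsub>M\<^esub> w" "a \<in> carrier R" "w \<in> lin R M xs" by auto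
    from Cons.IH[OF _ v(3)] Cons.prems
    obtain c where c: "c \<in> set xs \<rightarrow> carrier R" "w = (\<Oplus>\<^bsub>M\<^esub>s\<in>set xs. c s \<odot>\<^bsub>M\<^esub> s)" by auto
    define F where "F = set xs - {x}"
    define c0 where "c0 = (if x \<in> set xs then c x else \<zero>)"
    have x: "x \<in> carrier M" and c0: "c0 \<in> carrier R" and F: "F \<subseteq> carrier M"
      using Cons.prems c(1) by (auto simp: c0_def F_def)
    have FM: "(\<lambda>s. c s \<odot>\<^bsub>M\<^esub> s) \<in> F \<rightarrow> carrier M" using c(1) F by (auto simp: F_def)
    define w' where "w' = (\<Oplus>\<^bsub>M\<^esub>s\<in>F. c s \<odot>\<^bsub>M\<^esub> s)"
    have w': "w' \<in> carrier M" using M.finsum_closed[OF FM] by (simp add: w'_def)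
    have ins: "(\<Oplus>\<^bsub>M\<^esub>s\<in>insert x F. (c(x := b)) s \<odot>\<^bsub>M\<^esub> s) = b \<odot>\<^bsub>M\<^esub> x \<oplus>\<^bsub>M\<^esub> w'"
      if "b \<in> carrier R" for b
    proof -
      have "(\<Oplus>\<^bsub>M\<^esub>s\<in>insert x F. (c(x := b)) s \<odot>\<^bsub>M\<^esub> s)
          = (c(x := b)) x \<odot>\<^bsub>M\<^esub> x \<oplus>\<^bsub>M\<^esub> (\<Oplus>\<^bsub>M\<^esub>s\<in>F. (c(x := b)) s \<odot>\<^bsub>M\<^esub> s)"
        using FM x that by (intro M.finsum_insert) (auto simp: F_def Pi_def)
      also have "(\<Oplus>\<^bsub>M\<^esub>s\<in>F. (c(x := b)) s \<odot>\<^bsub>M\<^esub> s) = w'"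
        unfolding w'_def using FM by (intro M.finsum_cong') (auto simp: F_def)
      finally show ?thesis by simp
    qed
    have "w = c0 \<odot>\<^bsub>M\<^esub> x \<oplus>\<^bsub>M\<^esub> w'"
    proof (cases "x \<in> set xs")
      case True
      then have "insert x F = set xs" "c0 = c x" by (auto simp: F_def c0_def)
      then show ?thesis using ins[OF c0] c(2) by (simp add: fun_upd_idem)
    next
      case False
      then have "F = set xs" "c0 = \<zero>" by (auto simp: F_def c0_def)
      then show ?thesis using c(2) x w' by (simp add: w'_def)
    qed
    then have "v = (a \<oplus> c0) \<odot>\<^bsub>M\<^esub> x \<oplus>\<^bsub>M\<^esub> w'"
      using v x w' c0 by (simp add: smult_l_distr M.a_assoc)
    moreover have "set (x # xs) = insert x F" by (auto simp: F_def)
    moreover have "c(x := a \<oplus> c0) \<in> insert x F \<rightarrow> carrier R"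
      using c(1) v(2) c0 by (auto simp: F_def)
    ultimately show ?case using ins[of "a \<oplus> c0"] v(2) c0 by (intro bexI[of _ "c(x := a \<oplus> c0)"]) auto
  qed simp
  assume "\<exists>xs. set xs \<subseteq> carrier M \<and> lin R M xs = carrier M"
  then obtain xs where "set xs \<subseteq> carrier M" "lin R M xs = carrier M" by blast
  then show "finite_dim R M" unfolding finite_dim_def
    using * by (intro exI[of _ "set xs"]) blast
qed

end

locale vec = R?: field R + module R M for R (structure) and M (structure)
begin

text \<open>Induction on the spanning list: modulo the span of the tail, the subspace is at most a line.\<close>

lemma submodule_lin:
  assumes "submodule U R M" "U \<subseteq> lin R M xs" "set xs \<subseteq> carrier M"
  shows "\<exists>ys. set ys \<subseteq> U \<and> lin R M ys = U"
  using assms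
proof (induction xs arbitrary: U)
  case Nil
  then show ?case using submodule_zero[OF Nil(1)] by (intro exI[of _ "[]"]) auto
next
  case (Cons x xs)
  have x: "x \<in> carrier M" and H: "submodule (lin R M xs) R M" using Cons.prems lin_submodule by auto
  note S = submoduleE[OF H] and T = submoduleE[OF Cons.prems(1)]
  have sub: "\<And>v. v \<in> lin R M xs \<Longrightarrow> v \<in> carrier M" using S(1) by blast
  have "submodule (U \<inter> lin R M xs) R M"
    by (rule submoduleI')
      (use S T submodule_zero[OF H] submodule_zero[OF Cons.prems(1)] in auto)
  with Cons.IH Cons.prems(3)
  obtain ys where ys: "set ys \<subseteq> U \<inter> lin R M xs" "lin R M ys = U \<inter> lin R M xs" by fastforce
  show ?case
  proof (cases "U \<subseteq> lin R M xs")
    case True then show ?thesis using ys by (intro exI[of _ ys]) auto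
  next
    case False
    then obtain u where u: "u \<in> U" "u \<notin> lin R M xs" by blast
    then obtain c v where cv: "u = c \<odot>\<^bsub>M\<^esub> x \<oplus>\<^bsub>M\<^esub> v" "c \<in> carrier R" "v \<in> lin R M xs"
      using Cons.prems(2) by auto
    have c0: "c \<noteq> \<zero>" using u(2) cv x sub by auto
    then have c: "inv c \<in> carrier R" "inv c \<otimes> c = \<one>" using cv(2) field_Units by auto
    have uc: "u \<in> carrier M" using u T by blast
    have "U \<subseteq> lin R M (u # ys)"
    proof
      fix w assume w: "w \<in> U"
      then obtain d v' where dv: "w = d \<odot>\<^bsub>M\<^esub> x \<oplus>\<^bsub>M\<^esub> v'" "d \<in> carrier R" "v' \<in> lin R M xs"
        using Cons.prems(2) by auto
      define e where "e = d \<otimes> inv c"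
      have e: "e \<in> carrier R" "e \<otimes> c = d" using dv c cv by (simp_all add: e_def m_assoc)
      have "e \<odot>\<^bsub>M\<^esub> u = d \<odot>\<^bsub>M\<^esub> x \<oplus>\<^bsub>M\<^esub> e \<odot>\<^bsub>M\<^esub> v"
        using cv x sub e by (simp add: smult_r_distr smult_assoc1[symmetric])
      then have "w \<ominus>\<^bsub>M\<^esub> e \<odot>\<^bsub>M\<^esub> u = v' \<ominus>\<^bsub>M\<^esub> e \<odot>\<^bsub>M\<^esub> v"
        using dv x sub e cv by (simp add: M.minus_eq M.minus_add M.a_ac M.r_neg1 M.r_neg2)
      moreover have "w \<ominus>\<^bsub>M\<^esub> e \<odot>\<^bsub>M\<^esub> u \<in> U"
        using submodule_minus[OF Cons.prems(1) w] T(4) e u(1) by simp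
      moreover have "v' \<ominus>\<^bsub>M\<^esub> e \<odot>\<^bsub>M\<^esub> v \<in> lin R M xs"
        using submodule_minus[OF H dv(3)] S(4) e cv(3) by simp
      ultimately have "w \<ominus>\<^bsub>M\<^esub> e \<odot>\<^bsub>M\<^esub> u \<in> U \<inter> lin R M xs" by simp
      moreover have "w = e \<odot>\<^bsub>M\<^esub> u \<oplus>\<^bsub>M\<^esub> (w \<ominus>\<^bsub>M\<^esub> e \<odot>\<^bsub>M\<^esub> u)"
        using w T uc e by (simp add: M.minus_eq M.a_ac M.r_neg M.r_neg2 subset_iff)
      ultimately show "w \<in> lin R M (u # ys)" using e ys by auto
    qed
    moreover have "lin R M (u # ys) \<subseteq> U" using u ys by (intro lin_subset Cons.prems) auto
    ultimately show ?thesis using u ys by (intro exI[of _ "u # ys"]) auto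
  qed
qed

lemma finite_dim_submodule:
  assumes "submodule U R M" "finite_dim R M"
  shows "finite_dim R (M\<lparr>carrier := U\<rparr>)"
proof -
  interpret U: module R "M\<lparr>carrier := U\<rparr>"
    using submodule.submodule_is_module[OF assms(1) module_axioms] .
  obtain xs where "set xs \<subseteq> carrier M" "lin R M xs = carrier M" using assms(2) finite_dim_iff by blast
  then show ?thesis
    using submodule_lin[OF assms(1), of xs] submoduleE(1)[OF assms(1)] U.finite_dim_iff by simp
qed

text \<open>Steinitz exchange: some list entry occurs in \<open>e\<close> with a nonzero coefficient and can be replaced by \<open>e\<close>.\<close>

lemma lin_exchange:
  assumes "set xs \<subseteq> carrier M" "e \<in> lin R M xs" "e \<noteq> \<zero>\<^bsub>M\<^esub>"
  shows "\<exists>ys. set ys \<subseteq> carrier M \<and> Suc (length ys) = length xs \<and> lin R M xs \<subseteq> lin R M (e # ys)"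
  using assms
proof (induction xs)
  case (Cons x xs)
  have x: "x \<in> carrier M" and H: "submodule (lin R M xs) R M" using Cons.prems lin_submodule by auto
  have sub: "\<And>v. v \<in> lin R M xs \<Longrightarrow> v \<in> carrier M" using submoduleE(1)[OF H] by blast
  obtain c v where cv: "e = c \<odot>\<^bsub>M\<^esub> x \<oplus>\<^bsub>M\<^esub> v" "c \<in> carrier R" "v \<in> lin R M xs"
    using Cons.prems by auto
  have e: "e \<in> carrier M" using cv x sub by simp
  show ?case
  proof (cases "c = \<zero>")
    case False
    then have c: "inv c \<in> carrier R" "inv c \<otimes> c = \<one>" using cv(2) field_Units by auto
    have "x = inv c \<odot>\<^bsub>M\<^esub> e \<oplus>\<^bsub>M\<^esub> (\<ominus> (inv c)) \<odot>\<^bsub>M\<^esub> v"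
      using cv x sub c
      by (simp add: smult_r_distr smult_assoc1[symmetric] smult_l_minus M.a_assoc M.r_neg)
    moreover have "(\<ominus> (inv c)) \<odot>\<^bsub>M\<^esub> v \<in> lin R M xs" using submoduleE(4)[OF H] cv c by simp
    ultimately have "x \<in> lin R M (e # xs)" using c by auto
    then have "lin R M (x # xs) \<subseteq> lin R M (e # xs)"
      using lin_incl[of "e # xs"] e Cons.prems by (intro lin_subset lin_submodule) auto
    then show ?thesis using Cons.prems by (intro exI[of _ xs]) auto
  next
    case True
    then have "e \<in> lin R M xs" using cv x sub by simp
    then obtain ys where ys: "set ys \<subseteq> carrier M" "Suc (length ys) = length xs"
      "lin R M xs \<subseteq> lin R M (e # ys)" using Cons by auto
    have "set xs \<subseteq> lin R M (e # ys)" using ys(3) lin_incl[of xs] Cons.prems by auto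
    moreover have sub: "set (e # x # ys) \<subseteq> carrier M" using e x ys(1) by simp
    moreover have "lin R M (e # ys) \<subseteq> lin R M (e # x # ys)"
      by (rule lin_subset[OF lin_submodule[OF sub]]) (use lin_incl[OF sub] in \<open>simp del: lin.simps\<close>)
    moreover have "x \<in> lin R M (e # x # ys)" using lin_incl[OF sub] by (simp del: lin.simps)
    ultimately have "lin R M (x # xs) \<subseteq> lin R M (e # x # ys)"
      by (intro lin_subset[OF lin_submodule[OF sub]]) (auto simp del: lin.simps)
    then show ?thesis using ys x by (intro exI[of _ "x # ys"]) (auto simp del: lin.simps)
  qed
qed simp

end

locale linear_map = V: module K V + W: module K W
  for K :: "('k, 'r) ring_scheme" and V :: "('k, 'a, 'v) module_scheme"
    and W :: "('k, 'b, 'w) module_scheme" +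
  fixes f
  assumes linear: "is_linear K V W f"
begin

lemma map_closed [simp, intro]: "x \<in> carrier V \<Longrightarrow> f x \<in> carrier W"
  and map_add: "x \<in> carrier V \<Longrightarrow> y \<in> carrier V \<Longrightarrow> f (x \<oplus>\<^bsub>V\<^esub> y) = f x \<oplus>\<^bsub>W\<^esub> f y"
  and map_smult: "c \<in> carrier K \<Longrightarrow> x \<in> carrier V \<Longrightarrow> f (c \<odot>\<^bsub>V\<^esub> x) = c \<odot>\<^bsub>W\<^esub> f x"
  using linear by (auto simp: is_linear_def)

lemma map_zero [simp]: "f \<zero>\<^bsub>V\<^esub> = \<zero>\<^bsub>W\<^esub>"
  using map_smult[of "\<zero>\<^bsub>K\<^esub>" "\<zero>\<^bsub>V\<^esub>"] by simp

lemma map_minus: "x \<in> carrier V \<Longrightarrow> y \<in> carrier V \<Longrightarrow> f (x \<ominus>\<^bsub>V\<^esub> y) = f x \<ominus>\<^bsub>W\<^esub> f y"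
proof -
  assume h: "x \<in> carrier V" "y \<in> carrier V"
  have "f (\<ominus>\<^bsub>V\<^esub> y) = \<ominus>\<^bsub>W\<^esub> f y"
    using map_smult[of "\<ominus>\<^bsub>K\<^esub> \<one>\<^bsub>K\<^esub>" y] h by (simp add: V.smult_l_minus W.smult_l_minus)
  then show ?thesis using h map_add by (simp add: V.M.minus_eq W.M.minus_eq)
qed

lemma map_inj_onI:
  assumes "\<And>x. x \<in> carrier V \<Longrightarrow> f x = \<zero>\<^bsub>W\<^esub> \<Longrightarrow> x = \<zero>\<^bsub>V\<^esub>"
  shows "inj_on f (carrier V)"
proof (rule inj_onI)
  fix x y assume h: "x \<in> carrier V" "y \<in> carrier V" "f x = f y"
  then have "f (x \<ominus>\<^bsub>V\<^esub> y) = \<zero>\<^bsub>W\<^esub>" using map_minus by (simp add: W.M.minus_eq W.M.r_neg)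
  then have "x \<ominus>\<^bsub>V\<^esub> y = \<zero>\<^bsub>V\<^esub>" using assms h by simp
  moreover have "(x \<ominus>\<^bsub>V\<^esub> y) \<oplus>\<^bsub>V\<^esub> y = x" using h by (simp add: V.M.minus_eq V.M.a_assoc V.M.l_neg)
  ultimately show "x = y" using h by simp
qed

lemma image_lin: "set xs \<subseteq> carrier V \<Longrightarrow> f ` lin K V xs = lin K W (map f xs)"
proof (induction xs)
  case (Cons x xs)
  have sub: "\<And>v. v \<in> lin K V xs \<Longrightarrow> v \<in> carrier V"
    using V.submoduleE(1)[OF V.lin_submodule[of xs]] Cons.prems by auto
  have *: "f (c \<odot>\<^bsub>V\<^esub> x \<oplus>\<^bsub>V\<^esub> v) = c \<odot>\<^bsub>W\<^esub> f x \<oplus>\<^bsub>W\<^esub> f v"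
    if "c \<in> carrier K" "v \<in> lin K V xs" for c v
    using that sub Cons.prems by (simp add: map_add map_smult)
  have "lin K W (map f xs) = f ` lin K V xs" using Cons by simp
  then show ?case by (auto simp: image_iff *) (metis *)+
qed simp

lemma submodule_image: "submodule U K V \<Longrightarrow> submodule (f ` U) K W"
proof (rule W.submoduleI')
  assume U: "submodule U K V"
  note S = V.submoduleE[OF U] V.submodule_zero[OF U]
  have sub: "\<And>v. v \<in> U \<Longrightarrow> v \<in> carrier V" using S(1) by blast
  show "f ` U \<subseteq> carrier W" using sub by auto
  show "\<zero>\<^bsub>W\<^esub> \<in> f ` U" using S(7) by (metis map_zero image_eqI)
  show "a \<oplus>\<^bsub>W\<^esub> b \<in> f ` U" if "a \<in> f ` U" "b \<in> f ` U" for a b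
    using that S(5) sub map_add by (auto simp: image_iff) metis
  show "c \<odot>\<^bsub>W\<^esub> a \<in> f ` U" if "c \<in> carrier K" "a \<in> f ` U" for c a
    using that S(4) sub map_smult by (auto simp: image_iff) metis
qed

lemma submodule_preimage:
  assumes U: "submodule U K V" and U': "submodule U' K W"
  shows "submodule {x \<in> U. f x \<in> U'} K V"
proof -
  note S = V.submoduleE[OF U] V.submodule_zero[OF U]
  note S' = W.submoduleE[OF U'] W.submodule_zero[OF U']
  have sub: "\<And>v. v \<in> U \<Longrightarrow> v \<in> carrier V" using S(1) by blast
  show ?thesis by (rule V.submoduleI') (use S S' sub map_add map_smult in auto)
qed

lemma inverse_linear:
  assumes "inj_on f (carrier V)" "f ` carrier V = carrier W"
  shows "is_linear K W V (the_inv_into (carrier V) f)"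
proof -
  let ?g = "the_inv_into (carrier V) f"
  have g: "?g y \<in> carrier V" "f (?g y) = y" if "y \<in> carrier W" for y
    using that assms the_inv_into_into[OF assms(1), of y "carrier V"] f_the_inv_into_f[OF assms(1)] by auto
  have gf: "?g (f x) = x" if "x \<in> carrier V" for x using the_inv_into_f_f[OF assms(1) that] .
  show ?thesis unfolding is_linear_def
  proof (intro conjI ballI funcsetI)
    fix x y assume h: "x \<in> carrier W" "y \<in> carrier W"
    show "?g (x \<oplus>\<^bsub>W\<^esub> y) = ?g x \<oplus>\<^bsub>V\<^esub> ?g y"
      using gf[of "?g x \<oplus>\<^bsub>V\<^esub> ?g y"] g h map_add by simp
  next
    fix c x assume h: "c \<in> carrier K" "x \<in> carrier W"
    show "?g (c \<odot>\<^bsub>W\<^esub> x) = c \<odot>\<^bsub>V\<^esub> ?g x"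
      using gf[of "c \<odot>\<^bsub>V\<^esub> ?g x"] g h map_smult by simp
  qed (use g in auto)
qed

end

section \<open>Spans of injective linear maps as partial injective linear maps\<close>

lemma concrete_cat_simps:
  "obj (concrete_cat Obs Mor) = Obs"
  "(A, f, B) \<in> arr (concrete_cat Obs Mor) \<longleftrightarrow>
     A \<in> Obs \<and> B \<in> Obs \<and> f \<in> carrier A \<rightarrow>\<^sub>E carrier B \<and> Mor A B f"
  "src (concrete_cat Obs Mor) (A, f, B) = A"
  "tgt (concrete_cat Obs Mor) (A, f, B) = B"
  "idn (concrete_cat Obs Mor) A = (A, \<lambda>v\<in>carrier A. v, A)"
  "cmp (concrete_cat Obs Mor) (B', g, D) (A, f, B) = (A, compose (carrier A) g f, D)"
  by (simp_all add: concrete_cat_def)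

lemma homs_concrete_cat:
  "\<phi> \<in> homs (concrete_cat Obs Mor) A B \<longleftrightarrow> (\<exists>f. \<phi> = (A, f, B) \<and> (A, f, B) \<in> arr (concrete_cat Obs Mor))"
  by (cases \<phi>) (auto simp: homs_iff concrete_cat_simps)

lemma category_concrete_cat:
  assumes idn: "\<And>A. A \<in> Obs \<Longrightarrow> Mor A A (\<lambda>v\<in>carrier A. v)"
    and cmp: "\<And>A B D f g. (A, f, B) \<in> arr (concrete_cat Obs Mor) \<Longrightarrow>
      (B, g, D) \<in> arr (concrete_cat Obs Mor) \<Longrightarrow> Mor A D (compose (carrier A) g f)"
  shows "category (concrete_cat Obs Mor)"
proof
  let ?C = "concrete_cat Obs Mor"
  show "src ?C f \<in> obj ?C" "tgt ?C f \<in> obj ?C" if "f \<in> arr ?C" for f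
    using that by (cases f; simp add: concrete_cat_simps)+
  show "idn ?C A \<in> homs ?C A A" if "A \<in> obj ?C" for A
    using that idn by (auto simp: homs_concrete_cat concrete_cat_simps)
  show "cmp ?C g f \<in> homs ?C A D" if "f \<in> homs ?C A B" "g \<in> homs ?C B D" for f g A B D
    using that cmp by (force simp: homs_concrete_cat concrete_cat_simps compose_def)
  show "cmp ?C (idn ?C B) f = f" if "f \<in> homs ?C A B" for f A B
    using that by (auto simp: homs_concrete_cat concrete_cat_simps PiE_iff Id_compose)
  show "cmp ?C f (idn ?C A) = f" if "f \<in> homs ?C A B" for f A B
    using that
    by (auto simp: homs_concrete_cat concrete_cat_simps PiE_iff compose_def fun_eq_iff extensional_def)
  show "cmp ?C h (cmp ?C g f) = cmp ?C (cmp ?C h g) f"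
    if a: "f \<in> homs ?C A B" "g \<in> homs ?C B D" "h \<in> homs ?C D E" for f g h A B D E
  proof -
    obtain f' g' h' where e: "f = (A, f', B)" "g = (B, g', D)" "h = (D, h', E)"
      and "f' \<in> carrier A \<rightarrow>\<^sub>E carrier B"
      using a by (auto simp: homs_concrete_cat concrete_cat_simps)
    then have "f' \<in> carrier A \<rightarrow> carrier B" by auto
    from compose_assoc[OF this, of h' g'] show ?thesis by (simp add: e concrete_cat_simps)
  qed
qed

lemma is_linear_cong:
  assumes "module K V" "is_linear K V W f" "\<And>x. x \<in> carrier V \<Longrightarrow> g x = f x"
  shows "is_linear K V W g"
proof -
  interpret module K V by (rule assms(1))
  show ?thesis using assms(2,3) by (auto simp: is_linear_def)
qed

lemma is_linear_comp:
  "is_linear K V W f \<Longrightarrow> is_linear K W Z g \<Longrightarrow> is_linear K V Z (\<lambda>x. g (f x))"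
  by (auto simp: is_linear_def Pi_iff)

lemma is_linear_id: "is_linear K V V (\<lambda>x. x)"
  by (auto simp: is_linear_def)

lemma is_linear_subspace:
  "is_linear K V W f \<Longrightarrow> U \<subseteq> carrier V \<Longrightarrow> is_linear K (V\<lparr>carrier := U\<rparr>) W f"
  by (auto simp: is_linear_def subset_iff)

text \<open>A span with injective left leg is, up to isomorphism, a partial injective linear map
  \<open>j\<close> defined on a subspace \<open>U\<close>: the image of the left leg.\<close>

definition pmap :: "('k, 'r) ring_scheme \<Rightarrow> ('k, 'x) vec_space \<Rightarrow> ('k, 'x) elt set \<Rightarrow>
    (('k, 'x) elt \<Rightarrow> ('k, 'x) elt) \<Rightarrow> ('k, 'x) vec_space \<Rightarrow> bool" where
  "pmap K V U j W \<longleftrightarrow> V \<in> obj (E_inj K) \<and> W \<in> obj (E_inj K) \<and> submodule U K V \<and>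
     is_linear K (V\<lparr>carrier := U\<rparr>) W j \<and> inj_on j U"

definition pspan where
  "pspan K V U j W = span_class (E_inj K)
     ((V\<lparr>carrier := U\<rparr>, \<lambda>v\<in>U. v, V), (V\<lparr>carrier := U\<rparr>, restrict j U, W))"

abbreviation "pmor K V U j W \<equiv> (V, pspan K V U j W, W)"

lemma E_inj_obj: "V \<in> obj (E_inj K) \<longleftrightarrow> module K V \<and> finite_dim K V"
  by (simp add: E_inj_def concrete_cat_simps)

lemma E_inj_arr: "(V, f, W) \<in> arr (E_inj K) \<longleftrightarrow> V \<in> obj (E_inj K) \<and> W \<in> obj (E_inj K) \<and>
    f \<in> carrier V \<rightarrow>\<^sub>E carrier W \<and> is_linear K V W f \<and> inj_on f (carrier V)"
  by (auto simp: E_inj_def concrete_cat_simps)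

lemma E_inj_homs: "\<phi> \<in> homs (E_inj K) V W \<longleftrightarrow> (\<exists>f. \<phi> = (V, f, W) \<and> (V, f, W) \<in> arr (E_inj K))"
  by (simp add: E_inj_def homs_concrete_cat)

lemma E_inj_simps [simp]:
  "src (E_inj K) (V, f, W) = V" "tgt (E_inj K) (V, f, W) = W"
  "idn (E_inj K) V = (V, \<lambda>v\<in>carrier V. v, V)"
  "cmp (E_inj K) (W', g, Z) (V, f, W) = (V, compose (carrier V) g f, Z)"
  by (simp_all add: E_inj_def concrete_cat_simps)

lemma E_inj_arr_restrict:
  assumes "V \<in> obj (E_inj K)" "W \<in> obj (E_inj K)" "is_linear K V W f" "inj_on f (carrier V)"
  shows "(V, restrict f (carrier V), W) \<in> arr (E_inj K)"
proof -
  have "is_linear K V W (restrict f (carrier V))"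
    using assms is_linear_cong[of K V W f "restrict f (carrier V)"] by (simp add: E_inj_obj)
  then show ?thesis using assms by (auto simp: E_inj_arr is_linear_def inj_on_def)
qed

lemma category_E_inj: "category (E_inj K)"
  unfolding E_inj_def
proof (rule category_concrete_cat)
  fix A :: "('a, 'b) vec_space" assume "A \<in> {V. module K V \<and> finite_dim K V}"
  then show "is_linear K A A (\<lambda>v\<in>carrier A. v) \<and> inj_on (\<lambda>v\<in>carrier A. v) (carrier A)"
    using is_linear_cong[OF _ is_linear_id, of K A "\<lambda>v\<in>carrier A. v"] by auto
next
  fix A B D :: "('a, 'b) vec_space" and f g
  assume "(A, f, B) \<in> arr (concrete_cat {V. module K V \<and> finite_dim K V}
      (\<lambda>V W f. is_linear K V W f \<and> inj_on f (carrier V)))"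
    and "(B, g, D) \<in> arr (concrete_cat {V. module K V \<and> finite_dim K V}
      (\<lambda>V W f. is_linear K V W f \<and> inj_on f (carrier V)))"
  then have *: "module K A" "is_linear K A B f" "is_linear K B D g" "inj_on f (carrier A)"
    "inj_on g (carrier B)" "f \<in> carrier A \<rightarrow> carrier B"
    by (auto simp: concrete_cat_simps)
  have "inj_on (compose (carrier A) g f) (carrier A)"
    using * by (auto simp: inj_on_def compose_eq Pi_iff)
  then show "is_linear K A D (compose (carrier A) g f) \<and>
      inj_on (compose (carrier A) g f) (carrier A)"
    using is_linear_cong[OF *(1) is_linear_comp[OF *(2,3)]] by (simp add: compose_eq)
qed

text \<open>Linearity of the factorisation comes for free from injectivity of \<open>p\<close>.\<close>

lemma E_inj_factor:
  assumes p: "(X, p, A) \<in> arr (E_inj K)" and a: "(Y, a, A) \<in> arr (E_inj K)"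
    and sub: "a ` carrier Y \<subseteq> p ` carrier X"
  shows "\<exists>h. (Y, h, X) \<in> arr (E_inj K) \<and> (\<forall>y \<in> carrier Y. p (h y) = a y)"
proof -
  define h where "h = restrict (\<lambda>y. the_inv_into (carrier X) p (a y)) (carrier Y)"
  interpret p: linear_map K X A p using p by (auto simp: E_inj_arr E_inj_obj linear_map_def linear_map_axioms_def)
  interpret a: linear_map K Y A a using a by (auto simp: E_inj_arr E_inj_obj linear_map_def linear_map_axioms_def)
  have inj: "inj_on p (carrier X)" and inja: "inj_on a (carrier Y)" using p a by (auto simp: E_inj_arr)
  have h: "h y \<in> carrier X" "p (h y) = a y" if "y \<in> carrier Y" for y
    using that sub the_inv_into_into[OF inj] f_the_inv_into_f[OF inj] by (auto simp: h_def image_subset_iff)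
  have "h (x \<oplus>\<^bsub>Y\<^esub> y) = h x \<oplus>\<^bsub>X\<^esub> h y" if "x \<in> carrier Y" "y \<in> carrier Y" for x y
    by (rule inj_onD[OF inj]) (use that h p.map_add a.map_add in auto)
  moreover have "h (c \<odot>\<^bsub>Y\<^esub> x) = c \<odot>\<^bsub>X\<^esub> h x" if "c \<in> carrier K" "x \<in> carrier Y" for c x
    by (rule inj_onD[OF inj]) (use that h p.map_smult a.map_smult in auto)
  moreover have "inj_on h (carrier Y)"
    using h(2) inja by (metis inj_onI inj_onD)
  moreover have "h \<in> carrier Y \<rightarrow>\<^sub>E carrier X" using h(1) by (auto simp: h_def)
  ultimately have "(Y, h, X) \<in> arr (E_inj K)"
    using p a by (auto simp: E_inj_arr is_linear_def)
  then show ?thesis using h(2) by blast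
qed

lemma E_inj_is_iso:
  assumes "(V, f, W) \<in> arr (E_inj K)"
  shows "is_iso (E_inj K) (V, f, W) \<longleftrightarrow> f ` carrier V = carrier W"
proof
  assume "is_iso (E_inj K) (V, f, W)"
  then obtain g where g: "(W, g, V) \<in> arr (E_inj K)" "compose (carrier W) f g = (\<lambda>v\<in>carrier W. v)"
    by (auto simp: is_iso_def E_inj_homs)
  have "w \<in> f ` carrier V" if "w \<in> carrier W" for w
  proof -
    have "f (g w) = w" using fun_cong[OF g(2), of w] that by (simp add: compose_eq)
    then show ?thesis using g(1) that by (force simp: E_inj_arr)
  qed
  then show "f ` carrier V = carrier W" using assms by (auto simp: E_inj_arr)
next
  interpret category "E_inj K" by (rule category_E_inj)
  assume surj: "f ` carrier V = carrier W"
  have V: "V \<in> obj (E_inj K)" and W: "W \<in> obj (E_inj K)" using assms by (auto simp: E_inj_arr)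
  have "(W, \<lambda>v\<in>carrier W. v, W) \<in> arr (E_inj K)" using idn_homs[OF W] by (simp add: homs_iff)
  from E_inj_factor[OF assms this] surj obtain g where g: "(W, g, V) \<in> arr (E_inj K)"
    "\<And>w. w \<in> carrier W \<Longrightarrow> f (g w) = w" by auto
  have fV: "f v \<in> carrier W" if "v \<in> carrier V" for v using that surj by auto
  have gW: "g w \<in> carrier V" if "w \<in> carrier W" for w using that g(1) by (auto simp: E_inj_arr)
  have gf: "g (f v) = v" if "v \<in> carrier V" for v
    using inj_onD[of f "carrier V" "g (f v)" v] that fV gW g(2) assms by (auto simp: E_inj_arr)
  show "is_iso (E_inj K) (V, f, W)"
  proof (rule is_isoI)
    show "(V, f, W) \<in> homs (E_inj K) V W" "(W, g, V) \<in> homs (E_inj K) W V"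
      using assms g by (auto simp: E_inj_homs)
    show "cmp (E_inj K) (W, g, V) (V, f, W) = idn (E_inj K) V"
      "cmp (E_inj K) (V, f, W) (W, g, V) = idn (E_inj K) W"
      using gf g(2) by (auto simp: compose_def)
  qed
qed

text \<open>An isomorphism of spans compatible with the left legs is forced to be \<open>f'\<inverse> f\<close>; so the right legs only
  have to agree wherever the left legs do.\<close>

lemma span_class_iff:
  assumes "(X, f, V) \<in> arr (E_inj K)" "(X, g, W) \<in> arr (E_inj K)"
  shows "s \<in> span_class (E_inj K) ((X, f, V), (X, g, W)) \<longleftrightarrow>
    (\<exists>Y f' g'. s = ((Y, f', V), (Y, g', W)) \<and> (Y, f', V) \<in> arr (E_inj K) \<and> (Y, g', W) \<in> arr (E_inj K) \<and>
       f' ` carrier Y = f ` carrier X \<and> (\<forall>x\<in>carrier X. \<forall>y\<in>carrier Y. f x = f' y \<longrightarrow> g x = g' y))"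
    (is "_ \<longleftrightarrow> ?R")
proof
  assume "s \<in> span_class (E_inj K) ((X, f, V), (X, g, W))"
  then obtain Y f' g' h where s: "s = ((Y, f', V), (Y, g', W))"
    and a: "(Y, f', V) \<in> arr (E_inj K)" "(Y, g', W) \<in> arr (E_inj K)"
    and h: "(X, h, Y) \<in> arr (E_inj K)" "is_iso (E_inj K) (X, h, Y)"
      "compose (carrier X) f' h = f" "compose (carrier X) g' h = g"
    by (auto simp: span_class_def spans_def E_inj_homs)
  have hs: "h ` carrier X = carrier Y" using h E_inj_is_iso by blast
  have e: "f' (h x) = f x" "g' (h x) = g x" if "x \<in> carrier X" for x
    using h(3,4) that by (auto simp: compose_eq)
  have "f' ` carrier Y = f ` carrier X" unfolding hs[symmetric] using e by (auto simp: image_iff)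
  moreover have "g x = g' y" if "x \<in> carrier X" "y \<in> carrier Y" "f x = f' y" for x y
  proof -
    have "h x \<in> carrier Y" using hs that by auto
    then have "h x = y"
      using inj_onD[of f' "carrier Y" "h x" y] that e(1)[of x] a(1) by (auto simp: E_inj_arr)
    then show ?thesis using e(2) that by metis
  qed
  ultimately show ?R using s a by blast
next
  assume ?R
  then obtain Y f' g' where s: "s = ((Y, f', V), (Y, g', W))"
    and a: "(Y, f', V) \<in> arr (E_inj K)" "(Y, g', W) \<in> arr (E_inj K)"
    and im: "f' ` carrier Y = f ` carrier X"
    and g: "\<forall>x\<in>carrier X. \<forall>y\<in>carrier Y. f x = f' y \<longrightarrow> g x = g' y"
    by (elim exE conjE) (rule that)
  from E_inj_factor[OF a(1) assms(1)] im obtain h where h: "(X, h, Y) \<in> arr (E_inj K)"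
    "\<And>x. x \<in> carrier X \<Longrightarrow> f' (h x) = f x" by auto
  have hY: "h x \<in> carrier Y" if "x \<in> carrier X" for x using h(1) that by (auto simp: E_inj_arr)
  have gh: "g' (h x) = g x" if "x \<in> carrier X" for x using g hY[OF that] h(2)[OF that] that by metis
  have "y \<in> h ` carrier X" if y: "y \<in> carrier Y" for y
  proof -
    obtain x where x: "x \<in> carrier X" "f' y = f x" using im y by blast
    then have "h x = y"
      using inj_onD[of f' "carrier Y" "h x" y] h(2) y hY a(1) by (auto simp: E_inj_arr)
    then show ?thesis using x by blast
  qed
  then have "is_iso (E_inj K) (X, h, Y)" using E_inj_is_iso[OF h(1)] hY by blast
  moreover have "compose (carrier X) f' h = f"
    using h(2) assms(1) by (auto simp: compose_def E_inj_arr fun_eq_iff PiE_iff extensional_def)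
  moreover have "compose (carrier X) g' h = g"
    using gh assms(2) by (auto simp: compose_def E_inj_arr fun_eq_iff PiE_iff extensional_def)
  ultimately show "s \<in> span_class (E_inj K) ((X, f, V), (X, g, W))"
    using s a h(1) by (auto simp: span_class_def spans_def E_inj_homs)
qed

context field
begin

lemma E_inj_vec: "V \<in> obj (E_inj R) \<Longrightarrow> vec R V"
  by (simp add: E_inj_obj vec_def field_axioms)

lemma E_inj_subspace:
  assumes "V \<in> obj (E_inj R)" "submodule U R V"
  shows "V\<lparr>carrier := U\<rparr> \<in> obj (E_inj R)"
  using assms vec.finite_dim_submodule[OF E_inj_vec[OF assms(1)] assms(2)]
    submodule.submodule_is_module by (auto simp: E_inj_obj)

lemma pmap_arr:
  assumes "pmap R V U j W"
  shows "(V\<lparr>carrier := U\<rparr>, \<lambda>v\<in>U. v, V) \<in> arr (E_inj R)"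
    and "(V\<lparr>carrier := U\<rparr>, restrict j U, W) \<in> arr (E_inj R)"
proof -
  have V: "V \<in> obj (E_inj R)" and U: "submodule U R V" and W: "W \<in> obj (E_inj R)"
    and j: "is_linear R (V\<lparr>carrier := U\<rparr>) W j" "inj_on j U" using assms by (auto simp: pmap_def)
  interpret V: vec R V using V by (rule E_inj_vec)
  note o = E_inj_subspace[OF V U]
  show "(V\<lparr>carrier := U\<rparr>, \<lambda>v\<in>U. v, V) \<in> arr (E_inj R)"
    using E_inj_arr_restrict[OF o V is_linear_subspace[OF is_linear_id]] V.submoduleE(1)[OF U] by simp
  show "(V\<lparr>carrier := U\<rparr>, restrict j U, W) \<in> arr (E_inj R)"
    using E_inj_arr_restrict[OF o W j(1)] j(2) by simp
qed

lemma pmap_closed: "pmap R V U j W \<Longrightarrow> u \<in> U \<Longrightarrow> j u \<in> carrier W"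
  by (auto simp: pmap_def is_linear_def)

lemma pmap_subset: "pmap R V U j W \<Longrightarrow> U \<subseteq> carrier V"
  using module.submoduleE(1)[of R V U] by (simp add: pmap_def E_inj_obj)

lemma pspan_iff:
  assumes "pmap R V U j W"
  shows "s \<in> pspan R V U j W \<longleftrightarrow>
    (\<exists>Y f g. s = ((Y, f, V), (Y, g, W)) \<and> (Y, f, V) \<in> arr (E_inj R) \<and> (Y, g, W) \<in> arr (E_inj R) \<and>
       f ` carrier Y = U \<and> (\<forall>y\<in>carrier Y. g y = j (f y)))"
proof -
  have eq: "(\<forall>x\<in>U. \<forall>y\<in>carrier Y. x = f y \<longrightarrow> j x = g y) \<longleftrightarrow> (\<forall>y\<in>carrier Y. g y = j (f y))"
    if "f ` carrier Y = U" for Y f g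
    using that by auto
  have im: "(\<lambda>v\<in>U. v) ` U = U" by auto
  show ?thesis unfolding pspan_def span_class_iff[OF pmap_arr[OF assms]] using im by auto
qed

lemma pspan_cong: "(\<And>u. u \<in> U \<Longrightarrow> j' u = j u) \<Longrightarrow> pspan R V U j' W = pspan R V U j W"
  unfolding pspan_def by (metis restrict_ext)

lemma pspan_eqD:
  assumes "pmap R V U j W" "pmap R V U' j' W" "pspan R V U j W = pspan R V U' j' W"
  shows "U = U'" "u \<in> U \<Longrightarrow> j u = j' u"
proof -
  have "((V\<lparr>carrier := U\<rparr>, \<lambda>v\<in>U. v, V), (V\<lparr>carrier := U\<rparr>, restrict j U, W)) \<in> pspan R V U j W"
    unfolding pspan_iff[OF assms(1)] using pmap_arr[OF assms(1)] by auto
  then have "((V\<lparr>carrier := U\<rparr>, \<lambda>v\<in>U. v, V), (V\<lparr>carrier := U\<rparr>, restrict j U, W)) \<in> pspan R V U' j' W"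
    using assms(3) by simp
  then show "U = U'" "u \<in> U \<Longrightarrow> j u = j' u"
    unfolding pspan_iff[OF assms(2)] by auto
qed

lemma Sp_arr: "\<alpha> \<in> homs (Sp (E_inj R)) V W \<longleftrightarrow> (\<exists>U j. pmap R V U j W \<and> \<alpha> = pmor R V U j W)"
proof
  assume "\<alpha> \<in> homs (Sp (E_inj R)) V W"
  then obtain X f g where \<alpha>: "\<alpha> = (V, span_class (E_inj R) ((X, f, V), (X, g, W)), W)"
    and a: "(X, f, V) \<in> arr (E_inj R)" "(X, g, W) \<in> arr (E_inj R)"
    by (auto simp: homs_iff Sp_def spans_def)
  interpret f: linear_map R X V f using a by (auto simp: E_inj_arr E_inj_obj linear_map_def linear_map_axioms_def)
  define U where "U = f ` carrier X"
  have V: "V \<in> obj (E_inj R)" using a by (simp add: E_inj_arr)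
  have U: "submodule U R V" unfolding U_def by (rule f.submodule_image[OF f.V.carrier_is_submodule])
  have incl: "(V\<lparr>carrier := U\<rparr>, \<lambda>v\<in>U. v, V) \<in> arr (E_inj R)"
    using E_inj_arr_restrict[OF E_inj_subspace[OF V U] V is_linear_subspace[OF is_linear_id]]
      f.W.submoduleE(1)[OF U] by simp
  from E_inj_factor[OF a(1) incl] obtain h where h: "(V\<lparr>carrier := U\<rparr>, h, X) \<in> arr (E_inj R)"
    "\<And>u. u \<in> U \<Longrightarrow> f (h u) = u" by (auto simp: U_def)
  define j where "j u = g (h u)" for u
  have hX: "u \<in> U \<Longrightarrow> h u \<in> carrier X" for u using h(1) by (auto simp: E_inj_arr)
  have hf: "h (f x) = x" if "x \<in> carrier X" for x
    using inj_onD[of f "carrier X" "h (f x)" x] that h(2)[of "f x"] hX[of "f x"] a(1)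
    by (auto simp: U_def E_inj_arr)
  have "inj_on j U" using h a(2) hX by (auto simp: j_def inj_on_def E_inj_arr)
  then have p: "pmap R V U j W"
    using U a h(1) is_linear_comp[of R "V\<lparr>carrier := U\<rparr>" X h W g] unfolding j_def
    by (auto simp: pmap_def E_inj_arr)
  have key: "(\<forall>y\<in>carrier Y. g' y = j (f' y)) \<longleftrightarrow>
      (\<forall>x\<in>carrier X. \<forall>y\<in>carrier Y. f x = f' y \<longrightarrow> g x = g' y)"
    if im: "f' ` carrier Y = U" for Y f' g'
  proof
    assume "\<forall>y\<in>carrier Y. g' y = j (f' y)"
    then show "\<forall>x\<in>carrier X. \<forall>y\<in>carrier Y. f x = f' y \<longrightarrow> g x = g' y"
      using hf unfolding j_def by metis
  next
    assume H: "\<forall>x\<in>carrier X. \<forall>y\<in>carrier Y. f x = f' y \<longrightarrow> g x = g' y"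
    show "\<forall>y\<in>carrier Y. g' y = j (f' y)"
    proof
      fix y assume y: "y \<in> carrier Y"
      then have "f' y \<in> U" using im by blast
      with y show "g' y = j (f' y)" using H h(2) hX unfolding j_def by metis
    qed
  qed
  have "pspan R V U j W = span_class (E_inj R) ((X, f, V), (X, g, W))"
    by (rule Set.set_eqI)
      (simp add: pspan_iff[OF p] span_class_iff[OF a] U_def[symmetric] key cong: conj_cong)
  then show "\<exists>U j. pmap R V U j W \<and> \<alpha> = pmor R V U j W" using p \<alpha> by blast
next
  assume "\<exists>U j. pmap R V U j W \<and> \<alpha> = pmor R V U j W"
  then obtain U j where p: "pmap R V U j W" "\<alpha> = pmor R V U j W" by blast
  show "\<alpha> \<in> homs (Sp (E_inj R)) V W"
    using p pmap_arr[OF p(1)] unfolding p(2) homs_iff Sp_def pspan_def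
    by (fastforce simp: spans_def pmap_def)
qed

lemma pmor_homs: "pmap R V U j W \<Longrightarrow> pmor R V U j W \<in> homs (Sp (E_inj R)) V W"
  using Sp_arr by blast

text \<open>Testing the universal property on the subspace \<open>f\<inverse> (g B)\<close> of \<open>A\<close>, with its two evident maps, shows
  that it is contained in the image of \<open>p\<close>.\<close>

lemma pullback_image:
  assumes "is_pullback (E_inj R) (A, f, C) (B, g, C') P Q"
  shows "\<exists>X p q. P = (X, p, A) \<and> Q = (X, q, B) \<and> P \<in> arr (E_inj R) \<and> Q \<in> arr (E_inj R) \<and>
    (\<forall>x\<in>carrier X. f (p x) = g (q x)) \<and> p ` carrier X = {a \<in> carrier A. f a \<in> g ` carrier B}"
proof -
  have f: "(A, f, C) \<in> arr (E_inj R)" and g: "(B, g, C) \<in> arr (E_inj R)" and C: "C' = C"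
    using assms by (auto simp: is_pullback_def)
  obtain X p q where P: "P = (X, p, A)" and Q: "Q = (X, q, B)" and a: "P \<in> arr (E_inj R)" "Q \<in> arr (E_inj R)"
    and c: "compose (carrier X) f p = compose (carrier X) g q"
  proof -
    have *: "P \<in> homs (E_inj R) (src (E_inj R) P) A" "Q \<in> homs (E_inj R) (src (E_inj R) P) B"
      "cmp (E_inj R) (A, f, C) P = cmp (E_inj R) (B, g, C) Q"
      using assms unfolding is_pullback_def C by simp_all
    obtain X p q where "P = (X, p, A)" "Q = (X, q, B)"
      using *(1,2) unfolding E_inj_homs by blast
    then show ?thesis by (rule that) (use * \<open>P = _\<close> \<open>Q = _\<close> in \<open>simp_all add: homs_iff\<close>)
  qed
  have pX: "p x \<in> carrier A" and qX: "q x \<in> carrier B" if "x \<in> carrier X" for x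
    using a that P Q by (auto simp: E_inj_arr)
  have comm: "f (p x) = g (q x)" if "x \<in> carrier X" for x
    using fun_cong[OF c, of x] that by (simp add: compose_eq)
  define S where "S = {a \<in> carrier A. f a \<in> g ` carrier B}"
  interpret f: linear_map R A C f using f by (auto simp: E_inj_arr E_inj_obj linear_map_def linear_map_axioms_def)
  interpret g: linear_map R B C g using g by (auto simp: E_inj_arr E_inj_obj linear_map_def linear_map_axioms_def)
  have S: "submodule S R A" unfolding S_def
    by (rule f.submodule_preimage[OF f.V.carrier_is_submodule g.submodule_image[OF g.V.carrier_is_submodule]])
  have A: "A \<in> obj (E_inj R)" and B: "B \<in> obj (E_inj R)" and Cobj: "C \<in> obj (E_inj R)"
    using f g by (auto simp: E_inj_arr)
  note AS = E_inj_subspace[OF A S]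
  have SA: "S \<subseteq> carrier A" by (auto simp: S_def)
  have incl: "(A\<lparr>carrier := S\<rparr>, \<lambda>v\<in>S. v, A) \<in> arr (E_inj R)"
    using E_inj_arr_restrict[OF AS A is_linear_subspace[OF is_linear_id]] SA by simp
  have "inj_on f S" using f SA by (auto simp: E_inj_arr intro: inj_on_subset)
  then have fS: "(A\<lparr>carrier := S\<rparr>, restrict f S, C) \<in> arr (E_inj R)"
    using E_inj_arr_restrict[OF AS Cobj is_linear_subspace[OF f.linear SA]] by simp
  from E_inj_factor[OF g fS] obtain b where b: "(A\<lparr>carrier := S\<rparr>, b, B) \<in> arr (E_inj R)"
    "\<And>s. s \<in> S \<Longrightarrow> g (b s) = f s" by (auto simp: S_def)
  have univ: "\<forall>Z a b. a \<in> homs (E_inj R) Z A \<and> b \<in> homs (E_inj R) Z B \<and>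
      cmp (E_inj R) (A, f, C) a = cmp (E_inj R) (B, g, C) b \<longrightarrow>
      (\<exists>!h. h \<in> homs (E_inj R) Z X \<and> cmp (E_inj R) P h = a \<and> cmp (E_inj R) Q h = b)"
    using assms unfolding is_pullback_def C P by simp
  have h1: "(A\<lparr>carrier := S\<rparr>, \<lambda>v\<in>S. v, A) \<in> homs (E_inj R) (A\<lparr>carrier := S\<rparr>) A"
    and h2: "(A\<lparr>carrier := S\<rparr>, b, B) \<in> homs (E_inj R) (A\<lparr>carrier := S\<rparr>) B"
    using incl b(1) by (auto simp: E_inj_homs)
  have h3: "cmp (E_inj R) (A, f, C) (A\<lparr>carrier := S\<rparr>, \<lambda>v\<in>S. v, A) = cmp (E_inj R) (B, g, C) (A\<lparr>carrier := S\<rparr>, b, B)"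
    using b(2) by (simp add: compose_def restrict_def fun_eq_iff)
  obtain h where h: "h \<in> homs (E_inj R) (A\<lparr>carrier := S\<rparr>) X"
    "cmp (E_inj R) P h = (A\<lparr>carrier := S\<rparr>, \<lambda>v\<in>S. v, A)"
    using univ[rule_format, OF conjI[OF h1 conjI[OF h2 h3]]] by blast
  then obtain k where k: "(A\<lparr>carrier := S\<rparr>, k, X) \<in> arr (E_inj R)" "compose S p k = (\<lambda>v\<in>S. v)"
    by (auto simp: E_inj_homs P)
  have "s \<in> p ` carrier X" if "s \<in> S" for s
  proof -
    have "p (k s) = s" using fun_cong[OF k(2), of s] that by (simp add: compose_eq)
    moreover have "k s \<in> carrier X" using k(1) that by (auto simp: E_inj_arr)
    ultimately show ?thesis by force
  qed
  then have "p ` carrier X = S" using pX qX comm by (auto simp: S_def)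
  then show ?thesis using P Q a comm S_def by blast
qed

lemma pullbackI:
  assumes f: "(A, f, C) \<in> arr (E_inj R)" and g: "(B, g, C) \<in> arr (E_inj R)"
    and p: "(X, p, A) \<in> arr (E_inj R)" and q: "(X, q, B) \<in> arr (E_inj R)"
    and comm: "\<And>x. x \<in> carrier X \<Longrightarrow> f (p x) = g (q x)"
    and im: "p ` carrier X = {a \<in> carrier A. f a \<in> g ` carrier B}"
  shows "is_pullback (E_inj R) (A, f, C) (B, g, C) (X, p, A) (X, q, B)"
proof -
  have "\<exists>!h. h \<in> homs (E_inj R) Z X \<and> cmp (E_inj R) (X, p, A) h = a \<and> cmp (E_inj R) (X, q, B) h = b"
    if a: "a \<in> homs (E_inj R) Z A" and b: "b \<in> homs (E_inj R) Z B"
      and c: "cmp (E_inj R) (A, f, C) a = cmp (E_inj R) (B, g, C) b" for Z a b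
  proof -
    obtain a' where a': "a = (Z, a', A)" "(Z, a', A) \<in> arr (E_inj R)" using a by (auto simp: E_inj_homs)
    obtain b' where b': "b = (Z, b', B)" "(Z, b', B) \<in> arr (E_inj R)" using b by (auto simp: E_inj_homs)
    have aZ: "a' z \<in> carrier A" and bZ: "b' z \<in> carrier B" and fg: "f (a' z) = g (b' z)"
      if z: "z \<in> carrier Z" for z
      using a' b' z fun_cong[of _ _ z, OF c[unfolded a' b', simplified]]
      by (auto simp: E_inj_arr compose_eq)
    have "a' ` carrier Z \<subseteq> p ` carrier X" unfolding im using aZ bZ fg by auto
    from E_inj_factor[OF p a'(2) this] obtain h where h: "(Z, h, X) \<in> arr (E_inj R)"
      "\<And>z. z \<in> carrier Z \<Longrightarrow> p (h z) = a' z" by auto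
    have hZ: "h z \<in> carrier X" if "z \<in> carrier Z" for z using that h(1) by (auto simp: E_inj_arr)
    have qh: "q (h z) = b' z" if z: "z \<in> carrier Z" for z
    proof (rule inj_onD[of g "carrier B"])
      show "g (q (h z)) = g (b' z)" using comm[OF hZ[OF z]] h(2)[OF z] fg[OF z] by simp
    qed (use g q hZ bZ z in \<open>auto simp: E_inj_arr\<close>)
    show ?thesis
    proof (rule ex1I[of _ "(Z, h, X)"])
      show "(Z, h, X) \<in> homs (E_inj R) Z X \<and> cmp (E_inj R) (X, p, A) (Z, h, X) = a \<and>
          cmp (E_inj R) (X, q, B) (Z, h, X) = b"
        using h qh a' b' by (auto simp: E_inj_homs E_inj_arr compose_def fun_eq_iff PiE_iff extensional_def)
    next
      fix k assume k: "k \<in> homs (E_inj R) Z X \<and> cmp (E_inj R) (X, p, A) k = a \<and> cmp (E_inj R) (X, q, B) k = b"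
      then obtain k' where k': "k = (Z, k', X)" "(Z, k', X) \<in> arr (E_inj R)" "compose (carrier Z) p k' = a'"
        using a'(1) by (auto simp: E_inj_homs)
      have "k' z = h z" if z: "z \<in> carrier Z" for z
      proof (rule inj_onD[of p "carrier X"])
        show "p (k' z) = p (h z)" using fun_cong[OF k'(3), of z] h(2)[OF z] z by (simp add: compose_eq)
      qed (use p k' hZ z in \<open>auto simp: E_inj_arr\<close>)
      then have "k' = h" using k'(2) h(1) by (auto simp: E_inj_arr intro: PiE_ext)
      then show "k = (Z, h, X)" using k' by simp
    qed
  qed
  moreover have "compose (carrier X) f p = compose (carrier X) g q"
    using comm by (auto simp: compose_def)
  ultimately show ?thesis unfolding is_pullback_def using f g p q by (auto simp: E_inj_homs)
qed

lemma pmap_comp: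
  assumes 1: "pmap R V U j W" and 2: "pmap R W U' j' Z"
  shows "pmap R V {u \<in> U. j u \<in> U'} (\<lambda>u. j' (j u)) Z"
proof -
  have o: "V \<in> obj (E_inj R)" "W \<in> obj (E_inj R)" "Z \<in> obj (E_inj R)"
    and U: "submodule U R V" and U': "submodule U' R W"
    and j: "is_linear R (V\<lparr>carrier := U\<rparr>) W j" "inj_on j U"
    and j': "is_linear R (W\<lparr>carrier := U'\<rparr>) Z j'" "inj_on j' U'" using 1 2 by (auto simp: pmap_def)
  interpret V: vec R V using o(1) by (rule E_inj_vec)
  interpret W: vec R W using o(2) by (rule E_inj_vec)
  note S = V.submoduleE[OF U] V.submodule_zero[OF U]
  note S' = W.submoduleE[OF U'] W.submodule_zero[OF U']
  have sub: "\<And>v. v \<in> U \<Longrightarrow> v \<in> carrier V" using S(1) by blast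
  interpret j: linear_map R "V\<lparr>carrier := U\<rparr>" W j
    using E_inj_subspace[OF o(1) U] o(2) j(1) by (auto simp: E_inj_obj linear_map_def linear_map_axioms_def)
  have add: "j (x \<oplus>\<^bsub>V\<^esub> y) = j x \<oplus>\<^bsub>W\<^esub> j y" if "x \<in> U" "y \<in> U" for x y
    using j.map_add that by simp
  have smult: "j (c \<odot>\<^bsub>V\<^esub> x) = c \<odot>\<^bsub>W\<^esub> j x" if "c \<in> carrier R" "x \<in> U" for c x
    using j.map_smult that by simp
  have zero: "j \<zero>\<^bsub>V\<^esub> = \<zero>\<^bsub>W\<^esub>" using j.map_zero by simp
  have "submodule {u \<in> U. j u \<in> U'} R V"
    by (rule V.submoduleI') (use S S' sub add smult zero in auto)
  moreover have "is_linear R (V\<lparr>carrier := {u \<in> U. j u \<in> U'}\<rparr>) Z (\<lambda>u. j' (j u))"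
    using j' add smult by (auto simp: is_linear_def)
  moreover have "inj_on (\<lambda>u. j' (j u)) {u \<in> U. j u \<in> U'}"
    using j(2) j'(2) by (auto simp: inj_on_def)
  ultimately show ?thesis using o by (simp add: pmap_def)
qed

text \<open>The fibre product of \<open>j\<close> with the inclusion of \<open>U'\<close> is the preimage of \<open>U'\<close> under \<open>j\<close>. Conversely,
  every span in the class on the right is hit, taking the canonical representatives of the
  two factors and the given span as a pullback of them.\<close>

lemma cmp_pmor:
  assumes 1: "pmap R V U j W" and 2: "pmap R W U' j' Z"
  shows "cmp (Sp (E_inj R)) (pmor R W U' j' Z) (pmor R V U j W) =
    pmor R V {u \<in> U. j u \<in> U'} (\<lambda>u. j' (j u)) Z"
proof -
  let ?U = "{u \<in> U. j u \<in> U'}"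
  let ?E = "E_inj R :: (('a, 'd) vec_space, _) cat"
  note 3 = pmap_comp[OF assms]
  have "{(cmp ?E f p, cmp ?E g' q) | f g f' g' p q.
      (f, g) \<in> pspan R V U j W \<and> (f', g') \<in> pspan R W U' j' Z \<and> is_pullback ?E g f' p q}
    = pspan R V ?U (\<lambda>u. j' (j u)) Z" (is "?L = ?P")
  proof (intro equalityI subsetI)
    fix s assume "s \<in> ?L"
    then obtain f g f' g' P Q where s: "s = (cmp ?E f P, cmp ?E g' Q)"
      and fg: "(f, g) \<in> pspan R V U j W" and fg': "(f', g') \<in> pspan R W U' j' Z"
      and pb: "is_pullback ?E g f' P Q" by blast
    obtain Y a b where Y: "f = (Y, a, V)" "g = (Y, b, W)" "(Y, a, V) \<in> arr ?E" "(Y, b, W) \<in> arr ?E"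
      "a ` carrier Y = U" "\<And>y. y \<in> carrier Y \<Longrightarrow> b y = j (a y)"
      using fg unfolding pspan_iff[OF 1] by auto
    obtain Y' a' b' where Y': "f' = (Y', a', W)" "g' = (Y', b', Z)" "(Y', a', W) \<in> arr ?E" "(Y', b', Z) \<in> arr ?E"
      "a' ` carrier Y' = U'" "\<And>y. y \<in> carrier Y' \<Longrightarrow> b' y = j' (a' y)"
      using fg' unfolding pspan_iff[OF 2] by auto
    obtain X p q where X: "P = (X, p, Y)" "Q = (X, q, Y')" "(X, p, Y) \<in> arr ?E" "(X, q, Y') \<in> arr ?E"
      "\<And>x. x \<in> carrier X \<Longrightarrow> b (p x) = a' (q x)" "p ` carrier X = {y \<in> carrier Y. b y \<in> a' ` carrier Y'}"
      using pullback_image[OF pb[unfolded Y Y']] by auto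
    have pX: "p x \<in> carrier Y" and qX: "q x \<in> carrier Y'" if "x \<in> carrier X" for x
      using X(3,4) that by (auto simp: E_inj_arr)
    interpret E: category ?E by (rule category_E_inj)
    have "(X, compose (carrier X) a p, V) \<in> arr ?E" "(X, compose (carrier X) b' q, Z) \<in> arr ?E"
      using E.cmp_homs[of "(X, p, Y)" X Y "(Y, a, V)" V] X Y E.cmp_homs[of "(X, q, Y')" X Y' "(Y', b', Z)" Z] Y'
      by (auto simp: homs_iff)
    moreover have "compose (carrier X) a p ` carrier X = ?U"
    proof -
      have "compose (carrier X) a p ` carrier X = a ` (p ` carrier X)" by (auto simp: compose_def)
      also have "\<dots> = ?U" unfolding X(6) Y'(5) using Y(5,6) by auto
      finally show ?thesis .
    qed
    moreover have "b' (q x) = j' (j (a (p x)))" if "x \<in> carrier X" for x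
      using that X(5) Y(6) Y'(6) pX qX by metis
    ultimately show "s \<in> ?P" unfolding pspan_iff[OF 3] s Y Y' X by (auto simp: compose_eq)
  next
    fix s assume "s \<in> ?P"
    then obtain X a b where X: "s = ((X, a, V), (X, b, Z))" "(X, a, V) \<in> arr ?E" "(X, b, Z) \<in> arr ?E"
      "a ` carrier X = ?U" "\<And>x. x \<in> carrier X \<Longrightarrow> b x = j' (j (a x))"
      unfolding pspan_iff[OF 3] by auto
    let ?VU = "V\<lparr>carrier := U\<rparr>" and ?WU = "W\<lparr>carrier := U'\<rparr>"
    note a1 = pmap_arr[OF 1] and a2 = pmap_arr[OF 2]
    have aX: "a x \<in> U" "j (a x) \<in> U'" if "x \<in> carrier X" for x using X(4) that by auto
    have "a ` carrier X \<subseteq> (\<lambda>v\<in>U. v) ` carrier ?VU" using aX by (auto simp: image_iff)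
    from E_inj_factor[OF a1(1) X(2) this] obtain p where p: "(X, p, ?VU) \<in> arr ?E"
      "\<And>x. x \<in> carrier X \<Longrightarrow> (\<lambda>v\<in>U. v) (p x) = a x" by blast
    have pU: "p x \<in> U" if "x \<in> carrier X" for x using p(1) that by (auto simp: E_inj_arr)
    have pa: "p x = a x" if "x \<in> carrier X" for x using p(2)[OF that] pU[OF that] by simp
    interpret E: category ?E by (rule category_E_inj)
    have jp: "(X, compose (carrier X) (restrict j U) p, W) \<in> arr ?E"
      using E.cmp_homs[of "(X, p, ?VU)" X ?VU "(?VU, restrict j U, W)" W] p a1 by (auto simp: homs_iff)
    have "compose (carrier X) (restrict j U) p ` carrier X \<subseteq> (\<lambda>v\<in>U'. v) ` carrier ?WU"
      using aX pa by (auto simp: compose_def image_iff)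
    from E_inj_factor[OF a2(1) jp this] obtain q where q: "(X, q, ?WU) \<in> arr ?E"
      "\<And>x. x \<in> carrier X \<Longrightarrow> (\<lambda>v\<in>U'. v) (q x) = restrict j U (p x)" by (auto simp: compose_eq)
    have qU: "q x \<in> U'" if "x \<in> carrier X" for x using q(1) that by (auto simp: E_inj_arr)
    have qa: "q x = j (a x)" if "x \<in> carrier X" for x
      using q(2)[OF that] qU[OF that] pa[OF that] aX[OF that] by simp
    have pb: "is_pullback ?E (?VU, restrict j U, W) (?WU, \<lambda>v\<in>U'. v, W) (X, p, ?VU) (X, q, ?WU)"
    proof (rule pullbackI[OF a1(2) a2(1) p(1) q(1)])
      show "restrict j U (p x) = (\<lambda>v\<in>U'. v) (q x)" if "x \<in> carrier X" for x using q(2) that by simp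
      have im: "(\<lambda>v\<in>U'. v) ` carrier ?WU = U'" by auto
      have "p ` carrier X = a ` carrier X" using pa by (rule image_cong[OF HOL.refl])
      also have "\<dots> = {u \<in> carrier ?VU. restrict j U u \<in> U'}" unfolding X(4) by auto
      finally show "p ` carrier X = {u \<in> carrier ?VU. restrict j U u \<in> (\<lambda>v\<in>U'. v) ` carrier ?WU}"
        unfolding im .
    qed
    have m1: "((?VU, \<lambda>v\<in>U. v, V), (?VU, restrict j U, W)) \<in> pspan R V U j W"
      unfolding pspan_iff[OF 1] using a1 by auto
    have m2: "((?WU, \<lambda>v\<in>U'. v, W), (?WU, restrict j' U', Z)) \<in> pspan R W U' j' Z"
      unfolding pspan_iff[OF 2] using a2 by auto
    have e1: "compose (carrier X) (\<lambda>v\<in>U. v) p = a"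
      using pa pU X(2) by (auto simp: compose_def E_inj_arr fun_eq_iff PiE_iff extensional_def)
    have e2: "compose (carrier X) (restrict j' U') q = b"
      using qa qU X(3,5) by (auto simp: compose_def E_inj_arr fun_eq_iff PiE_iff extensional_def)
    have seq: "s = (cmp ?E (?VU, \<lambda>v\<in>U. v, V) (X, p, ?VU), cmp ?E (?WU, restrict j' U', Z) (X, q, ?WU))"
      using X(1) e1 e2 by simp
    show "s \<in> ?L" by (rule CollectI, intro exI conjI, rule seq, rule m1, rule m2, rule pb)
  qed
  then show ?thesis by (simp add: Sp_def)
qed

lemma pmap_id: "V \<in> obj (E_inj R) \<Longrightarrow> pmap R V (carrier V) (\<lambda>v. v) V"
  using module.carrier_is_submodule is_linear_id by (auto simp: pmap_def E_inj_obj)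

lemma idn_Sp: "idn (Sp (E_inj R)) V = pmor R V (carrier V) (\<lambda>v. v) V"
  by (simp add: Sp_def pspan_def)

lemma obj_Sp [simp]: "obj (Sp (E_inj R)) = obj (E_inj R)"
  by (simp add: Sp_def)

lemma category_Sp: "category (Sp (E_inj R))"
proof
  let ?S = "Sp (E_inj R)"
  fix f assume f: "f \<in> arr ?S"
  then show "src ?S f \<in> obj ?S" "tgt ?S f \<in> obj ?S" by (auto simp: Sp_def)
next
  let ?S = "Sp (E_inj R)"
  fix A assume "A \<in> obj ?S"
  then show "idn ?S A \<in> homs ?S A A" using pmap_id by (auto simp: idn_Sp Sp_arr)
next
  let ?S = "Sp (E_inj R)"
  fix f g A B D assume "f \<in> homs ?S A B" "g \<in> homs ?S B D"
  then show "cmp ?S g f \<in> homs ?S A D"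
    unfolding Sp_arr by (elim exE conjE) (simp only: cmp_pmor, blast intro: pmap_comp)
next
  let ?S = "Sp (E_inj R)"
  fix f A B assume "f \<in> homs ?S A B"
  then obtain U j where p: "pmap R A U j B" "f = pmor R A U j B" unfolding Sp_arr by blast
  then have o: "pmap R A (carrier A) (\<lambda>v. v) A" "pmap R B (carrier B) (\<lambda>v. v) B"
    using pmap_id by (auto simp: pmap_def)
  have e: "{u \<in> U. j u \<in> carrier B} = U" "{u \<in> carrier A. u \<in> U} = U"
    using pmap_closed[OF p(1)] pmap_subset[OF p(1)] by auto
  show "cmp ?S (idn ?S B) f = f" "cmp ?S f (idn ?S A) = f"
    using cmp_pmor[OF p(1) o(2)] cmp_pmor[OF o(1) p(1)] unfolding idn_Sp p(2) e by simp_all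
next
  let ?S = "Sp (E_inj R)"
  fix f g h A B D E assume "f \<in> homs ?S A B" "g \<in> homs ?S B D" "h \<in> homs ?S D E"
  then obtain U j U' j' U'' j'' where p: "pmap R A U j B" "pmap R B U' j' D" "pmap R D U'' j'' E"
    and e: "f = pmor R A U j B" "g = pmor R B U' j' D" "h = pmor R D U'' j'' E" unfolding Sp_arr by blast
  have dom: "{u \<in> {u \<in> U. j u \<in> U'}. j' (j u) \<in> U''} = {u \<in> U. j u \<in> {u \<in> U'. j' u \<in> U''}}" by auto
  show "cmp ?S h (cmp ?S g f) = cmp ?S (cmp ?S h g) f"
    unfolding e cmp_pmor[OF p(1,2)] cmp_pmor[OF p(2,3)] cmp_pmor[OF pmap_comp[OF p(1,2)] p(3)]
      cmp_pmor[OF p(1) pmap_comp[OF p(2,3)]] dom ..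
qed

lemma pmor_is_iso:
  assumes p: "pmap R V (carrier V) j W" and surj: "j ` carrier V = carrier W"
  shows "is_iso (Sp (E_inj R)) (pmor R V (carrier V) j W)"
proof -
  interpret S: category "Sp (E_inj R)" by (rule category_Sp)
  have VW: "V \<in> obj (E_inj R)" "W \<in> obj (E_inj R)" using p by (auto simp: pmap_def)
  interpret j: linear_map R V W j
    using p by (auto simp: pmap_def E_inj_obj linear_map_def linear_map_axioms_def)
  have inj: "inj_on j (carrier V)" using p by (simp add: pmap_def)
  let ?g = "the_inv_into (carrier V) j"
  have q: "pmap R W (carrier W) ?g V"
    using VW j.inverse_linear[OF inj surj] inj_on_the_inv_into[OF inj] surj j.W.carrier_is_submodule
    by (simp add: pmap_def)
  have gW: "?g w \<in> carrier V" "j (?g w) = w" if "w \<in> carrier W" for w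
    using that surj the_inv_into_into[OF inj, of w] f_the_inv_into_f[OF inj] by auto
  have jV: "j v \<in> carrier W" "?g (j v) = v" if "v \<in> carrier V" for v
    using that the_inv_into_f_f[OF inj] by auto
  have d: "{u \<in> carrier V. j u \<in> carrier W} = carrier V" "{u \<in> carrier W. ?g u \<in> carrier V} = carrier W"
    using gW jV by auto
  show ?thesis
  proof (rule S.is_isoI[OF pmor_homs[OF p] pmor_homs[OF q]])
    show "cmp (Sp (E_inj R)) (pmor R W (carrier W) ?g V) (pmor R V (carrier V) j W) = idn (Sp (E_inj R)) V"
      unfolding cmp_pmor[OF p q] d idn_Sp by (simp add: pspan_cong[of "carrier V" "\<lambda>u. ?g (j u)" "\<lambda>v. v"] jV)
    show "cmp (Sp (E_inj R)) (pmor R V (carrier V) j W) (pmor R W (carrier W) ?g V) = idn (Sp (E_inj R)) W"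
      unfolding cmp_pmor[OF q p] d idn_Sp by (simp add: pspan_cong[of "carrier W" "\<lambda>u. j (?g u)" "\<lambda>v. v"] gW)
  qed
qed

end

section \<open>Quadratic spaces and their radicals\<close>

definition polar :: "('k, 'r) ring_scheme \<Rightarrow> ('k, 'a) quadratic_module \<Rightarrow> 'a \<Rightarrow> 'a \<Rightarrow> 'k" where
  "polar K D v w = qform D (v \<oplus>\<^bsub>D\<^esub> w) \<ominus>\<^bsub>K\<^esub> (qform D v \<oplus>\<^bsub>K\<^esub> qform D w)"

locale qspace = vec R D for R (structure) and D :: "('a, 'b) quadratic_module" +
  assumes quadratic: "is_quadratic_form R D (qform D)"

lemma is_linear_form_closed: "is_linear_form K V l \<Longrightarrow> v \<in> carrier V \<Longrightarrow> l v \<in> carrier K"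
  by (auto simp: is_linear_form_def)

context vec
begin

text \<open>If \<open>q = \<Sum> l m\<close>, the polar form is \<open>b(v, w) = \<Sum> l(v) m(w) + l(w) m(v)\<close>.\<close>

lemma quadratic_form_expansion:
  assumes "is_quadratic_form R M q"
  shows "\<exists>b. (\<forall>v \<in> carrier M. q v \<in> carrier R) \<and>
    (\<forall>c \<in> carrier R. \<forall>v \<in> carrier M. q (c \<odot>\<^bsub>M\<^esub> v) = c \<otimes> c \<otimes> q v) \<and>
    (\<forall>v \<in> carrier M. \<forall>w \<in> carrier M. b v w \<in> carrier R \<and> b v w = b w v \<and>
       q (v \<oplus>\<^bsub>M\<^esub> w) = (q v \<oplus> q w) \<oplus> b v w) \<and>
    (\<forall>u \<in> carrier M. \<forall>v \<in> carrier M. \<forall>w \<in> carrier M. b (u \<oplus>\<^bsub>M\<^esub> v) w = b u w \<oplus> b v w) \<and>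
    (\<forall>c \<in> carrier R. \<forall>v \<in> carrier M. \<forall>w \<in> carrier M. b (c \<odot>\<^bsub>M\<^esub> v) w = c \<otimes> b v w)"
proof -
  obtain n l m where lm: "\<And>i. i < n \<Longrightarrow> is_linear_form R M (l i) \<and> is_linear_form R M (m i)"
    and q: "\<And>v. v \<in> carrier M \<Longrightarrow> q v = (\<Oplus>i\<in>{..<n::nat}. l i v \<otimes> m i v)"
    using assms unfolding is_quadratic_form_def by blast
  have cl: "l i v \<in> carrier R" "m i v \<in> carrier R" if "i < n" "v \<in> carrier M" for i v
    using lm[OF that(1)] that(2) by (auto simp: is_linear_form_def)
  have add: "l i (v \<oplus>\<^bsub>M\<^esub> w) = l i v \<oplus> l i w" "m i (v \<oplus>\<^bsub>M\<^esub> w) = m i v \<oplus> m i w"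
    if "i < n" "v \<in> carrier M" "w \<in> carrier M" for i v w
    using lm[OF that(1)] that(2,3) by (auto simp: is_linear_form_def)
  have sm: "l i (c \<odot>\<^bsub>M\<^esub> v) = c \<otimes> l i v" "m i (c \<odot>\<^bsub>M\<^esub> v) = c \<otimes> m i v"
    if "i < n" "c \<in> carrier R" "v \<in> carrier M" for i c v
    using lm[OF that(1)] that(2,3) by (auto simp: is_linear_form_def)
  define b where "b v w = (\<Oplus>i\<in>{..<n}. l i v \<otimes> m i w \<oplus> l i w \<otimes> m i v)" for v w
  have 1: "q v \<in> carrier R" if "v \<in> carrier M" for v
    unfolding q[OF that] using cl that by (auto intro!: R.finsum_closed)
  have 2: "q (c \<odot>\<^bsub>M\<^esub> v) = c \<otimes> c \<otimes> q v" if h: "c \<in> carrier R" "v \<in> carrier M" for c v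
  proof -
    have "q (c \<odot>\<^bsub>M\<^esub> v) = (\<Oplus>i\<in>{..<n}. c \<otimes> c \<otimes> (l i v \<otimes> m i v))"
      unfolding q[OF smult_closed[OF h]]
      by (rule R.finsum_cong') (use cl sm h in \<open>auto simp: R.m_ac\<close>)
    also have "\<dots> = c \<otimes> c \<otimes> q v"
      unfolding q[OF h(2)] by (rule R.finsum_rdistr[symmetric]) (use cl h in auto)
    finally show ?thesis .
  qed
  have 3: "b v w \<in> carrier R" if "v \<in> carrier M" "w \<in> carrier M" for v w
    unfolding b_def using cl that by (auto intro!: R.finsum_closed)
  have 4: "b v w = b w v" if "v \<in> carrier M" "w \<in> carrier M" for v w
    unfolding b_def by (rule R.finsum_cong') (use cl that in \<open>auto simp: R.a_comm\<close>)
  have 5: "q (v \<oplus>\<^bsub>M\<^esub> w) = (q v \<oplus> q w) \<oplus> b v w" if h: "v \<in> carrier M" "w \<in> carrier M" for v w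
  proof -
    have "q (v \<oplus>\<^bsub>M\<^esub> w)
      = (\<Oplus>i\<in>{..<n}. (l i v \<otimes> m i v \<oplus> l i w \<otimes> m i w) \<oplus> (l i v \<otimes> m i w \<oplus> l i w \<otimes> m i v))"
      unfolding q[OF M.a_closed[OF h]]
      by (rule R.finsum_cong') (use cl add h in \<open>auto simp: R.l_distr R.r_distr R.a_ac\<close>)
    also have "\<dots> = (q v \<oplus> q w) \<oplus> b v w"
      unfolding q[OF h(1)] q[OF h(2)] b_def using cl h by (simp add: R.finsum_addf Pi_iff)
    finally show ?thesis .
  qed
  have 6: "b (u \<oplus>\<^bsub>M\<^esub> v) w = b u w \<oplus> b v w"
    if h: "u \<in> carrier M" "v \<in> carrier M" "w \<in> carrier M" for u v w
  proof -
    have "b (u \<oplus>\<^bsub>M\<^esub> v) w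
      = (\<Oplus>i\<in>{..<n}. (l i u \<otimes> m i w \<oplus> l i w \<otimes> m i u) \<oplus> (l i v \<otimes> m i w \<oplus> l i w \<otimes> m i v))"
      unfolding b_def
      by (rule R.finsum_cong') (use cl add h in \<open>auto simp: R.l_distr R.r_distr R.a_ac\<close>)
    also have "\<dots> = b u w \<oplus> b v w"
      unfolding b_def by (rule R.finsum_addf) (use cl h in auto)
    finally show ?thesis .
  qed
  have 7: "b (c \<odot>\<^bsub>M\<^esub> v) w = c \<otimes> b v w"
    if h: "c \<in> carrier R" "v \<in> carrier M" "w \<in> carrier M" for c v w
  proof -
    have "b (c \<odot>\<^bsub>M\<^esub> v) w = (\<Oplus>i\<in>{..<n}. c \<otimes> (l i v \<otimes> m i w \<oplus> l i w \<otimes> m i v))"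
      unfolding b_def
      by (rule R.finsum_cong') (use cl sm h in \<open>auto simp: R.r_distr R.m_ac\<close>)
    also have "\<dots> = c \<otimes> b v w"
      unfolding b_def by (rule R.finsum_rdistr[symmetric]) (use cl h in auto)
    finally show ?thesis .
  qed
  show ?thesis
    by (intro exI[of _ b] conjI ballI; rule 1 2 3 4 5 6 7; assumption)
qed

lemma is_quadratic_form_0: "(\<And>v. v \<in> carrier M \<Longrightarrow> q v = \<zero>) \<Longrightarrow> is_quadratic_form R M q"
  unfolding is_quadratic_form_def by (rule exI[of _ 0]) simp

lemma is_quadratic_form_mult:
  assumes "is_linear_form R M l" "is_linear_form R M m"
    and "\<And>v. v \<in> carrier M \<Longrightarrow> q v = l v \<otimes> m v"
  shows "is_quadratic_form R M q"
  unfolding is_quadratic_form_def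
proof (intro exI conjI ballI)
  show "\<forall>i<1::nat. is_linear_form R M l \<and> is_linear_form R M m" using assms by simp
  fix v assume v: "v \<in> carrier M"
  then have "l v \<otimes> m v \<in> carrier R" using assms by (auto simp: is_linear_form_def)
  then show "q v = (\<Oplus>i\<in>{..<1::nat}. l v \<otimes> m v)" using assms(3)[OF v] by (simp add: lessThan_Suc)
qed

lemma is_quadratic_form_add:
  assumes "is_quadratic_form R M q1" "is_quadratic_form R M q2"
    and "\<And>v. v \<in> carrier M \<Longrightarrow> q v = q1 v \<oplus> q2 v"
  shows "is_quadratic_form R M q"
proof -
  obtain n l m where lm: "\<And>i. i < n \<Longrightarrow> is_linear_form R M (l i) \<and> is_linear_form R M (m i)"
    and q1: "\<And>v. v \<in> carrier M \<Longrightarrow> q1 v = (\<Oplus>i\<in>{..<n::nat}. l i v \<otimes> m i v)"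
    using assms unfolding is_quadratic_form_def by blast
  obtain n' l' m' where lm': "\<And>i. i < n' \<Longrightarrow> is_linear_form R M (l' i) \<and> is_linear_form R M (m' i)"
    and q2: "\<And>v. v \<in> carrier M \<Longrightarrow> q2 v = (\<Oplus>i\<in>{..<n'::nat}. l' i v \<otimes> m' i v)"
    using assms unfolding is_quadratic_form_def by blast
  define L where "L i = (if i < n then l i else l' (i - n))" for i
  define N where "N i = (if i < n then m i else m' (i - n))" for i
  have cl1: "l i v \<otimes> m i v \<in> carrier R" if "i < n" "v \<in> carrier M" for i v
    using is_linear_form_closed[OF conjunct1[OF lm[OF that(1)]] that(2)]
      is_linear_form_closed[OF conjunct2[OF lm[OF that(1)]] that(2)] by simp
  have cl2: "l' i v \<otimes> m' i v \<in> carrier R" if "i < n'" "v \<in> carrier M" for i v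
    using is_linear_form_closed[OF conjunct1[OF lm'[OF that(1)]] that(2)]
      is_linear_form_closed[OF conjunct2[OF lm'[OF that(1)]] that(2)] by simp
  have cl: "L i v \<otimes> N i v \<in> carrier R" if "i < n + n'" "v \<in> carrier M" for i v
    using cl1[of i v] cl2[of "i - n" v] that by (cases "i < n") (auto simp: L_def N_def)
  have split: "(\<Oplus>i\<in>{..<n + k}. L i v \<otimes> N i v)
      = (\<Oplus>i\<in>{..<n}. l i v \<otimes> m i v) \<oplus> (\<Oplus>i\<in>{..<k}. l' i v \<otimes> m' i v)"
    if v: "v \<in> carrier M" and k: "k \<le> n'" for k v
    using k
  proof (induction k)
    case 0
    have "(\<Oplus>i\<in>{..<n}. L i v \<otimes> N i v) = (\<Oplus>i\<in>{..<n}. l i v \<otimes> m i v)"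
      using cl1[OF _ v] by (intro R.finsum_cong') (auto simp: L_def N_def)
    moreover have "(\<Oplus>i\<in>{..<n}. L i v \<otimes> N i v) \<in> carrier R"
      using cl[OF _ v] by (auto intro!: R.finsum_closed)
    ultimately show ?case by simp
  next
    case (Suc k)
    have c: "(\<Oplus>i\<in>{..<n}. l i v \<otimes> m i v) \<in> carrier R" "(\<Oplus>i\<in>{..<k}. l' i v \<otimes> m' i v) \<in> carrier R"
      "l' k v \<otimes> m' k v \<in> carrier R"
      using cl1[OF _ v] cl2[OF _ v] Suc.prems by (auto intro!: R.finsum_closed)
    have "(\<Oplus>i\<in>{..<n + Suc k}. L i v \<otimes> N i v) = L (n + k) v \<otimes> N (n + k) v \<oplus> (\<Oplus>i\<in>{..<n + k}. L i v \<otimes> N i v)"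
      using cl[OF _ v] Suc.prems by (simp add: lessThan_Suc R.finsum_insert Pi_iff)
    moreover have "(\<Oplus>i\<in>{..<Suc k}. l' i v \<otimes> m' i v) = l' k v \<otimes> m' k v \<oplus> (\<Oplus>i\<in>{..<k}. l' i v \<otimes> m' i v)"
      using cl2[OF _ v] Suc.prems by (simp add: lessThan_Suc R.finsum_insert Pi_iff)
    ultimately show ?case using Suc c by (simp add: L_def N_def R.a_ac)
  qed
  show ?thesis unfolding is_quadratic_form_def
  proof (intro exI conjI ballI allI impI)
    fix i assume "i < n + n'"
    then show "is_linear_form R M (L i)" "is_linear_form R M (N i)"
      using lm[of i] lm'[of "i - n"] by (auto simp: L_def N_def)
  next
    fix v assume "v \<in> carrier M"
    then show "q v = (\<Oplus>i\<in>{..<n + n'}. L i v \<otimes> N i v)" using assms(3) q1 q2 split by simp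
  qed
qed

end

lemma is_quadratic_form_pullback:
  assumes V: "module K V" and f: "is_linear K V W f" and q: "is_quadratic_form K W q"
    and eq: "\<And>v. v \<in> carrier V \<Longrightarrow> q' v = q (f v)"
  shows "is_quadratic_form K V q'"
proof -
  obtain n l m where lm: "\<And>i. i < n \<Longrightarrow> is_linear_form K W (l i) \<and> is_linear_form K W (m i)"
    and q: "\<And>v. v \<in> carrier W \<Longrightarrow> q v = (\<Oplus>\<^bsub>K\<^esub>i\<in>{..<n::nat}. l i v \<otimes>\<^bsub>K\<^esub> m i v)"
    using q unfolding is_quadratic_form_def by blast
  have "is_linear_form K V (\<lambda>v. l (f v))" if "is_linear_form K W l" for l
    using that f by (auto simp: is_linear_form_def is_linear_def Pi_iff)
  moreover have "f v \<in> carrier W" if "v \<in> carrier V" for v using that f by (auto simp: is_linear_def)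
  ultimately show ?thesis unfolding is_quadratic_form_def using lm q eq
    by (intro exI[of _ n] exI[of _ "\<lambda>i v. l i (f v)"] exI[of _ "\<lambda>i v. m i (f v)"]) simp
qed

lemma (in abelian_group) add_minus_cancel:
  "a \<in> carrier G \<Longrightarrow> b \<in> carrier G \<Longrightarrow> (a \<oplus> b) \<ominus> a = b"
  by (simp add: minus_eq a_comm[of a b] a_assoc r_neg)

context qspace
begin

lemma q_closed [simp, intro]: "v \<in> carrier D \<Longrightarrow> qform D v \<in> carrier R"
  and q_smult: "c \<in> carrier R \<Longrightarrow> v \<in> carrier D \<Longrightarrow> qform D (c \<odot>\<^bsub>D\<^esub> v) = c \<otimes> c \<otimes> qform D v"
  using quadratic_form_expansion[OF quadratic] by blast+

lemma polar_expansion: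
  shows polar_closed [simp, intro]: "v \<in> carrier D \<Longrightarrow> w \<in> carrier D \<Longrightarrow> polar R D v w \<in> carrier R"
    and polar_sym: "v \<in> carrier D \<Longrightarrow> w \<in> carrier D \<Longrightarrow> polar R D v w = polar R D w v"
    and q_add: "v \<in> carrier D \<Longrightarrow> w \<in> carrier D \<Longrightarrow>
      qform D (v \<oplus>\<^bsub>D\<^esub> w) = (qform D v \<oplus> qform D w) \<oplus> polar R D v w"
    and polar_add_left: "u \<in> carrier D \<Longrightarrow> v \<in> carrier D \<Longrightarrow> w \<in> carrier D \<Longrightarrow>
      polar R D (u \<oplus>\<^bsub>D\<^esub> v) w = polar R D u w \<oplus> polar R D v w"
    and polar_smult_left: "c \<in> carrier R \<Longrightarrow> v \<in> carrier D \<Longrightarrow> w \<in> carrier D \<Longrightarrow>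
      polar R D (c \<odot>\<^bsub>D\<^esub> v) w = c \<otimes> polar R D v w"
proof -
  obtain b where b: "\<forall>v \<in> carrier D. \<forall>w \<in> carrier D. b v w \<in> carrier R \<and> b v w = b w v \<and>
       qform D (v \<oplus>\<^bsub>D\<^esub> w) = (qform D v \<oplus> qform D w) \<oplus> b v w"
    "\<forall>u \<in> carrier D. \<forall>v \<in> carrier D. \<forall>w \<in> carrier D. b (u \<oplus>\<^bsub>D\<^esub> v) w = b u w \<oplus> b v w"
    "\<forall>c \<in> carrier R. \<forall>v \<in> carrier D. \<forall>w \<in> carrier D. b (c \<odot>\<^bsub>D\<^esub> v) w = c \<otimes> b v w"
    using quadratic_form_expansion[OF quadratic] by (elim exE conjE) (rule that)
  have p: "polar R D v w = b v w" if h: "v \<in> carrier D" "w \<in> carrier D" for v w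
  proof -
    note * = bspec[OF bspec[OF b(1) h(1)] h(2)]
    show ?thesis unfolding polar_def conjunct2[OF conjunct2[OF *]]
      by (rule R.add_minus_cancel) (use h * in auto)
  qed
  show "v \<in> carrier D \<Longrightarrow> w \<in> carrier D \<Longrightarrow> polar R D v w \<in> carrier R"
    "v \<in> carrier D \<Longrightarrow> w \<in> carrier D \<Longrightarrow> polar R D v w = polar R D w v"
    "v \<in> carrier D \<Longrightarrow> w \<in> carrier D \<Longrightarrow> qform D (v \<oplus>\<^bsub>D\<^esub> w) = (qform D v \<oplus> qform D w) \<oplus> polar R D v w"
    using b(1) by (simp_all add: p)
  show "u \<in> carrier D \<Longrightarrow> v \<in> carrier D \<Longrightarrow> w \<in> carrier D \<Longrightarrow>
      polar R D (u \<oplus>\<^bsub>D\<^esub> v) w = polar R D u w \<oplus> polar R D v w" using b(2) p by simp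
  show "c \<in> carrier R \<Longrightarrow> v \<in> carrier D \<Longrightarrow> w \<in> carrier D \<Longrightarrow>
      polar R D (c \<odot>\<^bsub>D\<^esub> v) w = c \<otimes> polar R D v w" using b(3) p by simp
qed

lemma polar_add_right: "u \<in> carrier D \<Longrightarrow> v \<in> carrier D \<Longrightarrow> w \<in> carrier D \<Longrightarrow>
    polar R D w (u \<oplus>\<^bsub>D\<^esub> v) = polar R D w u \<oplus> polar R D w v"
  using polar_add_left[of u v w] polar_sym[of w] by simp

lemma polar_smult_right: "c \<in> carrier R \<Longrightarrow> v \<in> carrier D \<Longrightarrow> w \<in> carrier D \<Longrightarrow>
    polar R D w (c \<odot>\<^bsub>D\<^esub> v) = c \<otimes> polar R D w v"
  using polar_smult_left[of c v w] polar_sym[of w] by simp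

lemma q_zero [simp]: "qform D \<zero>\<^bsub>D\<^esub> = \<zero>"
  using q_smult[of \<zero> "\<zero>\<^bsub>D\<^esub>"] by simp

lemma polar_zero [simp]: "v \<in> carrier D \<Longrightarrow> polar R D \<zero>\<^bsub>D\<^esub> v = \<zero>" "v \<in> carrier D \<Longrightarrow> polar R D v \<zero>\<^bsub>D\<^esub> = \<zero>"
  using polar_smult_left[of \<zero> "\<zero>\<^bsub>D\<^esub>" v] polar_sym[of v "\<zero>\<^bsub>D\<^esub>"] by auto

lemma polar_self:
  assumes "v \<in> carrier D"
  shows "polar R D v v = qform D v \<oplus> qform D v"
proof -
  have "v \<oplus>\<^bsub>D\<^esub> v = (\<one> \<oplus> \<one>) \<odot>\<^bsub>D\<^esub> v" using assms by (simp add: smult_l_distr)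
  then have "qform D (v \<oplus>\<^bsub>D\<^esub> v) = (qform D v \<oplus> qform D v) \<oplus> (qform D v \<oplus> qform D v)"
    using assms by (simp add: q_smult R.l_distr R.r_distr R.a_ac)
  then show ?thesis using q_add[OF assms assms] assms by simp
qed

text \<open>The value at \<open>w = 0\<close> gives \<open>q v = 0\<close>; the condition at \<open>w\<close> then becomes \<open>b(v, w) = 0\<close>.\<close>

lemma rad_iff:
  "v \<in> rad D \<longleftrightarrow> v \<in> carrier D \<and> qform D v = \<zero> \<and> (\<forall>w \<in> carrier D. polar R D v w = \<zero>)"
proof
  assume v: "v \<in> rad D"
  then have vc: "v \<in> carrier D" and e: "\<And>w. w \<in> carrier D \<Longrightarrow> qform D (v \<oplus>\<^bsub>D\<^esub> w) = qform D w"
    by (auto simp: rad_def)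
  have q0: "qform D v = \<zero>" using e[of "\<zero>\<^bsub>D\<^esub>"] vc by simp
  have "polar R D v w = \<zero>" if "w \<in> carrier D" for w
    using e[OF that] q_add[OF vc that] q0 that vc by simp
  then show "v \<in> carrier D \<and> qform D v = \<zero> \<and> (\<forall>w \<in> carrier D. polar R D v w = \<zero>)" using vc q0 by blast
next
  assume "v \<in> carrier D \<and> qform D v = \<zero> \<and> (\<forall>w \<in> carrier D. polar R D v w = \<zero>)"
  then show "v \<in> rad D" using q_add by (simp add: rad_def)
qed

lemma rad_submodule: "submodule (rad D) R D"
  by (rule submoduleI')
    (auto simp: rad_iff q_add q_smult polar_add_left polar_smult_left)

end

subsection \<open>The category of quadratic spaces\<close>

lemma Eq_obj: "D \<in> obj (Eq_deg K) \<longleftrightarrow> module K D \<and> finite_dim K D \<and> is_quadratic_form K D (qform D)"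
  by (simp add: Eq_deg_def concrete_cat_simps)

lemma Eq_arr: "(D, f, E) \<in> arr (Eq_deg K) \<longleftrightarrow> D \<in> obj (Eq_deg K) \<and> E \<in> obj (Eq_deg K) \<and>
    f \<in> carrier D \<rightarrow>\<^sub>E carrier E \<and> is_linear K D E f \<and> inj_on f (carrier D) \<and>
    (\<forall>v \<in> carrier D. qform E (f v) = qform D v)"
  by (auto simp: Eq_deg_def concrete_cat_simps)

lemma Eq_homs: "\<phi> \<in> homs (Eq_deg K) D E \<longleftrightarrow> (\<exists>f. \<phi> = (D, f, E) \<and> (D, f, E) \<in> arr (Eq_deg K))"
  by (simp add: Eq_deg_def homs_concrete_cat)

lemma Eq_simps [simp]:
  "src (Eq_deg K) (D, f, E) = D" "tgt (Eq_deg K) (D, f, E) = E"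
  "idn (Eq_deg K) D = (D, \<lambda>v\<in>carrier D. v, D)"
  "cmp (Eq_deg K) (E', g, G) (D, f, E) = (D, compose (carrier D) g f, G)"
  by (simp_all add: Eq_deg_def concrete_cat_simps)

lemma Eq_arr_restrict:
  assumes "D \<in> obj (Eq_deg K)" "E \<in> obj (Eq_deg K)" "is_linear K D E f" "inj_on f (carrier D)"
    "\<And>v. v \<in> carrier D \<Longrightarrow> qform E (f v) = qform D v"
  shows "(D, restrict f (carrier D), E) \<in> arr (Eq_deg K)"
proof -
  have "is_linear K D E (restrict f (carrier D))"
    using assms is_linear_cong[of K D E f "restrict f (carrier D)"] by (simp add: Eq_obj)
  then show ?thesis using assms by (auto simp: Eq_arr is_linear_def inj_on_def)
qed

lemma category_Eq: "category (Eq_deg K)"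
  unfolding Eq_deg_def
proof (rule category_concrete_cat)
  let ?M = "\<lambda>D E f. is_linear K D E f \<and> inj_on f (carrier D) \<and> (\<forall>v\<in>carrier D. qform E (f v) = qform D v)"
  let ?O = "{D. module K D \<and> finite_dim K D \<and> is_quadratic_form K D (qform D)}"
  fix A :: "('a, 'b) quad_space" assume "A \<in> ?O"
  then show "?M A A (\<lambda>v\<in>carrier A. v)"
    using is_linear_cong[OF _ is_linear_id, of K A "\<lambda>v\<in>carrier A. v"] by auto
next
  let ?M = "\<lambda>D E f. is_linear K D E f \<and> inj_on f (carrier D) \<and> (\<forall>v\<in>carrier D. qform E (f v) = qform D v)"
  let ?O = "{D. module K D \<and> finite_dim K D \<and> is_quadratic_form K D (qform D)}"
  fix A B D :: "('a, 'b) quad_space" and f g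
  assume "(A, f, B) \<in> arr (concrete_cat ?O ?M)" "(B, g, D) \<in> arr (concrete_cat ?O ?M)"
  then have *: "module K A" "is_linear K A B f" "is_linear K B D g" "inj_on f (carrier A)"
    "inj_on g (carrier B)" "f \<in> carrier A \<rightarrow> carrier B"
    "\<forall>v\<in>carrier A. qform B (f v) = qform A v" "\<forall>v\<in>carrier B. qform D (g v) = qform B v"
    by (auto simp: concrete_cat_simps)
  have "inj_on (compose (carrier A) g f) (carrier A)"
    using * by (auto simp: inj_on_def compose_eq Pi_iff)
  then show "?M A D (compose (carrier A) g f)"
    using is_linear_cong[OF *(1) is_linear_comp[OF *(2,3)]] *(6-8) by (simp add: compose_eq Pi_iff)
qed

lemma Eq_is_isoI:
  assumes a: "(D, f, E) \<in> arr (Eq_deg K)" and surj: "f ` carrier D = carrier E"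
  shows "is_iso (Eq_deg K) (D, f, E)"
proof -
  interpret category "Eq_deg K" by (rule category_Eq)
  have inj: "inj_on f (carrier D)" and f: "is_linear K D E f" and D: "module K D" and E: "module K E"
    and q: "\<And>v. v \<in> carrier D \<Longrightarrow> qform E (f v) = qform D v"
    using a by (auto simp: Eq_arr Eq_obj)
  interpret f: linear_map K D E f using f D E by (simp add: linear_map_def linear_map_axioms_def)
  let ?g = "the_inv_into (carrier D) f"
  have g: "?g w \<in> carrier D" "f (?g w) = w" if "w \<in> carrier E" for w
    using that surj the_inv_into_into[OF inj, of w] f_the_inv_into_f[OF inj] by auto
  have gf: "?g (f v) = v" if "v \<in> carrier D" for v using the_inv_into_f_f[OF inj that] .
  have ga: "(E, restrict ?g (carrier E), D) \<in> arr (Eq_deg K)"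
  proof (rule Eq_arr_restrict)
    show "is_linear K E D ?g" using f.inverse_linear[OF inj surj] .
    show "inj_on ?g (carrier E)" using inj_on_the_inv_into[OF inj] surj by simp
    show "qform D (?g v) = qform E v" if "v \<in> carrier E" for v using q[of "?g v"] g that by simp
  qed (use a in \<open>auto simp: Eq_arr\<close>)
  show ?thesis
  proof (rule is_isoI)
    show "(D, f, E) \<in> homs (Eq_deg K) D E" "(E, restrict ?g (carrier E), D) \<in> homs (Eq_deg K) E D"
      using a ga by (simp_all add: homs_iff)
    show "cmp (Eq_deg K) (E, restrict ?g (carrier E), D) (D, f, E) = idn (Eq_deg K) D"
      using gf by (auto simp: compose_def)
    show "cmp (Eq_deg K) (D, f, E) (E, restrict ?g (carrier E), D) = idn (Eq_deg K) E"
      using g by (auto simp: compose_def)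
  qed
qed

lemma Eq_is_iso_surj:
  assumes "(D, f, E) \<in> arr (Eq_deg K)" "is_iso (Eq_deg K) (D, f, E)"
  shows "f ` carrier D = carrier E"
proof -
  obtain g where g: "(E, g, D) \<in> arr (Eq_deg K)" "compose (carrier E) f g = (\<lambda>v\<in>carrier E. v)"
    using assms(2) by (auto simp: is_iso_def Eq_homs)
  have "w \<in> f ` carrier D" if "w \<in> carrier E" for w
  proof -
    have "f (g w) = w" using fun_cong[OF g(2), of w] that by (simp add: compose_eq)
    then show ?thesis using g(1) that by (force simp: Eq_arr)
  qed
  then show ?thesis using assms by (auto simp: Eq_arr)
qed

locale Eq_map = linear_map K D E f + D: qspace K D + E: qspace K E
  for K :: "('k, 'r) ring_scheme" and D E :: "('k, 'x) quad_space" and f +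
  assumes arr: "(D, f, E) \<in> arr (Eq_deg K)"
begin

lemma map_inj: "inj_on f (carrier D)"
  and map_q: "v \<in> carrier D \<Longrightarrow> qform E (f v) = qform D v"
  using arr by (auto simp: Eq_arr)

lemma map_polar:
  assumes "v \<in> carrier D" "w \<in> carrier D"
  shows "polar K E (f v) (f w) = polar K D v w"
  using assms map_q[of "v \<oplus>\<^bsub>D\<^esub> w"] map_add[OF assms] by (simp add: polar_def map_q)

lemma map_rad: "v \<in> carrier D \<Longrightarrow> f v \<in> rad E \<Longrightarrow> v \<in> rad D"
  unfolding D.rad_iff E.rad_iff using map_polar[of v] map_q[of v] by (metis map_closed)

lemma preimage_rad_submodule: "submodule {v \<in> carrier D. f v \<in> rad E} K D"
  by (rule submodule_preimage[OF V.carrier_is_submodule E.rad_submodule])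

end

context field
begin

lemma Eq_qspace: "D \<in> obj (Eq_deg R) \<Longrightarrow> qspace R D"
  by (simp add: Eq_obj qspace_def vec_def field_axioms qspace_axioms_def)

lemma Eq_mapI: "(D, f, E) \<in> arr (Eq_deg R) \<Longrightarrow> Eq_map R D E f"
  unfolding Eq_map_def Eq_map_axioms_def linear_map_def linear_map_axioms_def
  using Eq_qspace by (auto simp: Eq_arr Eq_obj)

lemma subspace_on_obj:
  assumes D: "D \<in> obj (Eq_deg R)" and U: "submodule U R D"
  shows "subspace_on D U \<in> obj (E_inj R)"
proof -
  interpret D: qspace R D by (rule Eq_qspace[OF D])
  have e: "carrier (subspace_on D U) = U" "zero (subspace_on D U) = zero D"
    "add (subspace_on D U) = add D" "smult (subspace_on D U) = smult D"
    by (simp_all add: subspace_on_def module.truncate_def)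
  have m: "module R (D\<lparr>carrier := U\<rparr>)" using submodule.submodule_is_module[OF U D.module_axioms] .
  have m': "module R (subspace_on D U)" by (rule module_cong[OF m]) (simp_all add: e)
  have "finite_dim R (D\<lparr>carrier := U\<rparr>)" using D.finite_dim_submodule[OF U] D by (simp add: Eq_obj)
  then have "finite_dim R (subspace_on D U)"
    unfolding module.finite_dim_iff[OF m] module.finite_dim_iff[OF m'] 
    unfolding lin_cong[OF e(2-4)] e(1) by simp
  then show ?thesis using m' by (simp add: E_inj_obj)
qed

lemma Rad_simps [simp]: "carrier (Rad D) = rad D" "zero (Rad D) = zero D"
    "add (Rad D) = add D" "smult (Rad D) = smult D" "(Rad D)\<lparr>carrier := U\<rparr> = subspace_on D U"
  by (simp_all add: Rad_def subspace_on_def module.truncate_def)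

lemma Rad_obj: "D \<in> obj (Eq_deg R) \<Longrightarrow> Rad D \<in> obj (E_inj R)"
  unfolding Rad_def using subspace_on_obj qspace.rad_submodule[OF Eq_qspace] by blast

lemma submodule_of_submodule:
  assumes V: "module R V" and U: "submodule U R V" and S: "S \<subseteq> U"
    and W: "module R W" "zero W = zero V" "add W = add V" "smult W = smult V" "carrier W = U"
  shows "submodule S R W \<longleftrightarrow> submodule S R V"
proof -
  interpret V: module R V by (rule V)
  interpret W: module R W by (rule W(1))
  note T = V.submoduleE[OF U]
  show ?thesis
  proof
    assume h: "submodule S R W"
    note H = W.submoduleE[OF h] W.submodule_zero[OF h]
    show "submodule S R V" by (rule V.submoduleI') (use H T S W in auto)
  next
    assume h: "submodule S R V"
    note H = V.submoduleE[OF h] V.submodule_zero[OF h]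
    show "submodule S R W" by (rule W.submoduleI') (use H T S W in auto)
  qed
qed

lemma pmap_Psi:
  assumes "(D, f, E) \<in> arr (Eq_deg R)"
  shows "pmap R (Rad D) {v \<in> carrier D. f v \<in> rad E} f (Rad E)"
proof -
  interpret f: Eq_map R D E f by (rule Eq_mapI[OF assms])
  have DE: "D \<in> obj (Eq_deg R)" "E \<in> obj (Eq_deg R)" using assms by (auto simp: Eq_arr)
  let ?U = "{v \<in> carrier D. f v \<in> rad E}"
  have "?U \<subseteq> rad D" using f.map_rad by blast
  then have "submodule ?U R (Rad D)"
    using submodule_of_submodule[OF f.V.module_axioms f.D.rad_submodule, of ?U "Rad D"] f.preimage_rad_submodule
      Rad_obj[OF DE(1)] by (simp add: E_inj_obj)
  moreover have "is_linear R (subspace_on D ?U) (Rad E) f"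
    using f.map_add f.map_smult by (auto simp: is_linear_def subspace_on_def module.truncate_def)
  moreover have "inj_on f ?U" using f.map_inj by (auto simp: inj_on_def)
  ultimately show ?thesis using Rad_obj[OF DE(1)] Rad_obj[OF DE(2)] by (simp add: pmap_def)
qed

lemma Psi_arr: "on_arr (Psi_tilde R) (D, f, E) = pmor R (Rad D) {v \<in> carrier D. f v \<in> rad E} f (Rad E)"
  by (simp add: Psi_tilde_def pspan_def Let_def)

lemma Psi_obj: "on_obj (Psi_tilde R) D = Rad D"
  by (simp add: Psi_tilde_def)

theorem Psi_functor: "is_functor (Eq_deg R) (Sp (E_inj R)) (Psi_tilde R)"
proof (intro is_functor.intro is_functor_axioms.intro category_Eq category_Sp)
  show "on_obj (Psi_tilde R) D \<in> obj (Sp (E_inj R))" if "D \<in> obj (Eq_deg R)" for D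
    using Rad_obj[OF that] by (simp add: Psi_obj)
  show "on_arr (Psi_tilde R) \<phi> \<in> homs (Sp (E_inj R)) (on_obj (Psi_tilde R) D) (on_obj (Psi_tilde R) E)"
    if "\<phi> \<in> homs (Eq_deg R) D E" for \<phi> D E
    using that pmor_homs[OF pmap_Psi] by (auto simp: Eq_homs Psi_obj Psi_arr)
  show "on_arr (Psi_tilde R) (idn (Eq_deg R) D) = idn (Sp (E_inj R)) (on_obj (Psi_tilde R) D)"
    if "D \<in> obj (Eq_deg R)" for D
  proof -
    have "{v \<in> carrier D. (\<lambda>v\<in>carrier D. v) v \<in> rad D} = rad D" by (auto simp: rad_def)
    then show ?thesis
      using pspan_cong[of "rad D" "\<lambda>v\<in>carrier D. v" "\<lambda>v. v"]
      by (simp add: Psi_arr Psi_obj idn_Sp) (auto simp: rad_def)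
  qed
  show "on_arr (Psi_tilde R) (cmp (Eq_deg R) \<psi> \<phi>)
      = cmp (Sp (E_inj R)) (on_arr (Psi_tilde R) \<psi>) (on_arr (Psi_tilde R) \<phi>)"
    if h: "\<phi> \<in> homs (Eq_deg R) D E" "\<psi> \<in> homs (Eq_deg R) E G" for \<phi> \<psi> D E G
  proof -
    obtain f g where e: "\<phi> = (D, f, E)" "\<psi> = (E, g, G)" "(D, f, E) \<in> arr (Eq_deg R)" "(E, g, G) \<in> arr (Eq_deg R)"
      using h by (auto simp: Eq_homs)
    interpret f: Eq_map R D E f by (rule Eq_mapI[OF e(3)])
    interpret g: Eq_map R E G g by (rule Eq_mapI[OF e(4)])
    have d: "{v \<in> carrier D. compose (carrier D) g f v \<in> rad G}
      = {v \<in> {v \<in> carrier D. f v \<in> rad E}. f v \<in> {w \<in> carrier E. g w \<in> rad G}}"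
      using g.map_rad by (auto simp: compose_eq)
    show ?thesis
      unfolding e Psi_arr cmp_pmor[OF pmap_Psi[OF e(3)] pmap_Psi[OF e(4)]] Eq_simps d
      using pspan_cong[of "{v \<in> {v \<in> carrier D. f v \<in> rad E}. f v \<in> {w \<in> carrier E. g w \<in> rad G}}"
          "compose (carrier D) g f" "\<lambda>v. g (f v)"]
      by (simp add: compose_eq)
  qed
qed

end

section \<open>Orthogonal sums and hyperbolic spaces\<close>

lemma orth_sum_simps [simp]:
  "Couple v w \<in> carrier (orth_sum K D E) \<longleftrightarrow> v \<in> carrier D \<and> w \<in> carrier E"
  "zero (orth_sum K D E) = Couple \<zero>\<^bsub>D\<^esub> \<zero>\<^bsub>E\<^esub>"
  "Couple v w \<oplus>\<^bsub>orth_sum K D E\<^esub> Couple v' w' = Couple (v \<oplus>\<^bsub>D\<^esub> v') (w \<oplus>\<^bsub>E\<^esub> w')"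
  "c \<odot>\<^bsub>orth_sum K D E\<^esub> Couple v w = Couple (c \<odot>\<^bsub>D\<^esub> v) (c \<odot>\<^bsub>E\<^esub> w)"
  "qform (orth_sum K D E) (Couple v w) = qform D v \<oplus>\<^bsub>K\<^esub> qform E w"
  by (auto simp: orth_sum_def)

lemma orth_sum_cases:
  assumes "u \<in> carrier (orth_sum K D E)"
  obtains v w where "u = Couple v w" "v \<in> carrier D" "w \<in> carrier E"
  using assms by (auto simp: orth_sum_def)

lemma carrier_orth_sum: "carrier (orth_sum K D E) = {Couple v w | v w. v \<in> carrier D \<and> w \<in> carrier E}"
  by (simp add: orth_sum_def)

lemma hyperbolic_plane_simps [simp]:
  "Couple (Scalar x) (Scalar y) \<in> carrier (hyperbolic_plane K) \<longleftrightarrow> x \<in> carrier K \<and> y \<in> carrier K"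
  "zero (hyperbolic_plane K) = Couple (Scalar \<zero>\<^bsub>K\<^esub>) (Scalar \<zero>\<^bsub>K\<^esub>)"
  "Couple (Scalar x) (Scalar y) \<oplus>\<^bsub>hyperbolic_plane K\<^esub> Couple (Scalar x') (Scalar y') =
    Couple (Scalar (x \<oplus>\<^bsub>K\<^esub> x')) (Scalar (y \<oplus>\<^bsub>K\<^esub> y'))"
  "c \<odot>\<^bsub>hyperbolic_plane K\<^esub> Couple (Scalar x) (Scalar y) =
    Couple (Scalar (c \<otimes>\<^bsub>K\<^esub> x)) (Scalar (c \<otimes>\<^bsub>K\<^esub> y))"
  "qform (hyperbolic_plane K) (Couple (Scalar x) (Scalar y)) = x \<otimes>\<^bsub>K\<^esub> y"
  by (auto simp: hyperbolic_plane_def)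

lemma carrier_hyperbolic_plane:
  "carrier (hyperbolic_plane K) = {Couple (Scalar x) (Scalar y) | x y. x \<in> carrier K \<and> y \<in> carrier K}"
  by (simp add: hyperbolic_plane_def)

lemma zero_space_simps [simp]:
  "carrier (zero_space K) = {Scalar \<zero>\<^bsub>K\<^esub>}" "zero (zero_space K) = Scalar \<zero>\<^bsub>K\<^esub>"
  "add (zero_space K) u v = Scalar \<zero>\<^bsub>K\<^esub>" "smult (zero_space K) c v = Scalar \<zero>\<^bsub>K\<^esub>"
  "qform (zero_space K) v = \<zero>\<^bsub>K\<^esub>"
  by (simp_all add: zero_space_def)

context field
begin

lemma orth_sum_module:
  assumes D: "module R D" and E: "module R E"
  shows "module R (orth_sum R D E)"
proof -
  interpret D: module R D by (rule D)
  interpret E: module R E by (rule E)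
  show ?thesis
  proof (rule moduleI)
    show "cring R" by (rule is_cring)
    show "abelian_group (orth_sum R D E)"
    proof (rule abelian_groupI)
      fix x assume "x \<in> carrier (orth_sum R D E)"
      then obtain v w where x: "x = Couple v w" "v \<in> carrier D" "w \<in> carrier E" by (rule orth_sum_cases)
      then show "\<exists>y\<in>carrier (orth_sum R D E). y \<oplus>\<^bsub>orth_sum R D E\<^esub> x = \<zero>\<^bsub>orth_sum R D E\<^esub>"
        by (intro bexI[of _ "Couple (\<ominus>\<^bsub>D\<^esub> v) (\<ominus>\<^bsub>E\<^esub> w)"]) (auto simp: D.M.l_neg E.M.l_neg)
    qed (auto simp: carrier_orth_sum D.M.a_ac E.M.a_ac)
  qed (auto simp: carrier_orth_sum D.smult_l_distr E.smult_l_distr D.smult_r_distr E.smult_r_distr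
      D.smult_assoc1 E.smult_assoc1)
qed

lemma orth_sum_linear:
  shows "module R D \<Longrightarrow> module R E \<Longrightarrow> is_linear R D (orth_sum R D E) (\<lambda>v. Couple v \<zero>\<^bsub>E\<^esub>)"
    and "module R D \<Longrightarrow> module R E \<Longrightarrow> is_linear R E (orth_sum R D E) (\<lambda>w. Couple \<zero>\<^bsub>D\<^esub> w)"
    and "is_linear R (orth_sum R D E) D pfst"
    and "is_linear R (orth_sum R D E) E psnd"
proof -
  assume "module R D" "module R E"
  then interpret D: module R D + E: module R E by simp_all
  show "is_linear R D (orth_sum R D E) (\<lambda>v. Couple v \<zero>\<^bsub>E\<^esub>)"
    "is_linear R E (orth_sum R D E) (\<lambda>w. Couple \<zero>\<^bsub>D\<^esub> w)" by (auto simp: is_linear_def)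
qed (auto simp: is_linear_def carrier_orth_sum)

lemma orth_sum_obj:
  assumes D: "D \<in> obj (Eq_deg R)" and E: "E \<in> obj (Eq_deg R)"
  shows "orth_sum R D E \<in> obj (Eq_deg R)"
proof -
  interpret D: qspace R D by (rule Eq_qspace[OF D])
  interpret E: qspace R E by (rule Eq_qspace[OF E])
  let ?S = "orth_sum R D E"
  note m = orth_sum_module[OF D.module_axioms E.module_axioms]
  interpret S: module R ?S by (rule m)
  interpret S: vec R ?S by (intro vec.intro field_axioms m)
  interpret i: linear_map R D ?S "\<lambda>v. Couple v \<zero>\<^bsub>E\<^esub>"
    by (simp add: linear_map_def linear_map_axioms_def orth_sum_linear D.module_axioms E.module_axioms m)
  interpret j: linear_map R E ?S "\<lambda>w. Couple \<zero>\<^bsub>D\<^esub> w"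
    by (simp add: linear_map_def linear_map_axioms_def orth_sum_linear D.module_axioms E.module_axioms m)
  have "finite_dim R ?S"
  proof -
    obtain xs where xs: "set xs \<subseteq> carrier D" "lin R D xs = carrier D"
      using D D.finite_dim_iff by (auto simp: Eq_obj)
    obtain ys where ys: "set ys \<subseteq> carrier E" "lin R E ys = carrier E"
      using E E.finite_dim_iff by (auto simp: Eq_obj)
    define zs where "zs = map (\<lambda>v. Couple v \<zero>\<^bsub>E\<^esub>) xs @ map (\<lambda>w. Couple \<zero>\<^bsub>D\<^esub> w) ys"
    have zs: "set zs \<subseteq> carrier ?S" using xs ys by (auto simp: zs_def)
    note H = S.lin_submodule[OF zs]
    have "(\<lambda>v. Couple v \<zero>\<^bsub>E\<^esub>) ` carrier D \<subseteq> lin R ?S zs"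
      unfolding xs(2)[symmetric] i.image_lin[OF xs(1)]
      by (rule S.lin_subset[OF H]) (use S.lin_incl[OF zs] in \<open>auto simp: zs_def\<close>)
    moreover have "(\<lambda>w. Couple \<zero>\<^bsub>D\<^esub> w) ` carrier E \<subseteq> lin R ?S zs"
      unfolding ys(2)[symmetric] j.image_lin[OF ys(1)]
      by (rule S.lin_subset[OF H]) (use S.lin_incl[OF zs] in \<open>auto simp: zs_def\<close>)
    moreover have "u \<in> lin R ?S zs" if u0: "u \<in> carrier ?S" "(\<lambda>v. Couple v \<zero>\<^bsub>E\<^esub>) ` carrier D \<subseteq> lin R ?S zs"
      "(\<lambda>w. Couple \<zero>\<^bsub>D\<^esub> w) ` carrier E \<subseteq> lin R ?S zs" for u
    proof -
      obtain v w where u: "u = Couple v w" "v \<in> carrier D" "w \<in> carrier E"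
        by (rule orth_sum_cases[OF u0(1)])
      then have "u = Couple v \<zero>\<^bsub>E\<^esub> \<oplus>\<^bsub>?S\<^esub> Couple \<zero>\<^bsub>D\<^esub> w" by simp
      moreover have "Couple v \<zero>\<^bsub>E\<^esub> \<in> lin R ?S zs" "Couple \<zero>\<^bsub>D\<^esub> w \<in> lin R ?S zs" using u0(2,3) u by auto
      ultimately show ?thesis using S.submoduleE(5)[OF H] by metis
    qed
    ultimately have "lin R ?S zs = carrier ?S" using S.submoduleE(1)[OF H] by blast
    then show ?thesis using S.finite_dim_iff zs by blast
  qed
  moreover have "is_quadratic_form R ?S (qform ?S)"
  proof (rule S.is_quadratic_form_add)
    show "is_quadratic_form R ?S (\<lambda>u. qform D (pfst u))"
      by (rule is_quadratic_form_pullback[OF m orth_sum_linear(3) D.quadratic]) simp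
    show "is_quadratic_form R ?S (\<lambda>u. qform E (psnd u))"
      by (rule is_quadratic_form_pullback[OF m orth_sum_linear(4) E.quadratic]) simp
  qed (auto simp: carrier_orth_sum)
  ultimately show ?thesis using m by (simp add: Eq_obj)
qed

lemma polar_orth_sum:
  assumes D: "D \<in> obj (Eq_deg R)" and E: "E \<in> obj (Eq_deg R)"
    and v: "v \<in> carrier D" "v' \<in> carrier D" and w: "w \<in> carrier E" "w' \<in> carrier E"
  shows "polar R (orth_sum R D E) (Couple v w) (Couple v' w') = polar R D v v' \<oplus> polar R E w w'"
proof -
  interpret D: qspace R D by (rule Eq_qspace[OF D])
  interpret E: qspace R E by (rule Eq_qspace[OF E])
  define a b where "a = (qform D v \<oplus> qform E w) \<oplus> (qform D v' \<oplus> qform E w')"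
    and "b = polar R D v v' \<oplus> polar R E w w'"
  have "qform D (v \<oplus>\<^bsub>D\<^esub> v') \<oplus> qform E (w \<oplus>\<^bsub>E\<^esub> w') = a \<oplus> b"
    unfolding a_def b_def using v w by (simp add: D.q_add E.q_add a_ac)
  moreover have "a \<in> carrier R" "b \<in> carrier R" using v w by (auto simp: a_def b_def)
  ultimately show ?thesis using add_minus_cancel[of a b] by (simp add: polar_def a_def b_def)
qed

lemma hyperbolic_plane_obj: "hyperbolic_plane R \<in> obj (Eq_deg R)"
proof -
  let ?H = "hyperbolic_plane R :: ('a, 'c) quad_space"
  have m: "module R ?H"
  proof (rule moduleI)
    show "cring R" by (rule is_cring)
    show "abelian_group ?H"
    proof (rule abelian_groupI)
      fix u assume "u \<in> carrier ?H"
      then obtain x y where "u = Couple (Scalar x) (Scalar y)" "x \<in> carrier R" "y \<in> carrier R"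
        by (auto simp: carrier_hyperbolic_plane)
      then show "\<exists>z\<in>carrier ?H. z \<oplus>\<^bsub>?H\<^esub> u = \<zero>\<^bsub>?H\<^esub>"
        by (intro bexI[of _ "Couple (Scalar (\<ominus> x)) (Scalar (\<ominus> y))"]) (auto simp: l_neg)
    qed (auto simp: carrier_hyperbolic_plane a_ac)
  qed (auto simp: carrier_hyperbolic_plane l_distr r_distr m_assoc)
  interpret H: vec R ?H by (intro vec.intro field_axioms m)
  let ?e = "Couple (Scalar \<one>) (Scalar \<zero>)" and ?f = "Couple (Scalar \<zero>) (Scalar \<one>)"
  have "carrier ?H \<subseteq> lin R ?H [?e, ?f]"
  proof
    fix u assume "u \<in> carrier ?H"
    then obtain x y where u: "u = Couple (Scalar x) (Scalar y)" "x \<in> carrier R" "y \<in> carrier R"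
      by (auto simp: carrier_hyperbolic_plane)
    then have "u = x \<odot>\<^bsub>?H\<^esub> ?e \<oplus>\<^bsub>?H\<^esub> (y \<odot>\<^bsub>?H\<^esub> ?f \<oplus>\<^bsub>?H\<^esub> \<zero>\<^bsub>?H\<^esub>)" by simp
    then show "u \<in> lin R ?H [?e, ?f]" using u(2,3) unfolding lin.simps by blast
  qed
  then have "finite_dim R ?H" unfolding H.finite_dim_iff
    using H.submoduleE(1)[OF H.lin_submodule[of "[?e, ?f]"]]
    by (intro exI[of _ "[?e, ?f]"]) (auto simp del: lin.simps)
  moreover have "is_quadratic_form R ?H (qform ?H)"
  proof (rule H.is_quadratic_form_mult)
    show "is_linear_form R ?H (\<lambda>u. scalar_of (pfst u))" "is_linear_form R ?H (\<lambda>u. scalar_of (psnd u))"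
      by (auto simp: is_linear_form_def carrier_hyperbolic_plane)
  qed (auto simp: carrier_hyperbolic_plane)
  ultimately show ?thesis using m by (simp add: Eq_obj)
qed

lemma zero_space_obj: "zero_space R \<in> obj (Eq_deg R)"
proof -
  let ?Z = "zero_space R :: ('a, 'c) quad_space"
  have m: "module R ?Z"
    by (rule moduleI) (auto intro!: abelian_groupI is_cring)
  interpret Z: vec R ?Z by (intro vec.intro field_axioms m)
  have "finite_dim R ?Z" unfolding Z.finite_dim_iff by (rule exI[of _ "[]"]) simp
  moreover have "is_quadratic_form R ?Z (qform ?Z)" by (rule Z.is_quadratic_form_0) simp
  ultimately show ?thesis using m by (simp add: Eq_obj)
qed

text \<open>Nondegeneracy of the polar form is stronger than a trivial radical in characteristic 2;
  unlike the latter it is inherited by orthogonal sums.\<close>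

definition nondeg :: "('a, 'x) quadratic_module \<Rightarrow> bool" where
  "nondeg D \<longleftrightarrow> (\<forall>v \<in> carrier D. (\<forall>w \<in> carrier D. polar R D v w = \<zero>) \<longrightarrow> v = \<zero>\<^bsub>D\<^esub>)"

lemma nondeg_orth_sum:
  assumes "D \<in> obj (Eq_deg R)" "E \<in> obj (Eq_deg R)" "nondeg D" "nondeg E"
  shows "nondeg (orth_sum R D E)"
proof -
  interpret D: qspace R D by (rule Eq_qspace[OF assms(1)])
  interpret E: qspace R E by (rule Eq_qspace[OF assms(2)])
  have "v = \<zero>\<^bsub>D\<^esub> \<and> w = \<zero>\<^bsub>E\<^esub>" if h: "v \<in> carrier D" "w \<in> carrier E"
    "\<And>u. u \<in> carrier (orth_sum R D E) \<Longrightarrow> polar R (orth_sum R D E) (Couple v w) u = \<zero>" for v w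
  proof -
    have "polar R D v v' = \<zero>" if "v' \<in> carrier D" for v'
      using h(3)[of "Couple v' \<zero>\<^bsub>E\<^esub>"] polar_orth_sum[OF assms(1,2)] h(1,2) that by simp
    moreover have "polar R E w w' = \<zero>" if "w' \<in> carrier E" for w'
      using h(3)[of "Couple \<zero>\<^bsub>D\<^esub> w'"] polar_orth_sum[OF assms(1,2)] h(1,2) that by simp
    ultimately show ?thesis using assms(3,4) h(1,2) by (auto simp: nondeg_def)
  qed
  then show ?thesis unfolding nondeg_def by (auto elim!: orth_sum_cases)
qed

lemma polar_hyperbolic_plane:
  assumes "x \<in> carrier R" "y \<in> carrier R" "x' \<in> carrier R" "y' \<in> carrier R"
  shows "polar R (hyperbolic_plane R) (Couple (Scalar x) (Scalar y)) (Couple (Scalar x') (Scalar y'))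
    = x \<otimes> y' \<oplus> x' \<otimes> y"
proof -
  have "(x \<oplus> x') \<otimes> (y \<oplus> y') = (x \<otimes> y \<oplus> x' \<otimes> y') \<oplus> (x \<otimes> y' \<oplus> x' \<otimes> y)"
    using assms by (simp add: l_distr r_distr a_ac)
  then show ?thesis
    using add_minus_cancel[of "x \<otimes> y \<oplus> x' \<otimes> y'" "x \<otimes> y' \<oplus> x' \<otimes> y"] assms by (simp add: polar_def)
qed

lemma nondeg_hyperbolic_plane: "nondeg (hyperbolic_plane R)"
proof -
  have "x = \<zero> \<and> y = \<zero>" if h: "x \<in> carrier R" "y \<in> carrier R"
    "\<And>u. u \<in> carrier (hyperbolic_plane R) \<Longrightarrow>
      polar R (hyperbolic_plane R) (Couple (Scalar x) (Scalar y)) u = \<zero>" for x y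
    using h(3)[of "Couple (Scalar \<zero>) (Scalar \<one>)"] h(3)[of "Couple (Scalar \<one>) (Scalar \<zero>)"] h(1,2)
    by (simp add: polar_hyperbolic_plane)
  then show ?thesis unfolding nondeg_def by (auto simp: carrier_hyperbolic_plane)
qed

lemma hyperbolic_sum_obj: "hyperbolic_sum R n \<in> obj (Eq_deg R)"
  by (induction n) (auto intro: zero_space_obj orth_sum_obj hyperbolic_plane_obj)

lemma nondeg_hyperbolic_sum: "nondeg (hyperbolic_sum R n)"
proof (induction n)
  case 0 then show ?case by (simp add: nondeg_def)
qed (auto intro: nondeg_orth_sum hyperbolic_sum_obj hyperbolic_plane_obj nondeg_hyperbolic_plane)

lemma hyperbolic_space:
  assumes "hyperbolic_space R H"
  shows "H \<in> obj (Eq_deg R)" "nondeg H"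
proof -
  obtain n f where f: "(H, f, hyperbolic_sum R n) \<in> arr (Eq_deg R)"
    "is_iso (Eq_deg R) (H, f, hyperbolic_sum R n)"
    using assms by (auto simp: hyperbolic_space_def isomorphic_def Eq_homs)
  show "H \<in> obj (Eq_deg R)" using f by (simp add: Eq_arr)
  interpret f: Eq_map R H "hyperbolic_sum R n" f by (rule Eq_mapI[OF f(1)])
  have surj: "f ` carrier H = carrier (hyperbolic_sum R n)" by (rule Eq_is_iso_surj[OF f])
  show "nondeg H" unfolding nondeg_def
  proof (intro ballI impI)
    fix v assume v: "v \<in> carrier H" and h: "\<forall>w\<in>carrier H. polar R H v w = \<zero>"
    have "polar R (hyperbolic_sum R n) (f v) w = \<zero>" if "w \<in> carrier (hyperbolic_sum R n)" for w
      using that v h f.map_polar unfolding surj[symmetric] by auto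
    then have "f v = \<zero>\<^bsub>hyperbolic_sum R n\<^esub>"
      using nondeg_hyperbolic_sum[of n] v f.map_closed unfolding nondeg_def by blast
    then show "v = \<zero>\<^bsub>H\<^esub>" using inj_onD[OF f.map_inj, of v "\<zero>\<^bsub>H\<^esub>"] v by simp
  qed
qed

lemma hyperbolic_space_plane: "hyperbolic_space R (hyperbolic_plane R)"
proof -
  let ?H = "hyperbolic_plane R :: ('a, 'c) quad_space" and ?Z = "zero_space R :: ('a, 'c) quad_space"
  interpret H: qspace R ?H by (rule Eq_qspace[OF hyperbolic_plane_obj])
  interpret Z: qspace R ?Z by (rule Eq_qspace[OF zero_space_obj])
  let ?f = "restrict (\<lambda>u. Couple \<zero>\<^bsub>?Z\<^esub> u) (carrier ?H)"
  have f: "(?H, ?f, orth_sum R ?Z ?H) \<in> arr (Eq_deg R)"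
    by (rule Eq_arr_restrict[OF hyperbolic_plane_obj orth_sum_obj[OF zero_space_obj hyperbolic_plane_obj]
          orth_sum_linear(2)[OF Z.module_axioms H.module_axioms]])
      (auto simp: inj_on_def)
  have "is_iso (Eq_deg R) (?H, ?f, orth_sum R ?Z ?H)"
    by (rule Eq_is_isoI[OF f]) (auto simp: carrier_orth_sum)
  moreover have "(?H, ?f, orth_sum R ?Z ?H) \<in> homs (Eq_deg R) ?H (orth_sum R ?Z ?H)"
    using f by (simp add: homs_iff)
  ultimately have "isomorphic (Eq_deg R) ?H (orth_sum R ?Z ?H)"
    unfolding isomorphic_def by (rule bexI)
  then show ?thesis unfolding hyperbolic_space_def by (intro exI[of _ "Suc 0"]) simp
qed

text \<open>Nondegeneracy of \<open>E\<close> kills the second component, and then the form vanishes on the first one.\<close>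

lemma rad_orth_sum:
  assumes D: "D \<in> obj (Eq_deg R)" and E: "E \<in> obj (Eq_deg R)" "nondeg E"
  shows "rad (orth_sum R D E) = (\<lambda>v. Couple v \<zero>\<^bsub>E\<^esub>) ` rad D"
proof -
  interpret D: qspace R D by (rule Eq_qspace[OF D])
  interpret E: qspace R E by (rule Eq_qspace[OF E(1)])
  interpret S: qspace R "orth_sum R D E" by (rule Eq_qspace[OF orth_sum_obj[OF D E(1)]])
  note p = polar_orth_sum[OF D E(1)]
  have "u \<in> (\<lambda>v. Couple v \<zero>\<^bsub>E\<^esub>) ` rad D" if "u \<in> rad (orth_sum R D E)" for u
  proof -
    have u: "u \<in> carrier (orth_sum R D E)" "qform (orth_sum R D E) u = \<zero>"
      "\<And>z. z \<in> carrier (orth_sum R D E) \<Longrightarrow> polar R (orth_sum R D E) u z = \<zero>"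
      using that S.rad_iff by auto
    obtain v w where vw: "u = Couple v w" "v \<in> carrier D" "w \<in> carrier E" using u(1) by (rule orth_sum_cases)
    have "polar R E w w' = \<zero>" if "w' \<in> carrier E" for w'
      using u(3)[of "Couple \<zero>\<^bsub>D\<^esub> w'"] p vw that by simp
    then have w: "w = \<zero>\<^bsub>E\<^esub>" using E(2) vw by (auto simp: nondeg_def)
    have "polar R D v v' = \<zero>" if "v' \<in> carrier D" for v'
      using u(3)[of "Couple v' \<zero>\<^bsub>E\<^esub>"] p vw that by simp
    moreover have "qform D v = \<zero>" using u(2) vw w by simp
    ultimately show ?thesis using D.rad_iff vw w by blast
  qed
  moreover have "Couple v \<zero>\<^bsub>E\<^esub> \<in> rad (orth_sum R D E)" if "v \<in> rad D" for v
    using that unfolding D.rad_iff S.rad_iff by (auto simp: carrier_orth_sum p)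
  ultimately show ?thesis by blast
qed

lemma perp_inclusion_arr:
  assumes D: "D \<in> obj (Eq_deg R)" and H: "H \<in> obj (Eq_deg R)"
  shows "perp_inclusion R D H \<in> homs (Eq_deg R) D (orth_sum R D H)"
proof -
  interpret D: qspace R D by (rule Eq_qspace[OF D])
  interpret H: qspace R H by (rule Eq_qspace[OF H])
  have "(D, \<lambda>v\<in>carrier D. Couple v \<zero>\<^bsub>H\<^esub>, orth_sum R D H) \<in> arr (Eq_deg R)"
    by (rule Eq_arr_restrict[OF D orth_sum_obj[OF D H] orth_sum_linear(1)[OF D.module_axioms H.module_axioms]])
      (auto simp: inj_on_def)
  then show ?thesis by (simp add: perp_inclusion_def homs_iff)
qed

lemma perp_H_iff: "s \<in> perp_H R \<longleftrightarrow> (\<exists>D H. s = perp_inclusion R D H \<and> D \<in> obj (Eq_deg R) \<and> hyperbolic_space R H)"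
  by (auto simp: perp_H_def)

lemma fractions_base_Eq: "fractions_base (Eq_deg R) (perp_H R)"
proof (intro fractions_base.intro fractions_base_axioms.intro category_Eq)
  show "s \<in> arr (Eq_deg R)" if "s \<in> perp_H R" for s
    using that perp_inclusion_arr hyperbolic_space(1) by (auto simp: perp_H_iff homs_iff)
  show "D \<in> obj (Eq_deg R)" if "idn (Eq_deg R) D \<in> arr (Eq_deg R)" for D
    using that by (auto simp: Eq_arr)
qed

theorem Psi_inverts: "inverts (Eq_deg R) (perp_H R) (Sp (E_inj R)) (Psi_tilde R)"
  unfolding inverts_def
proof
  fix s assume "s \<in> perp_H R"
  then obtain D H where s: "s = perp_inclusion R D H" and D: "D \<in> obj (Eq_deg R)" and H: "hyperbolic_space R H"
    by (auto simp: perp_H_iff)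
  let ?i = "\<lambda>v\<in>carrier D. Couple v \<zero>\<^bsub>H\<^esub>" and ?S = "orth_sum R D H"
  have a: "(D, ?i, ?S) \<in> arr (Eq_deg R)"
    using perp_inclusion_arr[OF D hyperbolic_space(1)[OF H]] by (simp add: perp_inclusion_def homs_iff)
  have r: "rad ?S = (\<lambda>v. Couple v \<zero>\<^bsub>H\<^esub>) ` rad D" by (rule rad_orth_sum[OF D hyperbolic_space[OF H]])
  have sub: "rad D \<subseteq> carrier D" by (auto simp: rad_def)
  have U: "{v \<in> carrier D. ?i v \<in> rad ?S} = carrier (Rad D)" unfolding r using sub by auto
  have "is_iso (Sp (E_inj R)) (pmor R (Rad D) (carrier (Rad D)) ?i (Rad ?S))"
    by (rule pmor_is_iso) (use pmap_Psi[OF a] U r sub in \<open>auto simp: image_iff\<close>)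
  then show "is_iso (Sp (E_inj R)) (on_arr (Psi_tilde R) s)"
    unfolding s perp_inclusion_def Psi_arr U .
qed

end

section \<open>Splitting off anisotropic lines\<close>

lemma (in abelian_group) add_diff_cancel:
  assumes "a \<in> carrier G" "b \<in> carrier G"
  shows "a \<oplus> (b \<ominus> a) = b"
  using r_neg2[of a b] a_comm[of b "\<ominus> a"] assms by (simp add: minus_eq)

context field
begin

text \<open>Coordinates with respect to a decomposition \<open>E = f D \<oplus> k e\<close>; they are linear because they are unique.\<close>

lemma line_coordinates:
  assumes D: "module R D" and E: "module R E" and f: "is_linear R D E f" "inj_on f (carrier D)"
    and e: "e \<in> carrier E" "e \<notin> f ` carrier D"
    and gen: "\<And>y. y \<in> carrier E \<Longrightarrow> \<exists>x\<in>carrier D. \<exists>k\<in>carrier R. y = f x \<oplus>\<^bsub>E\<^esub> k \<odot>\<^bsub>E\<^esub> e"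
  obtains p c where "is_linear R E D p" "is_linear_form R E c"
    "\<And>y. y \<in> carrier E \<Longrightarrow> y = f (p y) \<oplus>\<^bsub>E\<^esub> c y \<odot>\<^bsub>E\<^esub> e"
    "\<And>x k. x \<in> carrier D \<Longrightarrow> k \<in> carrier R \<Longrightarrow> p (f x \<oplus>\<^bsub>E\<^esub> k \<odot>\<^bsub>E\<^esub> e) = x"
    "\<And>x k. x \<in> carrier D \<Longrightarrow> k \<in> carrier R \<Longrightarrow> c (f x \<oplus>\<^bsub>E\<^esub> k \<odot>\<^bsub>E\<^esub> e) = k"
proof -
  interpret f: linear_map R D E f using D E f by (simp add: linear_map_def linear_map_axioms_def)
  have uniq: "k = k' \<and> x = x'"
    if h: "x \<in> carrier D" "k \<in> carrier R" "x' \<in> carrier D" "k' \<in> carrier R"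
      "f x \<oplus>\<^bsub>E\<^esub> k \<odot>\<^bsub>E\<^esub> e = f x' \<oplus>\<^bsub>E\<^esub> k' \<odot>\<^bsub>E\<^esub> e" for x k x' k'
  proof -
    have ke: "k \<odot>\<^bsub>E\<^esub> e \<in> carrier E" "k' \<odot>\<^bsub>E\<^esub> e \<in> carrier E" using h e by auto
    have "k = k'"
    proof (rule ccontr)
      assume "k \<noteq> k'"
      define d where "d = k \<ominus> k'"
      have d: "d \<in> carrier R" "k = k' \<oplus> d" using h by (auto simp: d_def add_diff_cancel)
      have "d \<noteq> \<zero>" using \<open>k \<noteq> k'\<close> d h by auto
      then have i: "inv d \<in> carrier R" "inv d \<otimes> d = \<one>" using d field_Units by auto
      have "f x' \<oplus>\<^bsub>E\<^esub> k' \<odot>\<^bsub>E\<^esub> e = (f x \<oplus>\<^bsub>E\<^esub> d \<odot>\<^bsub>E\<^esub> e) \<oplus>\<^bsub>E\<^esub> k' \<odot>\<^bsub>E\<^esub> e"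
        using h(5) d h(1-4) e ke f.W.smult_l_distr[of k' d e] by (simp add: f.W.M.a_ac)
      then have "f x' = f x \<oplus>\<^bsub>E\<^esub> d \<odot>\<^bsub>E\<^esub> e" using h e d ke by simp
      then have "f x' \<ominus>\<^bsub>E\<^esub> f x = d \<odot>\<^bsub>E\<^esub> e" using h e d by (simp add: f.W.M.add_minus_cancel)
      then have "f (inv d \<odot>\<^bsub>D\<^esub> (x' \<ominus>\<^bsub>D\<^esub> x)) = inv d \<odot>\<^bsub>E\<^esub> (d \<odot>\<^bsub>E\<^esub> e)"
        using h i by (simp add: f.map_smult f.map_minus)
      also have "\<dots> = e" using i d e by (simp add: f.W.smult_assoc1[symmetric])
      finally have "e = f (inv d \<odot>\<^bsub>D\<^esub> (x' \<ominus>\<^bsub>D\<^esub> x))" ..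
      moreover have "inv d \<odot>\<^bsub>D\<^esub> (x' \<ominus>\<^bsub>D\<^esub> x) \<in> carrier D" using h i by simp
      ultimately show False using e(2) by blast
    qed
    moreover have "f x = f x'" using h ke \<open>k = k'\<close> by simp
    ultimately show ?thesis using f(2) h by (auto dest: inj_onD)
  qed
  define P where "P y = (SOME xk. fst xk \<in> carrier D \<and> snd xk \<in> carrier R \<and>
    y = f (fst xk) \<oplus>\<^bsub>E\<^esub> snd xk \<odot>\<^bsub>E\<^esub> e)" for y
  define p where "p y = fst (P y)" for y
  define c where "c y = snd (P y)" for y
  have pc: "p y \<in> carrier D" "c y \<in> carrier R" "y = f (p y) \<oplus>\<^bsub>E\<^esub> c y \<odot>\<^bsub>E\<^esub> e" if y: "y \<in> carrier E" for y
  proof -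
    obtain x k where "x \<in> carrier D" "k \<in> carrier R" "y = f x \<oplus>\<^bsub>E\<^esub> k \<odot>\<^bsub>E\<^esub> e" using gen[OF y] by blast
    then have "\<exists>xk. fst xk \<in> carrier D \<and> snd xk \<in> carrier R \<and> y = f (fst xk) \<oplus>\<^bsub>E\<^esub> snd xk \<odot>\<^bsub>E\<^esub> e"
      by (intro exI[of _ "(x, k)"]) simp
    from someI_ex[OF this] show "p y \<in> carrier D" "c y \<in> carrier R" "y = f (p y) \<oplus>\<^bsub>E\<^esub> c y \<odot>\<^bsub>E\<^esub> e"
      unfolding p_def c_def P_def by blast+
  qed
  have eq: "p y = x \<and> c y = k" if "x \<in> carrier D" "k \<in> carrier R" "y = f x \<oplus>\<^bsub>E\<^esub> k \<odot>\<^bsub>E\<^esub> e" for x k y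
  proof -
    have "y \<in> carrier E" using that e by simp
    from uniq[OF pc(1,2)[OF this] that(1,2)] pc(3)[OF this] that(3) show ?thesis by metis
  qed
  have add: "p (y \<oplus>\<^bsub>E\<^esub> z) = p y \<oplus>\<^bsub>D\<^esub> p z \<and> c (y \<oplus>\<^bsub>E\<^esub> z) = c y \<oplus> c z"
    if h: "y \<in> carrier E" "z \<in> carrier E" for y z
  proof (rule eq)
    note py = pc[OF h(1)] and pz = pc[OF h(2)]
    have "y \<oplus>\<^bsub>E\<^esub> z = (f (p y) \<oplus>\<^bsub>E\<^esub> c y \<odot>\<^bsub>E\<^esub> e) \<oplus>\<^bsub>E\<^esub> (f (p z) \<oplus>\<^bsub>E\<^esub> c z \<odot>\<^bsub>E\<^esub> e)"
      using py(3) pz(3) by simp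
    also have "\<dots> = f (p y \<oplus>\<^bsub>D\<^esub> p z) \<oplus>\<^bsub>E\<^esub> (c y \<oplus> c z) \<odot>\<^bsub>E\<^esub> e"
      using py(1,2) pz(1,2) e by (simp add: f.map_add f.W.smult_l_distr f.W.M.a_ac)
    finally show "y \<oplus>\<^bsub>E\<^esub> z = f (p y \<oplus>\<^bsub>D\<^esub> p z) \<oplus>\<^bsub>E\<^esub> (c y \<oplus> c z) \<odot>\<^bsub>E\<^esub> e" .
  qed (use pc h in auto)
  have smult: "p (r \<odot>\<^bsub>E\<^esub> y) = r \<odot>\<^bsub>D\<^esub> p y \<and> c (r \<odot>\<^bsub>E\<^esub> y) = r \<otimes> c y"
    if h: "r \<in> carrier R" "y \<in> carrier E" for r y
  proof (rule eq)
    note py = pc[OF h(2)]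
    have "r \<odot>\<^bsub>E\<^esub> y = r \<odot>\<^bsub>E\<^esub> (f (p y) \<oplus>\<^bsub>E\<^esub> c y \<odot>\<^bsub>E\<^esub> e)" using py(3) by simp
    also have "\<dots> = f (r \<odot>\<^bsub>D\<^esub> p y) \<oplus>\<^bsub>E\<^esub> (r \<otimes> c y) \<odot>\<^bsub>E\<^esub> e"
      using py(1,2) h e by (simp add: f.map_smult f.W.smult_r_distr f.W.smult_assoc1)
    finally show "r \<odot>\<^bsub>E\<^esub> y = f (r \<odot>\<^bsub>D\<^esub> p y) \<oplus>\<^bsub>E\<^esub> (r \<otimes> c y) \<odot>\<^bsub>E\<^esub> e" .
  qed (use pc h in auto)
  show ?thesis
  proof (rule that)
    show "is_linear R E D p" using pc add smult by (auto simp: is_linear_def)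
    show "is_linear_form R E c" using pc add smult by (auto simp: is_linear_form_def)
  qed (use pc(3) eq in blast)+
qed

definition adds_line :: "('a, 'x) quad_space \<Rightarrow> (('a, 'x) elt \<Rightarrow> ('a, 'x) elt) \<Rightarrow> ('a, 'x) quad_space \<Rightarrow>
    ('a, 'x) elt \<Rightarrow> bool" where
  "adds_line D f E e \<longleftrightarrow> (D, f, E) \<in> arr (Eq_deg R) \<and> e \<in> carrier E \<and> qform E e \<noteq> \<zero> \<and>
     (\<forall>x\<in>carrier D. polar R E (f x) e = \<zero>) \<and>
     (\<forall>y\<in>carrier E. \<exists>x\<in>carrier D. \<exists>k\<in>carrier R. y = f x \<oplus>\<^bsub>E\<^esub> k \<odot>\<^bsub>E\<^esub> e)"

end

text \<open>The dummy parameter fixes the type of the atoms, so that \<open>EQ\<close> is one category.\<close>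

locale odd_char = field R for R :: "('k, 'r) ring_scheme" (structure) +
  fixes X :: "'x itself"
  assumes two: "\<one> \<oplus> \<one> \<noteq> \<zero>"
begin

abbreviation EQ :: "(('k, 'x) quad_space,
     ('k, 'x) quad_space \<times> (('k, 'x) elt \<Rightarrow> ('k, 'x) elt) \<times> ('k, 'x) quad_space) cat" where
  "EQ \<equiv> Eq_deg R"

sublocale F: fractions_base EQ "perp_H R"
  by (rule fractions_base_Eq)

lemma double_nonzero: "a \<in> carrier R \<Longrightarrow> a \<noteq> \<zero> \<Longrightarrow> a \<oplus> a \<noteq> \<zero>"
proof
  assume a: "a \<in> carrier R" "a \<noteq> \<zero>" "a \<oplus> a = \<zero>"
  then have "(\<one> \<oplus> \<one>) \<otimes> a = \<zero>" by (simp add: l_distr)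
  then show False using a two integral by (metis a_closed one_closed)
qed

lemma line_coordinates_orthogonal:
  assumes "adds_line D f E (e :: ('k, 'x) elt)"
  obtains p c where "is_linear R E D p" "is_linear_form R E c"
    "\<And>y. y \<in> carrier E \<Longrightarrow> y = f (p y) \<oplus>\<^bsub>E\<^esub> c y \<odot>\<^bsub>E\<^esub> e"
    "\<And>x k. x \<in> carrier D \<Longrightarrow> k \<in> carrier R \<Longrightarrow> p (f x \<oplus>\<^bsub>E\<^esub> k \<odot>\<^bsub>E\<^esub> e) = x"
    "\<And>x k. x \<in> carrier D \<Longrightarrow> k \<in> carrier R \<Longrightarrow> c (f x \<oplus>\<^bsub>E\<^esub> k \<odot>\<^bsub>E\<^esub> e) = k"
proof -
  have a: "(D, f, E) \<in> arr EQ" and e: "e \<in> carrier E" "qform E e \<noteq> \<zero>"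
    and orth: "\<And>x. x \<in> carrier D \<Longrightarrow> polar R E (f x) e = \<zero>"
    and gen: "\<And>y. y \<in> carrier E \<Longrightarrow> \<exists>x\<in>carrier D. \<exists>k\<in>carrier R. y = f x \<oplus>\<^bsub>E\<^esub> k \<odot>\<^bsub>E\<^esub> e"
    using assms by (auto simp: adds_line_def)
  interpret f: Eq_map R D E f by (rule Eq_mapI[OF a])
  have "e \<notin> f ` carrier D"
    using orth f.E.polar_self[OF e(1)] double_nonzero[OF f.E.q_closed[OF e(1)] e(2)] by auto
  show ?thesis
  proof (rule line_coordinates[OF f.V.module_axioms f.W.module_axioms f.linear f.map_inj e(1) \<open>e \<notin> _\<close>])
    show "\<exists>x\<in>carrier D. \<exists>k\<in>carrier R. y = f x \<oplus>\<^bsub>E\<^esub> k \<odot>\<^bsub>E\<^esub> e" if "y \<in> carrier E" for y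
      using gen[OF that] .
  qed (rule that)
qed

text \<open>The line \<open>\<langle>a\<rangle>\<close> embeds into the hyperbolic plane by \<open>c \<mapsto> (c, c a)\<close>, with orthogonal complement
  spanned by \<open>(1, -a)\<close>: this is \<open>\<langle>a\<rangle> \<perp> \<langle>-a\<rangle> \<cong> H\<close>, which needs the scalar 2 to be invertible.\<close>

lemma adds_line_step:
  assumes "adds_line D f E (e :: ('k, 'x) elt)"
  shows "\<exists>g e'. adds_line E g (orth_sum R D (hyperbolic_plane R)) e' \<and>
    (\<forall>x\<in>carrier D. g (f x) = Couple x \<zero>\<^bsub>hyperbolic_plane R\<^esub>)"
proof -
  let ?H = "hyperbolic_plane R :: ('k, 'x) quad_space"
  let ?S = "orth_sum R D ?H"
  have a: "(D, f, E) \<in> arr EQ" and e: "e \<in> carrier E" "qform E e \<noteq> \<zero>"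
    and orth: "\<And>x. x \<in> carrier D \<Longrightarrow> polar R E (f x) e = \<zero>"
    using assms by (auto simp: adds_line_def)
  interpret f: Eq_map R D E f by (rule Eq_mapI[OF a])
  have Dobj: "D \<in> obj EQ" and Eobj: "E \<in> obj EQ" using a by (auto simp: Eq_arr)
  have Sobj: "?S \<in> obj EQ" by (rule orth_sum_obj[OF Dobj hyperbolic_plane_obj])
  obtain p c where p: "is_linear R E D p" and c: "is_linear_form R E c"
    and pc: "\<And>y. y \<in> carrier E \<Longrightarrow> y = f (p y) \<oplus>\<^bsub>E\<^esub> c y \<odot>\<^bsub>E\<^esub> e"
    and p_eq: "\<And>x k. x \<in> carrier D \<Longrightarrow> k \<in> carrier R \<Longrightarrow> p (f x \<oplus>\<^bsub>E\<^esub> k \<odot>\<^bsub>E\<^esub> e) = x"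
    and c_eq: "\<And>x k. x \<in> carrier D \<Longrightarrow> k \<in> carrier R \<Longrightarrow> c (f x \<oplus>\<^bsub>E\<^esub> k \<odot>\<^bsub>E\<^esub> e) = k"
    using line_coordinates_orthogonal[OF assms] by blast
  define \<alpha> where "\<alpha> = qform E e"
  have \<alpha>: "\<alpha> \<in> carrier R" "\<alpha> \<noteq> \<zero>" using e by (auto simp: \<alpha>_def)
  have pcl: "p y \<in> carrier D" and ccl: "c y \<in> carrier R" if "y \<in> carrier E" for y
    using p c that by (auto simp: is_linear_def is_linear_form_def)
  have pl: "p (y \<oplus>\<^bsub>E\<^esub> z) = p y \<oplus>\<^bsub>D\<^esub> p z" "c (y \<oplus>\<^bsub>E\<^esub> z) = c y \<oplus> c z"
    if "y \<in> carrier E" "z \<in> carrier E" for y z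
    using p c that by (auto simp: is_linear_def is_linear_form_def)
  have ps: "p (r \<odot>\<^bsub>E\<^esub> y) = r \<odot>\<^bsub>D\<^esub> p y" "c (r \<odot>\<^bsub>E\<^esub> y) = r \<otimes> c y"
    if "r \<in> carrier R" "y \<in> carrier E" for r y
    using p c that by (auto simp: is_linear_def is_linear_form_def)
  have fx: "p (f x) = x \<and> c (f x) = \<zero>" if "x \<in> carrier D" for x
    using p_eq[OF that zero_closed] c_eq[OF that zero_closed] that e by simp
  define g where "g y = Couple (p y) (Couple (Scalar (c y)) (Scalar (c y \<otimes> \<alpha>)))" for y
  have gcl: "g y \<in> carrier ?S" if "y \<in> carrier E" for y using that pcl ccl \<alpha> by (simp add: g_def)
  have glin: "is_linear R E ?S g" unfolding is_linear_def
    using gcl pl ps ccl \<alpha> by (auto simp: g_def l_distr m_assoc)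
  have ginj: "inj_on g (carrier E)"
  proof (rule inj_onI)
    fix y z assume "y \<in> carrier E" "z \<in> carrier E" "g y = g z"
    then show "y = z" using pc[of y] pc[of z] by (simp add: g_def)
  qed
  have gq: "qform ?S (g y) = qform E y" if y: "y \<in> carrier E" for y
  proof -
    have 1: "f (p y) \<in> carrier E" "c y \<odot>\<^bsub>E\<^esub> e \<in> carrier E" using pcl ccl y e by auto
    have "polar R E (f (p y)) (c y \<odot>\<^bsub>E\<^esub> e) = \<zero>"
      using f.E.polar_smult_right[OF ccl[OF y] e(1) 1(1)] orth[OF pcl[OF y]] ccl[OF y] by simp
    then have "qform E (f (p y) \<oplus>\<^bsub>E\<^esub> c y \<odot>\<^bsub>E\<^esub> e) = qform D (p y) \<oplus> c y \<otimes> c y \<otimes> \<alpha>"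
      using f.E.q_add[OF 1] f.E.q_smult[OF ccl[OF y] e(1)] f.map_q[OF pcl[OF y]] 1 pcl[OF y] ccl[OF y] \<alpha>
      by (simp add: \<alpha>_def)
    then show ?thesis using pc[OF y] ccl[OF y] \<alpha> by (simp add: g_def m_assoc)
  qed
  define g' where "g' = restrict g (carrier E)"
  have ga: "(E, g', ?S) \<in> arr EQ"
    unfolding g'_def by (rule Eq_arr_restrict[OF Eobj Sobj glin ginj gq])
  define e' :: "('k, 'x) elt" where "e' = Couple \<zero>\<^bsub>D\<^esub> (Couple (Scalar \<one>) (Scalar (\<ominus> \<alpha>)))"
  have e': "e' \<in> carrier ?S" "qform ?S e' \<noteq> \<zero>" using \<alpha> by (simp_all add: e'_def)
  have orth': "polar R ?S (g' y) e' = \<zero>" if y: "y \<in> carrier E" for y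
  proof -
    have "polar R ?S (g y) e' = \<zero> \<oplus> (c y \<otimes> (\<ominus> \<alpha>) \<oplus> \<one> \<otimes> (c y \<otimes> \<alpha>))"
      unfolding g_def e'_def using pcl[OF y] ccl[OF y] \<alpha>
      by (subst polar_orth_sum[OF Dobj hyperbolic_plane_obj]) (simp_all add: polar_hyperbolic_plane)
    also have "\<dots> = \<zero>" using ccl[OF y] \<alpha> by (simp add: r_minus l_neg)
    finally show ?thesis using y by (simp add: g'_def)
  qed
  have gen': "\<exists>y\<in>carrier E. \<exists>k\<in>carrier R. z = g' y \<oplus>\<^bsub>?S\<^esub> k \<odot>\<^bsub>?S\<^esub> e'" if zS: "z \<in> carrier ?S" for z
  proof -
    obtain v x y where z: "z = Couple v (Couple (Scalar x) (Scalar y))"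
      and vxy: "v \<in> carrier D" "x \<in> carrier R" "y \<in> carrier R"
      using zS by (auto simp: carrier_orth_sum carrier_hyperbolic_plane)
    \<comment> \<open>\<open>(x, y) = k (1, \<alpha>) + d (1, -\<alpha>)\<close> has the solution \<open>k = (x + y / \<alpha>) / 2\<close>, \<open>d = x - k\<close>\<close>
    define h where "h = inv (\<one> \<oplus> \<one>)"
    have h: "h \<in> carrier R" "h \<oplus> h = \<one>"
    proof -
      have u: "\<one> \<oplus> \<one> \<in> Units R" using two field_Units by simp
      then show hc: "h \<in> carrier R" by (simp add: h_def)
      have "h \<oplus> h = (\<one> \<oplus> \<one>) \<otimes> h" using hc by (simp add: l_distr)
      then show "h \<oplus> h = \<one>" using u by (simp add: h_def)
    qed
    have i: "inv \<alpha> \<in> carrier R" "inv \<alpha> \<otimes> \<alpha> = \<one>" using \<alpha> field_Units by auto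
    define k where "k = h \<otimes> (x \<oplus> y \<otimes> inv \<alpha>)"
    have k: "k \<in> carrier R" using h i vxy by (simp add: k_def)
    have kk: "k \<oplus> k = x \<oplus> y \<otimes> inv \<alpha>"
      unfolding k_def using h i vxy by (simp add: l_distr[symmetric])
    define w where "w = f v \<oplus>\<^bsub>E\<^esub> k \<odot>\<^bsub>E\<^esub> e"
    have w: "w \<in> carrier E" "p w = v" "c w = k" using vxy k e p_eq c_eq by (simp_all add: w_def)
    have d: "x \<ominus> k \<in> carrier R" using vxy k by simp
    have 1: "k \<oplus> (x \<ominus> k) = x" using vxy k by (simp add: add_diff_cancel)
    have "k \<otimes> \<alpha> \<oplus> (x \<ominus> k) \<otimes> (\<ominus> \<alpha>) = (k \<oplus> k) \<otimes> \<alpha> \<oplus> (\<ominus> (x \<otimes> \<alpha>))"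
      using vxy k \<alpha> by (simp add: minus_eq l_distr r_minus l_minus minus_add a_ac)
    also have "\<dots> = y"
      unfolding kk using vxy i \<alpha> by (simp add: l_distr m_assoc a_ac r_neg r_neg2 r_neg1)
    finally have 2: "k \<otimes> \<alpha> \<oplus> (x \<ominus> k) \<otimes> (\<ominus> \<alpha>) = y" .
    have "z = g' w \<oplus>\<^bsub>?S\<^esub> (x \<ominus> k) \<odot>\<^bsub>?S\<^esub> e'"
      using w vxy d 1 2 \<alpha> k by (simp add: z g'_def g_def e'_def)
    then show ?thesis using w(1) d by blast
  qed
  have "adds_line E g' ?S e'" unfolding adds_line_def using ga e' orth' gen' by blast
  moreover have "g' (f x) = Couple x \<zero>\<^bsub>?H\<^esub>" if "x \<in> carrier D" for x
    using fx[OF that] that \<alpha> by (simp add: g'_def g_def)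
  ultimately show ?thesis by blast
qed

text \<open>The arrow \<open>g\<close> of the previous lemma again adds a line, so the lemma applies twice: both composites
  of \<open>D \<rightarrow> E \<rightarrow> D \<perp> H \<rightarrow> E \<perp> H\<close> are inclusions that are inverted.\<close>

lemma adds_line_iso:
  assumes "adds_line D f E (e :: ('k, 'x) elt)"
  shows "is_iso F.Fr (F.loc (D, f, E))"
proof -
  let ?H = "hyperbolic_plane R :: ('k, 'x) quad_space"
  let ?S = "orth_sum R D ?H" and ?T = "orth_sum R E ?H"
  obtain g e' where g: "adds_line E g ?S e'" "\<And>x. x \<in> carrier D \<Longrightarrow> g (f x) = Couple x \<zero>\<^bsub>?H\<^esub>"
    using adds_line_step[OF assms] by blast
  obtain h e'' where h: "adds_line ?S h ?T e''" "\<And>y. y \<in> carrier E \<Longrightarrow> h (g y) = Couple y \<zero>\<^bsub>?H\<^esub>"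
    using adds_line_step[OF g(1)] by blast
  have a: "(D, f, E) \<in> arr EQ" "(E, g, ?S) \<in> arr EQ" "(?S, h, ?T) \<in> arr EQ"
    using assms g h by (auto simp: adds_line_def)
  then have DE: "D \<in> obj EQ" "E \<in> obj EQ" by (auto simp: Eq_arr)
  have hom: "(D, f, E) \<in> homs EQ D E" "(E, g, ?S) \<in> homs EQ E ?S" "(?S, h, ?T) \<in> homs EQ ?S ?T"
    using a by (simp_all add: homs_iff)
  have S: "perp_inclusion R A ?H \<in> perp_H R" if "A \<in> obj EQ" for A
    using that hyperbolic_space_plane by (auto simp: perp_H_iff)
  note si = F.loc_S_is_iso[OF S perp_inclusion_arr[OF _ hyperbolic_plane_obj]]
  have "cmp EQ (E, g, ?S) (D, f, E) = perp_inclusion R D ?H"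
    using g(2) a by (auto simp: perp_inclusion_def compose_def Eq_arr)
  then have 1: "is_iso F.Fr (cmp F.Fr (F.loc (E, g, ?S)) (F.loc (D, f, E)))"
    using si[OF DE(1) DE(1)] F.loc_cmp[OF hom(1,2)] by simp
  have "cmp EQ (?S, h, ?T) (E, g, ?S) = perp_inclusion R E ?H"
    using h(2) a by (auto simp: perp_inclusion_def compose_def Eq_arr)
  then have 2: "is_iso F.Fr (cmp F.Fr (F.loc (?S, h, ?T)) (F.loc (E, g, ?S)))"
    using si[OF DE(2) DE(2)] F.loc_cmp[OF hom(2,3)] by simp
  show ?thesis
    using F.Fr.two_of_six[OF F.loc_homs[OF hom(1)] F.loc_homs[OF hom(2)] F.loc_homs[OF hom(3)] 1 2] .
qed

end

section \<open>Inverting the inclusion of the radical\<close>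

definition isotropic_space :: "('k, 'r) ring_scheme \<Rightarrow> ('k, 'x) vec_space \<Rightarrow> ('k, 'x) quad_space" where
  "isotropic_space K V = \<lparr>carrier = carrier V, mult = mult V, one = one V, zero = zero V, add = add V,
     smult = smult V, qform = (\<lambda>_. \<zero>\<^bsub>K\<^esub>)\<rparr>"

lemma isotropic_space_simps [simp]:
  "carrier (isotropic_space K V) = carrier V" "zero (isotropic_space K V) = zero V" "add (isotropic_space K V) = add V"
  "smult (isotropic_space K V) = smult V" "qform (isotropic_space K V) v = \<zero>\<^bsub>K\<^esub>"
  by (simp_all add: isotropic_space_def)

lemma rad_isotropic_space [simp]: "rad (isotropic_space K V) = carrier V"
  by (simp add: rad_def)

lemma Rad_isotropic_space [simp]: "Rad (isotropic_space K V) = V"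
  unfolding Rad_def rad_isotropic_space by (simp add: subspace_on_def module.truncate_def isotropic_space_def)

context field
begin

lemma isotropic_space_obj:
  assumes V: "V \<in> obj (E_inj R)"
  shows "isotropic_space R V \<in> obj (Eq_deg R)"
proof -
  interpret V: vec R V by (rule E_inj_vec[OF V])
  have m: "module R (isotropic_space R V)" by (rule module_cong[OF V.module_axioms]) simp_all
  interpret Z: vec R "isotropic_space R V" by (intro vec.intro field_axioms m)
  have "finite_dim R V" using V by (simp add: E_inj_obj)
  then have "finite_dim R (isotropic_space R V)"
    unfolding V.finite_dim_iff Z.finite_dim_iff by (simp add: lin_cong[of "isotropic_space R V" V])
  moreover have "is_quadratic_form R (isotropic_space R V) (qform (isotropic_space R V))"
    by (rule Z.is_quadratic_form_0) simp
  ultimately show ?thesis using m by (simp add: Eq_obj)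
qed

definition rad_incl where
  "rad_incl D = (isotropic_space R (Rad D), \<lambda>v\<in>rad D. v, D)"

lemma rad_incl_arr:
  assumes D: "D \<in> obj (Eq_deg R)"
  shows "(isotropic_space R (Rad D), \<lambda>v\<in>rad D. v, D) \<in> arr (Eq_deg R)"
proof -
  interpret D: qspace R D by (rule Eq_qspace[OF D])
  have sub: "rad D \<subseteq> carrier D" by (auto simp: rad_def)
  have "is_linear R (isotropic_space R (Rad D)) D (\<lambda>v. v)" using sub by (auto simp: is_linear_def)
  from Eq_arr_restrict[OF isotropic_space_obj[OF Rad_obj[OF D]] D this]
  show ?thesis using D.rad_iff by (simp add: inj_on_def)
qed

lemma rad_incl_homs: "D \<in> obj (Eq_deg R) \<Longrightarrow> rad_incl D \<in> homs (Eq_deg R) (isotropic_space R (Rad D)) D"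
  using rad_incl_arr by (simp add: rad_incl_def homs_iff)

end

context odd_char
begin

text \<open>Induction on the number of generators: as long as the form is nonzero, an anisotropic line
  can be split off without changing the radical.\<close>

lemma rad_incl_iso:
  assumes "(D :: ('k, 'x) quad_space) \<in> obj EQ"
  shows "is_iso F.Fr (F.loc (rad_incl D))"
proof -
  have "is_iso F.Fr (F.loc (rad_incl D))"
    if "D \<in> obj EQ" "set xs \<subseteq> carrier D" "lin R D xs = carrier D"
    for D :: "('k, 'x) quad_space" and xs
    using that
  proof (induction "length xs" arbitrary: D xs rule: less_induct)
    case less
    note D = less.prems(1)
    interpret D: qspace R D by (rule Eq_qspace[OF D])
    show ?case
    proof (cases "\<forall>v\<in>carrier D. qform D v = \<zero>")
      case True
      then have "rad D = carrier D" by (auto simp: rad_def)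
      then have "is_iso EQ (rad_incl D)" unfolding rad_incl_def
        by (intro Eq_is_isoI[OF rad_incl_arr[OF D]]) simp
      then show ?thesis using F.loc.is_iso_on_arr(1) rad_incl_homs[OF D] by blast
    next
      case False
      then obtain e where e: "e \<in> carrier D" "qform D e \<noteq> \<zero>" by blast
      then have e0: "e \<noteq> \<zero>\<^bsub>D\<^esub>" by auto
      define \<beta> where "\<beta> = polar R D e e"
      have \<beta>: "\<beta> \<in> carrier R" "\<beta> \<noteq> \<zero>"
        using e double_nonzero[OF D.q_closed[OF e(1)] e(2)] by (simp_all add: \<beta>_def D.polar_self)
      have i: "inv \<beta> \<in> carrier R" "inv \<beta> \<otimes> \<beta> = \<one>" using \<beta> field_Units by auto
      define U where "U = {v \<in> carrier D. polar R D v e = \<zero>}"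
      have U: "submodule U R D"
        by (rule D.submoduleI') (use e in \<open>auto simp: U_def D.polar_add_left D.polar_smult_left\<close>)
      have Usub: "U \<subseteq> carrier D" by (auto simp: U_def)
      define D1 where "D1 = D\<lparr>carrier := U\<rparr>"
      have D1s: "carrier D1 = U" "zero D1 = zero D" "add D1 = add D" "smult D1 = smult D" "qform D1 = qform D"
        by (simp_all add: D1_def)
      have m1: "module R D1" unfolding D1_def by (rule submodule.submodule_is_module[OF U D.module_axioms])
      have "is_quadratic_form R D1 (qform D1)"
        by (rule is_quadratic_form_pullback[OF m1 _ D.quadratic, of "\<lambda>v. v"])
          (use Usub in \<open>auto simp: D1s is_linear_def\<close>)
      then have D1: "D1 \<in> obj EQ"
        using m1 D.finite_dim_submodule[OF U] D by (simp add: Eq_obj D1_def)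
      interpret D1: qspace R D1 by (rule Eq_qspace[OF D1])
      have pol1: "polar R D1 v w = polar R D v w" for v w by (simp add: polar_def D1s)
      have incl: "is_linear R D1 D (\<lambda>v. v)" using Usub by (auto simp: D1s is_linear_def)
      have \<kappa>: "(D1, \<lambda>v\<in>U. v, D) \<in> arr EQ"
        using Eq_arr_restrict[OF D1 D incl] by (simp add: D1s inj_on_def)
      have split: "\<exists>x\<in>U. \<exists>k\<in>carrier R. y = x \<oplus>\<^bsub>D\<^esub> k \<odot>\<^bsub>D\<^esub> e" if y: "y \<in> carrier D" for y
      proof (intro bexI)
        let ?k = "polar R D y e \<otimes> inv \<beta>"
        show k: "?k \<in> carrier R" using y e i by simp
        let ?x = "y \<oplus>\<^bsub>D\<^esub> (\<ominus> ?k) \<odot>\<^bsub>D\<^esub> e"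
        have "polar R D ?x e = polar R D y e \<oplus> (\<ominus> ?k) \<otimes> \<beta>"
          using y e k by (simp add: D.polar_add_left D.polar_smult_left \<beta>_def)
        also have "(\<ominus> ?k) \<otimes> \<beta> = \<ominus> (polar R D y e)" using y e i \<beta> by (simp add: l_minus m_assoc)
        finally show "?x \<in> U" using y e k by (simp add: U_def r_neg)
        show "y = ?x \<oplus>\<^bsub>D\<^esub> ?k \<odot>\<^bsub>D\<^esub> e"
          using y e k by (simp add: D.smult_l_minus D.M.a_assoc D.M.l_neg)
      qed
      have line: "adds_line D1 (\<lambda>v\<in>U. v) D e"
        unfolding adds_line_def using \<kappa> e split by (auto simp: D1s U_def)
      have rad1: "rad D1 = rad D"
      proof (intro equalityI subsetI)
        fix v assume v: "v \<in> rad D1"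
        then have vU: "v \<in> U" "qform D v = \<zero>" "\<And>w. w \<in> U \<Longrightarrow> polar R D v w = \<zero>"
          unfolding D1.rad_iff pol1 D1s by auto
        have "polar R D v w = \<zero>" if w: "w \<in> carrier D" for w
        proof -
          obtain x k where xk: "x \<in> U" "k \<in> carrier R" "w = x \<oplus>\<^bsub>D\<^esub> k \<odot>\<^bsub>D\<^esub> e" using split[OF w] by blast
          moreover have "x \<in> carrier D" "v \<in> carrier D" "polar R D v e = \<zero>"
            using xk(1) vU(1) by (auto simp: U_def)
          ultimately show ?thesis using vU(3)[OF xk(1)] e
            by (simp add: D.polar_add_right D.polar_smult_right)
        qed
        then show "v \<in> rad D" using vU Usub by (auto simp: D.rad_iff)
      next
        fix v assume "v \<in> rad D"
        then show "v \<in> rad D1" using e unfolding D1.rad_iff D.rad_iff pol1 D1s by (auto simp: U_def)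
      qed
      have Rad1: "Rad D1 = Rad D"
        unfolding Rad_def rad1 by (simp add: D1_def subspace_on_def module.truncate_def)
      obtain p c where p: "is_linear R D D1 p"
        and p_eq: "\<And>x k. x \<in> carrier D1 \<Longrightarrow> k \<in> carrier R \<Longrightarrow> p ((\<lambda>v\<in>U. v) x \<oplus>\<^bsub>D\<^esub> k \<odot>\<^bsub>D\<^esub> e) = x"
        by (rule line_coordinates_orthogonal[OF line]) (rule that)
      interpret p: linear_map R D D1 p
        using p m1 D.module_axioms by (simp add: linear_map_def linear_map_axioms_def)
      have pU: "p x = x" if "x \<in> U" for x using p_eq[of x \<zero>] that Usub e by (auto simp: D1s)
      have pe: "p e = \<zero>\<^bsub>D\<^esub>"
        using p_eq[of "\<zero>\<^bsub>D\<^esub>" \<one>] D.submodule_zero[OF U] e by (simp add: D1s)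
      obtain ys where ys: "set ys \<subseteq> carrier D" "Suc (length ys) = length xs" "lin R D xs \<subseteq> lin R D (e # ys)"
        using D.lin_exchange[OF less.prems(2) _ e0] e less.prems(3) by blast
      define zs where "zs = map p ys"
      have zs: "set zs \<subseteq> carrier D1" using ys(1) by (auto simp: zs_def)
      have "U \<subseteq> lin R D1 zs"
      proof
        fix x assume x: "x \<in> U"
        then have "x \<in> lin R D (e # ys)" using ys(3) less.prems(3) Usub by blast
        then have "p x \<in> p ` lin R D (e # ys)" by blast
        then have "x \<in> lin R D1 (map p (e # ys))" using p.image_lin[of "e # ys"] e ys(1) pU[OF x] by simp
        moreover have "lin R D1 (map p (e # ys)) \<subseteq> lin R D1 zs"
          by (rule D1.lin_subset[OF D1.lin_submodule[OF zs]])
            (use pe D1.lin_incl[OF zs] D1.submodule_zero[OF D1.lin_submodule[OF zs]] in \<open>auto simp: zs_def D1s\<close>)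
        ultimately show "x \<in> lin R D1 zs" by blast
      qed
      then have "lin R D1 zs = carrier D1" using D1.submoduleE(1)[OF D1.lin_submodule[OF zs]] by (auto simp: D1s)
      then have IH: "is_iso F.Fr (F.loc (rad_incl D1))"
        using less.hyps[of zs D1] ys(2) D1 zs by (simp add: zs_def)
      have \<kappa>h: "(D1, \<lambda>v\<in>U. v, D) \<in> homs EQ D1 D" using \<kappa> by (simp add: homs_iff)
      have radU: "rad D \<subseteq> U" using rad1 D1s by (auto simp: rad_def)
      have "cmp EQ (D1, \<lambda>v\<in>U. v, D) (rad_incl D1) = rad_incl D"
        using radU by (auto simp: rad_incl_def Rad1 rad1 compose_def subset_iff)
      then have "F.loc (rad_incl D) = cmp F.Fr (F.loc (D1, \<lambda>v\<in>U. v, D)) (F.loc (rad_incl D1))"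
        using F.loc_cmp[OF rad_incl_homs[OF D1] \<kappa>h] by simp
      then show ?thesis
        using F.Fr.is_iso_cmp[OF IH F.loc_homs[OF rad_incl_homs[OF D1]] adds_line_iso[OF line] F.loc_homs[OF \<kappa>h]]
        by simp
    qed
  qed
  moreover interpret D: qspace R D by (rule Eq_qspace[OF assms])
  obtain xs where "set xs \<subseteq> carrier D" "lin R D xs = carrier D"
    using assms D.finite_dim_iff by (auto simp: Eq_obj)
  ultimately show ?thesis using assms by blast
qed

end

section \<open>Morphisms of fractions out of totally isotropic spaces\<close>

text \<open>Linear dependence of functionals, one functional \<open>b(y, -)\<close> at a time: if it does not vanish on the
  common kernel of the others, subtracting a multiple of \<open>y\<close> from \<open>e\<close> reduces to these.\<close>

lemma (in qspace) polar_dependent: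
  assumes "set us \<subseteq> carrier D" "e \<in> carrier D"
    and "\<And>x. x \<in> carrier D \<Longrightarrow> \<forall>u\<in>set us. polar R D u x = \<zero> \<Longrightarrow> polar R D e x = \<zero>"
  shows "\<exists>u\<in>lin R D us. \<forall>x\<in>carrier D. polar R D e x = polar R D u x"
  using assms
proof (induction us arbitrary: e)
  case Nil
  then show ?case by simp
next
  case (Cons y us)
  have y: "y \<in> carrier D" and us: "set us \<subseteq> carrier D" using Cons.prems by auto
  have linD: "u \<in> carrier D" if "u \<in> lin R D us" for u
    using submoduleE(1)[OF lin_submodule[OF us]] that by blast
  show ?case
  proof (cases "\<forall>x\<in>carrier D. (\<forall>u\<in>set us. polar R D u x = \<zero>) \<longrightarrow> polar R D y x = \<zero>")
    case True
    then obtain u where "u \<in> lin R D us" "\<forall>x\<in>carrier D. polar R D e x = polar R D u x"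
      using Cons.IH[OF us Cons.prems(2)] Cons.prems(3) by auto
    then show ?thesis using lin_Cons_mono[OF Cons.prems(1)] by blast
  next
    case False
    then obtain x0 where x0: "x0 \<in> carrier D" "\<forall>u\<in>set us. polar R D u x0 = \<zero>" "polar R D y x0 \<noteq> \<zero>"
      by blast
    define t where "t = inv (polar R D y x0)"
    have t: "t \<in> carrier R" "t \<otimes> polar R D y x0 = \<one>" using x0 y field_Units by (auto simp: t_def)
    define x1 where "x1 = t \<odot>\<^bsub>D\<^esub> x0"
    have x1: "x1 \<in> carrier D" "polar R D y x1 = \<one>" "\<And>u. u \<in> set us \<Longrightarrow> polar R D u x1 = \<zero>"
      using x0 t y us by (auto simp: x1_def polar_smult_right subset_iff)
    define k where "k = polar R D e x1"
    have k: "k \<in> carrier R" using Cons.prems(2) x1 by (simp add: k_def)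
    define e' where "e' = e \<oplus>\<^bsub>D\<^esub> (\<ominus> k) \<odot>\<^bsub>D\<^esub> y"
    have e': "e' \<in> carrier D" using Cons.prems(2) y k by (simp add: e'_def)
    have pe': "polar R D e x = k \<otimes> polar R D y x \<oplus> polar R D e' x" if x: "x \<in> carrier D" for x
    proof -
      have "polar R D e' x = polar R D e x \<ominus> k \<otimes> polar R D y x"
        using x Cons.prems(2) y k by (simp add: e'_def polar_add_left polar_smult_left R.l_minus R.minus_eq)
      then show ?thesis using x Cons.prems(2) y k by (simp add: R.add_diff_cancel)
    qed
    have "polar R D e' x = \<zero>" if x: "x \<in> carrier D" "\<forall>u\<in>set us. polar R D u x = \<zero>" for x
    proof -
      define c where "c = polar R D y x"
      have c: "c \<in> carrier R" using x y by (simp add: c_def)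
      define x' where "x' = x \<oplus>\<^bsub>D\<^esub> (\<ominus> c) \<odot>\<^bsub>D\<^esub> x1"
      have x': "x' \<in> carrier D" using x x1 c by (simp add: x'_def)
      have px': "polar R D v x' = polar R D v x \<oplus> (\<ominus> c) \<otimes> polar R D v x1" if "v \<in> carrier D" for v
        using that x x1 c by (simp add: x'_def polar_add_right polar_smult_right)
      have "polar R D y x' = \<zero>" using px'[OF y] x1 c by (simp add: c_def[symmetric] R.r_neg)
      moreover have "\<forall>u\<in>set us. polar R D u x' = \<zero>" using px' x x1 us c by (simp add: subset_iff)
      ultimately have "polar R D e x' = \<zero>" using Cons.prems(3)[OF x'] by simp
      moreover have "polar R D e x' = polar R D e x \<ominus> c \<otimes> k"
        using px'[OF Cons.prems(2)] c k by (simp add: k_def R.l_minus R.minus_eq)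
      ultimately have "c \<otimes> k \<oplus> \<zero> = polar R D e x"
        using R.add_diff_cancel[of "c \<otimes> k" "polar R D e x"] c k x Cons.prems(2) by simp
      moreover have "polar R D e x = k \<otimes> c \<oplus> polar R D e' x" using pe'[OF x(1)] by (simp add: c_def)
      ultimately have "k \<otimes> c \<oplus> polar R D e' x = k \<otimes> c" using c k by (simp add: R.m_comm)
      then show ?thesis using c k e' x by simp
    qed
    then obtain u where u: "u \<in> lin R D us" "\<forall>x\<in>carrier D. polar R D e' x = polar R D u x"
      using Cons.IH[OF us e'] by blast
    have "k \<odot>\<^bsub>D\<^esub> y \<oplus>\<^bsub>D\<^esub> u \<in> lin R D (y # us)" using k u(1) by auto
    moreover have "polar R D e x = polar R D (k \<odot>\<^bsub>D\<^esub> y \<oplus>\<^bsub>D\<^esub> u) x" if "x \<in> carrier D" for x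
      using pe'[OF that] u(2) that k y linD[OF u(1)] by (simp add: polar_add_left polar_smult_left)
    ultimately show ?thesis by blast
  qed
qed

context field
begin

lemma orth_sum_map:
  assumes a: "(D, f, E) \<in> arr (Eq_deg R)" and H: "H \<in> obj (Eq_deg R)"
  shows "(orth_sum R D H, \<lambda>u\<in>carrier (orth_sum R D H). Couple (f (pfst u)) (psnd u), orth_sum R E H)
      \<in> arr (Eq_deg R)"
    and "cmp (Eq_deg R) (orth_sum R D H, \<lambda>u\<in>carrier (orth_sum R D H). Couple (f (pfst u)) (psnd u), orth_sum R E H)
        (perp_inclusion R D H) =
      cmp (Eq_deg R) (perp_inclusion R E H) (D, f, E)"
proof -
  let ?F = "\<lambda>u\<in>carrier (orth_sum R D H). Couple (f (pfst u)) (psnd u)"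
  interpret f: Eq_map R D E f by (rule Eq_mapI[OF a])
  interpret H: qspace R H by (rule Eq_qspace[OF H])
  have DE: "D \<in> obj (Eq_deg R)" "E \<in> obj (Eq_deg R)" using a by (auto simp: Eq_arr)
  show "(orth_sum R D H, ?F, orth_sum R E H) \<in> arr (Eq_deg R)"
    by (rule Eq_arr_restrict[OF orth_sum_obj[OF DE(1) H] orth_sum_obj[OF DE(2) H]])
      (use f.map_inj in \<open>auto simp: is_linear_def carrier_orth_sum f.map_add f.map_smult f.map_q
         intro!: inj_onI dest: inj_onD\<close>)
  show "cmp (Eq_deg R) (orth_sum R D H, ?F, orth_sum R E H) (perp_inclusion R D H) =
      cmp (Eq_deg R) (perp_inclusion R E H) (D, f, E)"
    by (auto simp: perp_inclusion_def compose_def)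
qed

lemma isotropic_space_subspace_arr:
  assumes a: "(isotropic_space R V, f, X) \<in> arr (Eq_deg R)" and V: "V \<in> obj (E_inj R)" and U: "submodule U R V"
  shows "(isotropic_space R (V\<lparr>carrier := U\<rparr>), restrict f U, X) \<in> arr (Eq_deg R)"
proof -
  interpret f: Eq_map R "isotropic_space R V" X f by (rule Eq_mapI[OF a])
  interpret V: vec R V by (rule E_inj_vec[OF V])
  have sub: "u \<in> carrier V" if "u \<in> U" for u using V.submoduleE(1)[OF U] that by blast
  have X: "X \<in> obj (Eq_deg R)" using a by (simp add: Eq_arr)
  have "is_linear R (isotropic_space R (V\<lparr>carrier := U\<rparr>)) X f"
    using f.linear sub by (auto simp: is_linear_def)
  moreover have "inj_on f U" using f.map_inj sub by (auto simp: inj_on_def)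
  ultimately show ?thesis
    using Eq_arr_restrict[OF isotropic_space_obj[OF E_inj_subspace[OF V U]] X, of f] f.map_q sub by simp
qed

text \<open>Extending a totally isotropic embedding \<open>f\<close> from \<open>U + k e\<close> to \<open>U \<perp> H\<close>: a vector
  dual to \<open>f e\<close> and orthogonal to \<open>f U\<close> is corrected by a multiple of \<open>f e\<close> to become isotropic.\<close>

lemma extend_to_hyperbolic:
  assumes a: "(isotropic_space R V, f, X) \<in> arr (Eq_deg R)" and V: "V \<in> obj (E_inj R)" and U: "submodule U R V"
    and e: "e \<in> carrier V" "e \<notin> U" and ker: "{v \<in> carrier V. f v \<in> rad X} \<subseteq> U"
  shows "\<exists>g. (orth_sum R (isotropic_space R (V\<lparr>carrier := U\<rparr>)) (hyperbolic_plane R), g, X) \<in> arr (Eq_deg R) \<and>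
    (\<forall>u\<in>U. \<forall>k\<in>carrier R. g (Couple u (Couple (Scalar k) (Scalar \<zero>))) = f (u \<oplus>\<^bsub>V\<^esub> k \<odot>\<^bsub>V\<^esub> e))"
proof -
  let ?W = "V\<lparr>carrier := U\<rparr>" and ?H = "hyperbolic_plane R :: ('a, 'c) quad_space"
  let ?S = "orth_sum R (isotropic_space R ?W) ?H"
  interpret f: Eq_map R "isotropic_space R V" X f by (rule Eq_mapI[OF a])
  interpret V: vec R V by (rule E_inj_vec[OF V])
  note W = E_inj_subspace[OF V U]
  interpret W: vec R ?W by (rule E_inj_vec[OF W])
  have sub: "u \<in> carrier V" if "u \<in> U" for u using V.submoduleE(1)[OF U] that by blast
  have fV: "f v \<in> carrier X" if "v \<in> carrier V" for v using f.map_closed that by simp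
  have fadd: "f (v \<oplus>\<^bsub>V\<^esub> w) = f v \<oplus>\<^bsub>X\<^esub> f w" if "v \<in> carrier V" "w \<in> carrier V" for v w
    using f.map_add that by simp
  have fsm: "f (k \<odot>\<^bsub>V\<^esub> v) = k \<odot>\<^bsub>X\<^esub> f v" if "k \<in> carrier R" "v \<in> carrier V" for k v
    using f.map_smult that by simp
  have fq: "qform X (f v) = \<zero>" if "v \<in> carrier V" for v using f.map_q that by simp
  have fp: "polar R X (f v) (f w) = \<zero>" if "v \<in> carrier V" "w \<in> carrier V" for v w
    using f.map_polar[of v w] that by (simp add: polar_def minus_eq)
  have X: "X \<in> obj (Eq_deg R)" using a by (simp add: Eq_arr)
  obtain xs where xs: "set xs \<subseteq> U" "lin R V xs = U"
    using W W.finite_dim_iff by (auto simp: E_inj_obj)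
  have "\<exists>x\<in>carrier X. (\<forall>u\<in>set (map f xs). polar R X u x = \<zero>) \<and> polar R X (f e) x \<noteq> \<zero>"
  proof (rule ccontr)
    assume neg: "\<not> ?thesis"
    have "set (map f xs) \<subseteq> carrier X" using xs sub fV by auto
    from f.E.polar_dependent[OF this fV[OF e(1)]] neg
    obtain u where u: "u \<in> lin R X (map f xs)" "\<And>x. x \<in> carrier X \<Longrightarrow> polar R X (f e) x = polar R X u x" by auto
    have "f ` lin R (isotropic_space R V) xs = lin R X (map f xs)"
      by (rule f.image_lin) (use xs sub in auto)
    moreover have "lin R (isotropic_space R V) xs = U" using lin_cong[of "isotropic_space R V" V R xs] xs(2) by simp
    ultimately obtain u0 where u0: "u0 \<in> U" "u = f u0" using u(1) by auto
    \<comment> \<open>\<open>e - u0\<close> is mapped into the radical, hence lies in \<open>U\<close>, and so does \<open>e\<close>\<close>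
    let ?d = "e \<oplus>\<^bsub>V\<^esub> (\<ominus> \<one>) \<odot>\<^bsub>V\<^esub> u0"
    have d: "?d \<in> carrier V" using e u0 sub by simp
    have "polar R X (f ?d) x = \<zero>" if x: "x \<in> carrier X" for x
    proof -
      have "polar R X (f ?d) x = polar R X (f e) x \<oplus> (\<ominus> \<one>) \<otimes> polar R X (f u0) x"
        using e(1) u0(1) sub x fV by (simp add: fadd fsm f.E.polar_add_left f.E.polar_smult_left)
      also have "\<dots> = \<zero>" using u(2)[OF x] u0 x fV sub by (simp add: l_minus r_neg)
      finally show ?thesis .
    qed
    then have "f ?d \<in> rad X" using f.E.rad_iff fV[OF d] fq[OF d] by blast
    then have "?d \<in> U" using ker d by blast
    then have "?d \<oplus>\<^bsub>V\<^esub> u0 \<in> U" using V.submoduleE(5)[OF U] u0 by blast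
    moreover have "?d \<oplus>\<^bsub>V\<^esub> u0 = e"
      using e u0 sub by (simp add: V.smult_l_minus V.M.a_assoc V.M.l_neg)
    ultimately show False using e(2) by simp
  qed
  then obtain x0 where x0: "x0 \<in> carrier X" "\<forall>u\<in>set xs. polar R X (f u) x0 = \<zero>" "polar R X (f e) x0 \<noteq> \<zero>"
    by auto
  define t where "t = inv (polar R X (f e) x0)"
  have t: "t \<in> carrier R" "t \<otimes> polar R X (f e) x0 = \<one>" using x0 e fV field_Units by (auto simp: t_def)
  define x1 where "x1 = t \<odot>\<^bsub>X\<^esub> x0"
  have x1: "x1 \<in> carrier X" "polar R X (f e) x1 = \<one>"
    using x0 t e fV by (simp_all add: x1_def f.E.polar_smult_right)
  have "submodule {v \<in> carrier V. polar R X (f v) x1 = \<zero>} R V"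
    by (rule V.submoduleI')
      (use x1 fV f.map_zero in \<open>auto simp: fadd fsm f.E.polar_add_left f.E.polar_smult_left\<close>)
  then have "lin R V xs \<subseteq> {v \<in> carrier V. polar R X (f v) x1 = \<zero>}"
    by (rule V.lin_subset) (use xs sub x0 t fV in \<open>auto simp: x1_def f.E.polar_smult_right\<close>)
  then have x1U: "polar R X (f u) x1 = \<zero>" if "u \<in> U" for u using that xs(2) by blast
  define r where "r = qform X x1"
  have r: "r \<in> carrier R" using x1 by (simp add: r_def)
  \<comment> \<open>as \<open>f e\<close> is isotropic with \<open>b(f e, x1) = 1\<close>, this gives \<open>q d = q x1 - q x1 = 0\<close>\<close>
  define d where "d = x1 \<oplus>\<^bsub>X\<^esub> (\<ominus> r) \<odot>\<^bsub>X\<^esub> f e"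
  have d: "d \<in> carrier X" using x1 r e fV by (simp add: d_def)
  have pd: "polar R X (f v) d = polar R X (f v) x1" if "v \<in> carrier V" for v
    using that x1 r e fV fp by (simp add: d_def f.E.polar_add_right f.E.polar_smult_right)
  have qd: "qform X d = \<zero>"
  proof -
    have "polar R X x1 (f e) = \<one>" using f.E.polar_sym[OF x1(1) fV[OF e(1)]] x1(2) by simp
    then have "qform X d = (r \<oplus> (\<ominus> r) \<otimes> (\<ominus> r) \<otimes> \<zero>) \<oplus> (\<ominus> r) \<otimes> \<one>"
      unfolding d_def using x1 r e fV
      by (simp add: f.E.q_add f.E.q_smult f.E.polar_smult_right fq r_def[symmetric])
    then show ?thesis using r by (simp add: r_neg)
  qed
  define g where "g u = f (pfst u) \<oplus>\<^bsub>X\<^esub> (scalar_of (pfst (psnd u)) \<odot>\<^bsub>X\<^esub> f e \<oplus>\<^bsub>X\<^esub> scalar_of (psnd (psnd u)) \<odot>\<^bsub>X\<^esub> d)"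
    for u :: "('a, 'c) elt"
  have g: "g (Couple u (Couple (Scalar k) (Scalar l))) = f (u \<oplus>\<^bsub>V\<^esub> k \<odot>\<^bsub>V\<^esub> e) \<oplus>\<^bsub>X\<^esub> l \<odot>\<^bsub>X\<^esub> d"
    if "u \<in> U" "k \<in> carrier R" "l \<in> carrier R" for u k l
    using that sub e d fV by (simp add: g_def fadd fsm f.W.M.a_assoc)
  have S: "\<exists>u\<in>U. \<exists>k\<in>carrier R. \<exists>l\<in>carrier R. z = Couple u (Couple (Scalar k) (Scalar l))"
    if "z \<in> carrier ?S" for z using that by (auto simp: carrier_orth_sum carrier_hyperbolic_plane)
  have Sobj: "?S \<in> obj (Eq_deg R)" by (rule orth_sum_obj[OF isotropic_space_obj[OF W] hyperbolic_plane_obj])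
  interpret S: qspace R ?S by (rule Eq_qspace[OF Sobj])
  have glin: "is_linear R ?S X g"
    unfolding is_linear_def
  proof (intro conjI ballI funcsetI)
    fix z assume "z \<in> carrier ?S"
    then show "g z \<in> carrier X" using S[of z] g sub e d fV by auto
  next
    fix z z' assume "z \<in> carrier ?S" "z' \<in> carrier ?S"
    then show "g (z \<oplus>\<^bsub>?S\<^esub> z') = g z \<oplus>\<^bsub>X\<^esub> g z'"
      using sub e(1) d fV
      by (auto simp: carrier_orth_sum carrier_hyperbolic_plane g_def fadd f.W.smult_l_distr f.W.M.a_ac)
  next
    fix k z assume "k \<in> carrier R" "z \<in> carrier ?S"
    then show "g (k \<odot>\<^bsub>?S\<^esub> z) = k \<odot>\<^bsub>X\<^esub> g z"
      using sub e(1) d fV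
      by (auto simp: carrier_orth_sum carrier_hyperbolic_plane g_def fsm f.W.smult_r_distr f.W.smult_assoc1)
  qed
  interpret g: linear_map R ?S X g
    using glin S.module_axioms f.W.module_axioms by (simp add: linear_map_def linear_map_axioms_def)
  have pol: "polar R X (f (u \<oplus>\<^bsub>V\<^esub> k \<odot>\<^bsub>V\<^esub> e)) d = k" if "u \<in> U" "k \<in> carrier R" for u k
    using that sub e d fV pd x1 x1U by (simp add: fadd fsm f.E.polar_add_left f.E.polar_smult_left)
  have gq: "qform X (g z) = qform ?S z" if zS: "z \<in> carrier ?S" for z
  proof -
    obtain u k l where z: "z = Couple u (Couple (Scalar k) (Scalar l))" and h: "u \<in> U" "k \<in> carrier R" "l \<in> carrier R"
      using S[OF zS] by blast
    have v: "u \<oplus>\<^bsub>V\<^esub> k \<odot>\<^bsub>V\<^esub> e \<in> carrier V" using h sub e by simp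
    have "qform X (g z) = (\<zero> \<oplus> l \<otimes> l \<otimes> \<zero>) \<oplus> l \<otimes> k"
      unfolding z g[OF h] using fq[OF v] fV[OF v] qd d h pol[OF h(1,2)]
      by (simp add: f.E.q_add f.E.q_smult f.E.polar_smult_right)
    then show ?thesis using h by (simp add: z m_comm)
  qed
  have ginj: "inj_on g (carrier ?S)"
  proof (rule g.map_inj_onI)
    fix z assume zS: "z \<in> carrier ?S" and gz: "g z = \<zero>\<^bsub>X\<^esub>"
    obtain u k l where z: "z = Couple u (Couple (Scalar k) (Scalar l))" and h: "u \<in> U" "k \<in> carrier R" "l \<in> carrier R"
      using S[OF zS] by blast
    have v: "u \<oplus>\<^bsub>V\<^esub> k \<odot>\<^bsub>V\<^esub> e \<in> carrier V" using h sub e by simp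
    have eq: "f (u \<oplus>\<^bsub>V\<^esub> k \<odot>\<^bsub>V\<^esub> e) \<oplus>\<^bsub>X\<^esub> l \<odot>\<^bsub>X\<^esub> d = \<zero>\<^bsub>X\<^esub>" using gz g[OF h] z by simp
    have "polar R X d (f e) = \<one>" using f.E.polar_sym[OF d fV[OF e(1)]] pd[OF e(1)] x1 by simp
    then have "polar R X (f (u \<oplus>\<^bsub>V\<^esub> k \<odot>\<^bsub>V\<^esub> e) \<oplus>\<^bsub>X\<^esub> l \<odot>\<^bsub>X\<^esub> d) (f e) = l"
      using fV[OF v] fV[OF e(1)] d h fp[OF v e(1)] by (simp add: f.E.polar_add_left f.E.polar_smult_left)
    then have l: "l = \<zero>" unfolding eq using fV[OF e(1)] by simp
    then have f0: "f (u \<oplus>\<^bsub>V\<^esub> k \<odot>\<^bsub>V\<^esub> e) = \<zero>\<^bsub>X\<^esub>" using eq fV[OF v] d by simp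
    then have k: "k = \<zero>" using pol[OF h(1,2)] d by simp
    then have "f u = f \<zero>\<^bsub>V\<^esub>" using f0 h sub e f.map_zero by simp
    then have "u = \<zero>\<^bsub>V\<^esub>" using inj_onD[OF f.map_inj, of u "\<zero>\<^bsub>V\<^esub>"] h sub by simp
    then show "z = \<zero>\<^bsub>?S\<^esub>" by (simp add: z k l)
  qed
  have "(?S, restrict g (carrier ?S), X) \<in> arr (Eq_deg R)"
    by (rule Eq_arr_restrict[OF Sobj X glin ginj gq])
  moreover have "restrict g (carrier ?S) (Couple u (Couple (Scalar k) (Scalar \<zero>))) = f (u \<oplus>\<^bsub>V\<^esub> k \<odot>\<^bsub>V\<^esub> e)"
    if "u \<in> U" "k \<in> carrier R" for u k
    using that g[of u k \<zero>] sub e d fV by simp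
  ultimately show ?thesis by blast
qed

end

context odd_char
begin

text \<open>Calculus of left fractions: \<open>f\<close> and an inclusion \<open>D \<rightarrow> D \<perp> H\<close> are completed to a square by \<open>f \<perp> H\<close>.\<close>

lemma fraction_form:
  assumes "\<alpha> \<in> homs F.Fr A B"
  shows "\<exists>X f t. (A, f, X) \<in> arr EQ \<and> (B, t, X) \<in> arr EQ \<and> is_iso F.Fr (F.loc (B, t, X)) \<and>
    t ` rad B = rad X \<and> cmp F.Fr (F.loc (B, t, X)) \<alpha> = F.loc (A, f, X)"
  using assms
proof (induction rule: F.fractions_induct)
  case (idn A)
  define i where "i = (\<lambda>v\<in>carrier A. v)"
  have e: "idn EQ A = (A, i, A)" by (simp add: i_def)
  have ih: "(A, i, A) \<in> homs EQ A A" unfolding e[symmetric] by (rule F.idn_homs[OF idn])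
  have iso: "is_iso F.Fr (F.loc (A, i, A))"
    unfolding e[symmetric] F.loc_idn[OF idn] by (rule F.Fr.is_iso_idn) (simp only: F.obj_Fr idn)
  have rad: "i ` rad A = rad A" by (auto simp: i_def rad_def image_iff)
  have cmp: "cmp F.Fr (F.loc (A, i, A)) (idn F.Fr A) = F.loc (A, i, A)"
    by (rule F.Fr.cmp_idn_right[OF F.loc_homs[OF ih]])
  have a: "(A, i, A) \<in> arr EQ" using ih by (simp add: homs_iff)
  show ?case by (intro exI conjI) (rule a, rule a, rule iso, rule rad, rule cmp)
next
  case (fwd f0 \<alpha> A M B)
  then obtain X f t where IH: "(M, f, X) \<in> arr EQ" "(B, t, X) \<in> arr EQ" "is_iso F.Fr (F.loc (B, t, X))"
    "t ` rad B = rad X" "cmp F.Fr (F.loc (B, t, X)) \<alpha> = F.loc (M, f, X)" by blast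
  obtain f1 where f1: "f0 = (A, f1, M)" using fwd(1) by (auto simp: Eq_homs)
  have fh: "(M, f, X) \<in> homs EQ M X" "(B, t, X) \<in> homs EQ B X" using IH by (simp_all add: homs_iff)
  have "cmp F.Fr (F.loc (B, t, X)) (cmp F.Fr \<alpha> (F.loc f0)) = cmp F.Fr (F.loc (M, f, X)) (F.loc f0)"
    using F.Fr.cmp_assoc[OF F.loc_homs[OF fwd(1)] fwd(2) F.loc_homs[OF fh(2)]] IH(5) by simp
  also have "\<dots> = F.loc (A, compose (carrier A) f f1, X)"
    using F.loc_cmp[OF fwd(1) fh(1)] f1 by simp
  finally show ?case using IH(2-4) F.cmp_homs[OF fwd(1) fh(1)] f1 by (auto simp: homs_iff)
next
  case (bwd s \<alpha> A M B)
  then obtain X f t where IH: "(M, f, X) \<in> arr EQ" "(B, t, X) \<in> arr EQ" "is_iso F.Fr (F.loc (B, t, X))"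
    "t ` rad B = rad X" "cmp F.Fr (F.loc (B, t, X)) \<alpha> = F.loc (M, f, X)" by blast
  obtain H where s: "s = perp_inclusion R M H" "A = orth_sum R M H" and H: "hyperbolic_space R H"
    using bwd(1,2) by (auto simp: perp_H_iff perp_inclusion_def homs_iff)
  have X: "X \<in> obj EQ" using IH by (simp add: Eq_arr)
  note Hobj = hyperbolic_space(1)[OF H]
  let ?s' = "perp_inclusion R X H" and ?X' = "orth_sum R X H"
  have s'S: "?s' \<in> perp_H R" using X H by (auto simp: perp_H_iff)
  note s'h = perp_inclusion_arr[OF X Hobj]
  let ?f' = "(A, \<lambda>u\<in>carrier A. Couple (f (pfst u)) (psnd u), ?X')"
  have f': "?f' \<in> arr EQ" "cmp EQ ?f' s = cmp EQ ?s' (M, f, X)"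
    using orth_sum_map[OF IH(1) Hobj] by (simp_all add: s)
  let ?t' = "compose (carrier B) (\<lambda>v\<in>carrier X. Couple v \<zero>\<^bsub>H\<^esub>) t"
  have hom: "(M, f, X) \<in> homs EQ M X" "(B, t, X) \<in> homs EQ B X" "?f' \<in> homs EQ A ?X'"
    using IH f' by (simp_all add: homs_iff)
  have t': "(B, ?t', ?X') = cmp EQ ?s' (B, t, X)" by (simp add: perp_inclusion_def)
  have t'h: "(B, ?t', ?X') \<in> homs EQ B ?X'" unfolding t' by (rule F.cmp_homs[OF hom(2) s'h])
  note l = F.loc_homs[OF hom(1)] F.loc_homs[OF hom(2)] F.loc_homs[OF hom(3)] F.loc_homs[OF s'h]
    F.loc_homs[OF bwd(2)]
  have lt': "F.loc (B, ?t', ?X') = cmp F.Fr (F.loc ?s') (F.loc (B, t, X))"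
    unfolding t' by (rule F.loc_cmp[OF hom(2) s'h])
  have iso: "is_iso F.Fr (F.loc (B, ?t', ?X'))"
    unfolding lt' by (rule F.Fr.is_iso_cmp[OF IH(3) l(2) F.loc_S_is_iso[OF s'S s'h] l(4)])
  have "?t' ` rad B = (\<lambda>v. Couple v \<zero>\<^bsub>H\<^esub>) ` (t ` rad B)"
    using IH(2) by (auto simp: compose_def rad_def Eq_arr image_iff Pi_iff PiE_iff)
  then have rad: "?t' ` rad B = rad ?X'"
    unfolding IH(4) rad_orth_sum[OF X hyperbolic_space[OF H]] .
  note siso = F.loc_S_is_iso[OF bwd(1,2)]
  note si = F.Fr.inv_arr(1)[OF siso l(5)]
  have "cmp F.Fr (F.loc (B, ?t', ?X')) (cmp F.Fr \<alpha> (inv_arr F.Fr (F.loc s)))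
      = cmp F.Fr (F.loc ?s') (cmp F.Fr (F.loc (M, f, X)) (inv_arr F.Fr (F.loc s)))"
    unfolding lt' using F.Fr.cmp_assoc[OF F.Fr.cmp_homs[OF si bwd(3)] l(2) l(4)]
      F.Fr.cmp_assoc[OF si bwd(3) l(2)] IH(5) by simp
  also have "\<dots> = cmp F.Fr (cmp F.Fr (F.loc ?s') (F.loc (M, f, X))) (inv_arr F.Fr (F.loc s))"
    by (rule F.Fr.cmp_assoc[OF si l(1) l(4)])
  also have "cmp F.Fr (F.loc ?s') (F.loc (M, f, X)) = cmp F.Fr (F.loc ?f') (F.loc s)"
    using F.loc_cmp[OF hom(1) s'h] F.loc_cmp[OF bwd(2) hom(3)] f'(2) by simp
  also have "cmp F.Fr (cmp F.Fr (F.loc ?f') (F.loc s)) (inv_arr F.Fr (F.loc s)) = F.loc ?f'"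
    by (rule F.Fr.inv_arr_cancel(3)[OF siso l(5) l(3)])
  finally have fin: "cmp F.Fr (F.loc (B, ?t', ?X')) (cmp F.Fr \<alpha> (inv_arr F.Fr (F.loc s))) = F.loc ?f'" .
  have t'a: "(B, ?t', ?X') \<in> arr EQ" using t'h by (simp only: homs_iff)
  show ?case by (intro exI conjI) (rule f'(1), rule t'a, rule iso, rule rad, rule fin)
qed

end

locale induced = odd_char R X for R :: "('k, 'r) ring_scheme" (structure) and X :: "'x itself" +
  fixes \<Psi>
  assumes \<Psi>_functor: "is_functor (fractions (Eq_deg R) (perp_H R)) (Sp (E_inj R))
      (\<Psi> :: (('k, 'x) quad_space, _, ('k, 'x) vec_space, _) fctr)"
    and \<Psi>_induced: "functor_eq EQ (functor_comp \<Psi> (to_fractions EQ (perp_H R))) (Psi_tilde R)"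
begin

sublocale \<Psi>: is_functor F.Fr "Sp (E_inj R)" \<Psi>
  by (rule \<Psi>_functor)

abbreviation "Z \<equiv> isotropic_space R"

lemma \<Psi>_obj: "D \<in> obj EQ \<Longrightarrow> on_obj \<Psi> D = Rad D"
  using \<Psi>_induced by (simp add: functor_eq_def functor_comp_def to_fractions_def Psi_obj)

lemma \<Psi>_loc: "(D, f, E) \<in> arr EQ \<Longrightarrow>
    on_arr \<Psi> (F.loc (D, f, E)) = pmor R (Rad D) {v \<in> carrier D. f v \<in> rad E} f (Rad E)"
  using \<Psi>_induced by (simp add: functor_eq_def functor_comp_def Psi_arr)

lemma \<Psi>_homs: "\<alpha> \<in> homs F.Fr D E \<Longrightarrow> on_arr \<Psi> \<alpha> \<in> homs (Sp (E_inj R)) (Rad D) (Rad E)"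
  using \<Psi>.on_arr_homs[of \<alpha> D E] F.Fr.homs_obj[of \<alpha> D E] \<Psi>_obj by simp

text \<open>The morphism is \<open>V \<rightarrow> U \<perp> H \<leftarrow> U\<close>, where \<open>\<sigma>\<close> maps \<open>u + c e\<close> to \<open>(u, (c, 0))\<close>. An extension \<open>g\<close> of \<open>f\<close> along \<open>\<sigma>\<close>
  restricts to \<open>f\<close> on \<open>U\<close>, so both sides of the last equation are \<open>g \<sigma>\<close>.\<close>

lemma retraction_along_line:
  assumes V: "V \<in> obj (E_inj R)" and U: "submodule U R V" and e: "e \<in> carrier V" "e \<notin> U"
    and gen: "\<And>y. y \<in> carrier V \<Longrightarrow> \<exists>x\<in>U. \<exists>k\<in>carrier R. y = x \<oplus>\<^bsub>V\<^esub> k \<odot>\<^bsub>V\<^esub> e"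
  shows "\<exists>\<rho>\<in>homs F.Fr (Z V) (Z (V\<lparr>carrier := U\<rparr>)).
    on_arr \<Psi> \<rho> = pmor R V U (\<lambda>u. u) (V\<lparr>carrier := U\<rparr>) \<and>
    (\<forall>X f. (Z V, f, X) \<in> arr EQ \<longrightarrow> {v \<in> carrier V. f v \<in> rad X} \<subseteq> U \<longrightarrow>
       F.loc (Z V, f, X) = cmp F.Fr (F.loc (Z (V\<lparr>carrier := U\<rparr>), restrict f U, X)) \<rho>)"
proof -
  let ?W = "V\<lparr>carrier := U\<rparr>" and ?H = "hyperbolic_plane R :: ('k, 'x) quad_space"
  let ?S = "orth_sum R (Z ?W) ?H"
  interpret V: vec R V by (rule E_inj_vec[OF V])
  note W = E_inj_subspace[OF V U]
  interpret W: vec R ?W by (rule E_inj_vec[OF W])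
  have sub: "u \<in> carrier V" if "u \<in> U" for u using V.submoduleE(1)[OF U] that by blast
  have ZV: "Z V \<in> obj EQ" and ZW: "Z ?W \<in> obj EQ" using isotropic_space_obj V W by auto
  have Sobj: "?S \<in> obj EQ" by (rule orth_sum_obj[OF ZW hyperbolic_plane_obj])
  have incl: "is_linear R ?W V (\<lambda>v. v)" "inj_on (\<lambda>v. v) (carrier ?W)"
    using sub by (auto simp: is_linear_def)
  obtain p c where p: "is_linear R V ?W p" and c: "is_linear_form R V c"
    and pc: "\<And>y. y \<in> carrier V \<Longrightarrow> y = p y \<oplus>\<^bsub>V\<^esub> c y \<odot>\<^bsub>V\<^esub> e"
    and p_eq: "\<And>x k. x \<in> carrier ?W \<Longrightarrow> k \<in> carrier R \<Longrightarrow> p (x \<oplus>\<^bsub>V\<^esub> k \<odot>\<^bsub>V\<^esub> e) = x"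
    and c_eq: "\<And>x k. x \<in> carrier ?W \<Longrightarrow> k \<in> carrier R \<Longrightarrow> c (x \<oplus>\<^bsub>V\<^esub> k \<odot>\<^bsub>V\<^esub> e) = k"
  proof (rule line_coordinates[OF W.module_axioms V.module_axioms incl e(1)])
    show "e \<notin> (\<lambda>v. v) ` carrier ?W" using e by simp
    show "\<exists>x\<in>carrier ?W. \<exists>k\<in>carrier R. y = x \<oplus>\<^bsub>V\<^esub> k \<odot>\<^bsub>V\<^esub> e" if "y \<in> carrier V" for y
      using gen[OF that] by simp
  qed (rule that)
  have pcl: "p y \<in> U" and ccl: "c y \<in> carrier R" if "y \<in> carrier V" for y
    using p c that by (auto simp: is_linear_def is_linear_form_def)
  have pU: "p u = u" "c u = \<zero>" if "u \<in> U" for u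
    using p_eq[of u \<zero>] c_eq[of u \<zero>] that sub e by simp_all
  define \<sigma> where "\<sigma> = (\<lambda>v\<in>carrier V. Couple (p v) (Couple (Scalar (c v)) (Scalar \<zero>)))"
  have \<sigma>a: "(Z V, \<sigma>, ?S) \<in> arr EQ"
  proof -
    let ?g = "\<lambda>v. Couple (p v) (Couple (Scalar (c v)) (Scalar \<zero>))"
    have "is_linear R (Z V) ?S ?g"
      using p c by (auto simp: is_linear_def is_linear_form_def)
    moreover have "inj_on ?g (carrier V)"
    proof (rule inj_onI)
      fix y z assume "y \<in> carrier V" "z \<in> carrier V" "?g y = ?g z"
      then show "y = z" using pc[of y] pc[of z] by simp
    qed
    ultimately show ?thesis
      using Eq_arr_restrict[OF ZV Sobj, of ?g] ccl by (simp add: \<sigma>_def)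
  qed
  let ?s = "perp_inclusion R (Z ?W) ?H"
  have sS: "?s \<in> perp_H R" using ZW hyperbolic_space_plane by (auto simp: perp_H_iff)
  note sh = perp_inclusion_arr[OF ZW hyperbolic_plane_obj]
  have \<sigma>h: "(Z V, \<sigma>, ?S) \<in> homs EQ (Z V) ?S" using \<sigma>a by (simp add: homs_iff)
  note ls = F.loc_homs[OF sh] and l\<sigma> = F.loc_homs[OF \<sigma>h]
  note siso = F.loc_S_is_iso[OF sS sh]
  note si = F.Fr.inv_arr(1)[OF siso ls]
  define \<rho> where "\<rho> = cmp F.Fr (inv_arr F.Fr (F.loc ?s)) (F.loc (Z V, \<sigma>, ?S))"
  have \<rho>: "\<rho> \<in> homs F.Fr (Z V) (Z ?W)" unfolding \<rho>_def by (rule F.Fr.cmp_homs[OF l\<sigma> si])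
  have s\<rho>: "cmp F.Fr (F.loc ?s) \<rho> = F.loc (Z V, \<sigma>, ?S)"
    unfolding \<rho>_def by (rule F.Fr.inv_arr_cancel(2)[OF siso ls l\<sigma>])
  have radS: "rad ?S = (\<lambda>v. Couple v \<zero>\<^bsub>?H\<^esub>) ` U"
    using rad_orth_sum[OF ZW hyperbolic_plane_obj nondeg_hyperbolic_plane] by simp
  have \<Psi>\<rho>: "on_arr \<Psi> \<rho> = pmor R V U (\<lambda>u. u) ?W"
  proof -
    obtain U0 j0 where j0: "pmap R V U0 j0 ?W" "on_arr \<Psi> \<rho> = pmor R V U0 j0 ?W"
      using \<Psi>_homs[OF \<rho>] unfolding Sp_arr Rad_isotropic_space by blast
    let ?i = "\<lambda>v\<in>U. Couple v \<zero>\<^bsub>?H\<^esub>"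
    have sa: "(Z ?W, ?i, ?S) \<in> arr EQ" using sh by (simp add: perp_inclusion_def homs_iff)
    have "{v \<in> U. ?i v \<in> rad ?S} = U" unfolding radS by auto
    then have \<Psi>s: "on_arr \<Psi> (F.loc ?s) = pmor R ?W U ?i (Rad ?S)" and ps: "pmap R ?W U ?i (Rad ?S)"
      using \<Psi>_loc[OF sa] pmap_Psi[OF sa] by (simp_all add: perp_inclusion_def)
    have "v \<in> U" if "v \<in> carrier V" "\<sigma> v \<in> rad ?S" for v
    proof -
      have "c v = \<zero>" using that radS by (auto simp: \<sigma>_def)
      then have "v = p v" using pc[OF that(1)] pcl[OF that(1)] sub e by simp
      then show ?thesis using pcl[OF that(1)] by simp
    qed
    moreover have "\<sigma> v \<in> rad ?S" if "v \<in> U" for v using that pU sub unfolding radS by (simp add: \<sigma>_def)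
    ultimately have "{v \<in> carrier V. \<sigma> v \<in> rad ?S} = U" using sub by auto
    then have \<Psi>\<sigma>: "on_arr \<Psi> (F.loc (Z V, \<sigma>, ?S)) = pmor R V U \<sigma> (Rad ?S)" and p\<sigma>: "pmap R V U \<sigma> (Rad ?S)"
      using \<Psi>_loc[OF \<sigma>a] pmap_Psi[OF \<sigma>a] by simp_all
    have "pmor R V U \<sigma> (Rad ?S) = pmor R V {u \<in> U0. j0 u \<in> U} (\<lambda>u. ?i (j0 u)) (Rad ?S)"
      using \<Psi>.on_arr_cmp[OF \<rho> ls] unfolding s\<rho> \<Psi>\<sigma> \<Psi>s j0(2) cmp_pmor[OF j0(1) ps] .
    then have eq: "U = {u \<in> U0. j0 u \<in> U}" "\<And>u. u \<in> U \<Longrightarrow> \<sigma> u = ?i (j0 u)"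
      using pspan_eqD[OF p\<sigma> pmap_comp[OF j0(1) ps]] by auto
    have "{u \<in> U0. j0 u \<in> U} = U0" using pmap_closed[OF j0(1)] by auto
    then have UU: "U = U0" using eq(1) by simp
    have "j0 u = u" if "u \<in> U" for u
    proof -
      have "\<sigma> u = Couple u \<zero>\<^bsub>?H\<^esub>" using pU[OF that] sub[OF that] by (simp add: \<sigma>_def)
      moreover have "j0 u \<in> U" using eq(1) that by blast
      ultimately show ?thesis using eq(2)[OF that] by simp
    qed
    then show ?thesis using j0(2) UU pspan_cong[of U j0 "\<lambda>u. u"] by simp
  qed
  have "F.loc (Z V, f, X) = cmp F.Fr (F.loc (Z ?W, restrict f U, X)) \<rho>"
    if a: "(Z V, f, X) \<in> arr EQ" and ker: "{v \<in> carrier V. f v \<in> rad X} \<subseteq> U" for X f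
  proof -
    obtain g where ga: "(?S, g, X) \<in> arr EQ"
      and g: "\<And>u k. u \<in> U \<Longrightarrow> k \<in> carrier R \<Longrightarrow> g (Couple u (Couple (Scalar k) (Scalar \<zero>))) = f (u \<oplus>\<^bsub>V\<^esub> k \<odot>\<^bsub>V\<^esub> e)"
      using extend_to_hyperbolic[OF a V U e ker] by blast
    have gh: "(?S, g, X) \<in> homs EQ ?S X" using ga by (simp add: homs_iff)
    have "compose (carrier V) g \<sigma> = f"
    proof
      fix v show "compose (carrier V) g \<sigma> v = f v"
      proof (cases "v \<in> carrier V")
        case True
        then show ?thesis using g[OF pcl[OF True] ccl[OF True]] pc[OF True] by (simp add: compose_eq \<sigma>_def)
      next
        case False
        then show ?thesis using a by (auto simp: compose_def Eq_arr PiE_iff extensional_def)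
      qed
    qed
    then have 1: "F.loc (Z V, f, X) = cmp F.Fr (F.loc (?S, g, X)) (F.loc (Z V, \<sigma>, ?S))"
      using F.loc_cmp[OF \<sigma>h gh] by simp
    have "compose U g (\<lambda>v\<in>U. Couple v \<zero>\<^bsub>?H\<^esub>) = restrict f U"
      using g[of _ \<zero>] sub e by (auto simp: compose_def)
    then have 2: "F.loc (Z ?W, restrict f U, X) = cmp F.Fr (F.loc (?S, g, X)) (F.loc ?s)"
      using F.loc_cmp[OF sh gh] by (simp add: perp_inclusion_def)
    show ?thesis unfolding 1 2 s\<rho>[symmetric] by (rule F.Fr.cmp_assoc[OF \<rho> ls F.loc_homs[OF gh]])
  qed
  then show ?thesis using \<rho> \<Psi>\<rho> by blast
qed

text \<open>The composite of the retractions along the lines spanned by the entries of \<open>ys\<close>; its behaviour on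
  \<open>f\<close> follows since the domain of the partial map of \<open>f\<close> stays \<open>U\<close> at every step.\<close>

lemma retraction_exists:
  assumes "V \<in> obj (E_inj R)" "submodule U R V" "set ys \<subseteq> carrier V"
    and "\<And>v. v \<in> carrier V \<Longrightarrow> \<exists>u\<in>U. \<exists>w\<in>lin R V ys. v = u \<oplus>\<^bsub>V\<^esub> w"
  shows "\<exists>\<rho>\<in>homs F.Fr (Z V) (Z (V\<lparr>carrier := U\<rparr>)).
    on_arr \<Psi> \<rho> = pmor R V U (\<lambda>u. u) (V\<lparr>carrier := U\<rparr>) \<and>
    (\<forall>X f. (Z V, f, X) \<in> arr EQ \<longrightarrow> {v \<in> carrier V. f v \<in> rad X} = U \<longrightarrow>
       F.loc (Z V, f, X) = cmp F.Fr (F.loc (Z (V\<lparr>carrier := U\<rparr>), restrict f U, X)) \<rho>)"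
  using assms
proof (induction ys arbitrary: V)
  case Nil
  interpret V: vec R V by (rule E_inj_vec[OF Nil(1)])
  have ZV: "Z V \<in> obj EQ" by (rule isotropic_space_obj[OF Nil(1)])
  have sub: "U \<subseteq> carrier V" by (rule V.submoduleE(1)[OF Nil(2)])
  have "v \<in> U" if "v \<in> carrier V" for v
    using Nil(4)[OF that] sub by auto
  then have UV: "U = carrier V" using sub by blast
  have e: "V\<lparr>carrier := U\<rparr> = V" by (simp add: UV)
  have "F.loc (Z V, f, X) = cmp F.Fr (F.loc (Z V, restrict f U, X)) (idn F.Fr (Z V))"
    if a: "(Z V, f, X) \<in> arr EQ" for X f
  proof -
    have "restrict f U = f" using a UV by (auto simp: Eq_arr PiE_iff intro: extensional_restrict)
    moreover have "(Z V, f, X) \<in> homs EQ (Z V) X" using a by (simp add: homs_iff)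
    ultimately show ?thesis using F.Fr.cmp_idn_right[OF F.loc_homs] by simp
  qed
  moreover have "on_arr \<Psi> (idn F.Fr (Z V)) = pmor R V U (\<lambda>u. u) V"
    using \<Psi>.on_arr_idn[of "Z V"] ZV \<Psi>_obj[OF ZV] by (simp add: idn_Sp UV)
  moreover have "idn F.Fr (Z V) \<in> homs F.Fr (Z V) (Z V)" using F.Fr.idn_homs[of "Z V"] ZV by simp
  ultimately show ?case unfolding e by blast
next
  case (Cons y ys)
  note V = Cons.prems(1) and U = Cons.prems(2)
  interpret V: vec R V by (rule E_inj_vec[OF V])
  have y: "y \<in> carrier V" and ys: "set ys \<subseteq> carrier V" using Cons.prems(3) by auto
  note L = V.lin_submodule[OF ys]
  note UE = V.submoduleE[OF U] V.submodule_zero[OF U] and LE = V.submoduleE[OF L] V.submodule_zero[OF L]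
  have Usub: "u \<in> carrier V" if "u \<in> U" for u using UE(1) that by blast
  have Lsub: "w \<in> carrier V" if "w \<in> lin R V ys" for w using LE(1) that by blast
  define T where "T = {u \<oplus>\<^bsub>V\<^esub> w | u w. u \<in> U \<and> w \<in> lin R V ys}"
  have TI: "u \<oplus>\<^bsub>V\<^esub> w \<in> T" if "u \<in> U" "w \<in> lin R V ys" for u w using that by (auto simp: T_def)
  have T: "submodule T R V"
  proof (rule V.submoduleI')
    show "T \<subseteq> carrier V" using Usub Lsub by (auto simp: T_def)
    show "\<zero>\<^bsub>V\<^esub> \<in> T" using TI[OF UE(7) LE(7)] by simp
  next
    fix a b assume "a \<in> T" "b \<in> T"
    then obtain u w u' w' where e: "a = u \<oplus>\<^bsub>V\<^esub> w" "b = u' \<oplus>\<^bsub>V\<^esub> w'"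
      "u \<in> U" "w \<in> lin R V ys" "u' \<in> U" "w' \<in> lin R V ys" by (auto simp: T_def)
    then have "a \<oplus>\<^bsub>V\<^esub> b = (u \<oplus>\<^bsub>V\<^esub> u') \<oplus>\<^bsub>V\<^esub> (w \<oplus>\<^bsub>V\<^esub> w')" using Usub Lsub by (simp add: V.M.a_ac)
    then show "a \<oplus>\<^bsub>V\<^esub> b \<in> T" using TI[OF UE(5) LE(5)] e by simp
  next
    fix k a assume k: "k \<in> carrier R" and "a \<in> T"
    then obtain u w where e: "a = u \<oplus>\<^bsub>V\<^esub> w" "u \<in> U" "w \<in> lin R V ys" by (auto simp: T_def)
    then have "k \<odot>\<^bsub>V\<^esub> a = k \<odot>\<^bsub>V\<^esub> u \<oplus>\<^bsub>V\<^esub> k \<odot>\<^bsub>V\<^esub> w" using k Usub Lsub by (simp add: V.smult_r_distr)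
    then show "k \<odot>\<^bsub>V\<^esub> a \<in> T" using TI[OF UE(4) LE(4)] e k by simp
  qed
  note TE = V.submoduleE[OF T] V.submodule_zero[OF T]
  have Tsub: "v \<in> carrier V" if "v \<in> T" for v using TE(1) that by blast
  have UT: "U \<subseteq> T" using TI[OF _ LE(7)] Usub by force
  have LT: "lin R V ys \<subseteq> T" using TI[OF UE(7)] Lsub by force
  have gen: "\<exists>x\<in>T. \<exists>k\<in>carrier R. v = x \<oplus>\<^bsub>V\<^esub> k \<odot>\<^bsub>V\<^esub> y" if v: "v \<in> carrier V" for v
  proof -
    obtain u k w where e: "v = u \<oplus>\<^bsub>V\<^esub> (k \<odot>\<^bsub>V\<^esub> y \<oplus>\<^bsub>V\<^esub> w)" "u \<in> U" "k \<in> carrier R" "w \<in> lin R V ys"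
      using Cons.prems(4)[OF v] by auto
    then have "v = (u \<oplus>\<^bsub>V\<^esub> w) \<oplus>\<^bsub>V\<^esub> k \<odot>\<^bsub>V\<^esub> y" using Usub Lsub y by (simp add: V.M.a_ac)
    then show ?thesis using TI[OF e(2,4)] e(3) by blast
  qed
  show ?case
  proof (cases "y \<in> T")
    case True
    have "\<exists>u\<in>U. \<exists>w\<in>lin R V ys. v = u \<oplus>\<^bsub>V\<^esub> w" if "v \<in> carrier V" for v
    proof -
      obtain x k where xk: "x \<in> T" "k \<in> carrier R" "v = x \<oplus>\<^bsub>V\<^esub> k \<odot>\<^bsub>V\<^esub> y" using gen[OF \<open>v \<in> _\<close>] by blast
      then have "v \<in> T" using True TE(4,5) by blast
      then show ?thesis by (auto simp: T_def)
    qed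
    from Cons.IH[OF V U ys this] show ?thesis .
  next
    case False
    let ?W = "V\<lparr>carrier := T\<rparr>"
    note W = E_inj_subspace[OF V T]
    have WU: "?W\<lparr>carrier := U\<rparr> = V\<lparr>carrier := U\<rparr>" by simp
    have UW: "submodule U R ?W"
      using submodule_of_submodule[OF V.module_axioms T UT, of ?W] U W by (simp add: E_inj_obj)
    have ysW: "set ys \<subseteq> carrier ?W" using V.lin_incl[OF ys] LT by auto
    have "\<exists>u\<in>U. \<exists>w\<in>lin R ?W ys. v = u \<oplus>\<^bsub>?W\<^esub> w" if "v \<in> carrier ?W" for v
      using that by (auto simp: T_def)
    from Cons.IH[OF W UW ysW this] obtain \<rho>' where \<rho>': "\<rho>' \<in> homs F.Fr (Z ?W) (Z (V\<lparr>carrier := U\<rparr>))"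
      "on_arr \<Psi> \<rho>' = pmor R ?W U (\<lambda>u. u) (V\<lparr>carrier := U\<rparr>)"
      "\<forall>X f. (Z ?W, f, X) \<in> arr EQ \<longrightarrow> {v \<in> carrier ?W. f v \<in> rad X} = U \<longrightarrow>
         F.loc (Z ?W, f, X) = cmp F.Fr (F.loc (Z (V\<lparr>carrier := U\<rparr>), restrict f U, X)) \<rho>'"
      unfolding WU by blast
    obtain \<rho>1 where \<rho>1: "\<rho>1 \<in> homs F.Fr (Z V) (Z ?W)"
      "on_arr \<Psi> \<rho>1 = pmor R V T (\<lambda>u. u) ?W"
      "\<And>X f. (Z V, f, X) \<in> arr EQ \<Longrightarrow> {v \<in> carrier V. f v \<in> rad X} \<subseteq> T \<Longrightarrow>
         F.loc (Z V, f, X) = cmp F.Fr (F.loc (Z ?W, restrict f T, X)) \<rho>1"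
      using retraction_along_line[OF V T y False gen] by blast
    have p1: "pmap R V T (\<lambda>u. u) ?W"
      using V T W by (auto simp: pmap_def is_linear_id)
    have p': "pmap R ?W U (\<lambda>u. u) (V\<lparr>carrier := U\<rparr>)"
      using UW W E_inj_subspace[OF V U] by (auto simp: pmap_def is_linear_id)
    have "{u \<in> T. u \<in> U} = U" using UT by auto
    then have "on_arr \<Psi> (cmp F.Fr \<rho>' \<rho>1) = pmor R V U (\<lambda>u. u) (V\<lparr>carrier := U\<rparr>)"
      using \<Psi>.on_arr_cmp[OF \<rho>1(1) \<rho>'(1)] cmp_pmor[OF p1 p'] by (simp add: \<rho>1(2) \<rho>'(2))
    moreover have "F.loc (Z V, f, X) = cmp F.Fr (F.loc (Z (V\<lparr>carrier := U\<rparr>), restrict f U, X)) (cmp F.Fr \<rho>' \<rho>1)"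
      if a: "(Z V, f, X) \<in> arr EQ" and ker: "{v \<in> carrier V. f v \<in> rad X} = U" for X f
    proof -
      note aT = isotropic_space_subspace_arr[OF a V T] and aU = isotropic_space_subspace_arr[OF a V U]
      have rr: "restrict (restrict f T) U = restrict f U"
        using UT by (auto simp: restrict_def fun_eq_iff)
      have "{v \<in> carrier ?W. restrict f T v \<in> rad X} = U" using ker UT Tsub by auto
      from \<rho>'(3)[rule_format, OF aT this] have 2: "F.loc (Z ?W, restrict f T, X) =
          cmp F.Fr (F.loc (Z (V\<lparr>carrier := U\<rparr>), restrict f U, X)) \<rho>'"
        unfolding rr .
      have h: "(Z (V\<lparr>carrier := U\<rparr>), restrict f U, X) \<in> homs EQ (Z (V\<lparr>carrier := U\<rparr>)) X"
        using aU by (simp add: homs_iff)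
      have "{v \<in> carrier V. f v \<in> rad X} \<subseteq> T" using ker UT by simp
      from \<rho>1(3)[OF a this] show ?thesis
        unfolding 2 F.Fr.cmp_assoc[OF \<rho>1(1) \<rho>'(1) F.loc_homs[OF h]] .
    qed
    ultimately show ?thesis using F.Fr.cmp_homs[OF \<rho>1(1) \<rho>'(1)] by blast
  qed
qed

definition retraction where
  "retraction V U = (SOME \<rho>. \<rho> \<in> homs F.Fr (Z V) (Z (V\<lparr>carrier := U\<rparr>)) \<and>
    on_arr \<Psi> \<rho> = pmor R V U (\<lambda>u. u) (V\<lparr>carrier := U\<rparr>) \<and>
    (\<forall>X f. (Z V, f, X) \<in> arr EQ \<longrightarrow> {v \<in> carrier V. f v \<in> rad X} = U \<longrightarrow>
       F.loc (Z V, f, X) = cmp F.Fr (F.loc (Z (V\<lparr>carrier := U\<rparr>), restrict f U, X)) \<rho>))"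

lemma retraction:
  assumes V: "V \<in> obj (E_inj R)" and U: "submodule U R V"
  shows "retraction V U \<in> homs F.Fr (Z V) (Z (V\<lparr>carrier := U\<rparr>))"
    and "on_arr \<Psi> (retraction V U) = pmor R V U (\<lambda>u. u) (V\<lparr>carrier := U\<rparr>)"
    and "\<And>X f. (Z V, f, X) \<in> arr EQ \<Longrightarrow> {v \<in> carrier V. f v \<in> rad X} = U \<Longrightarrow>
       F.loc (Z V, f, X) = cmp F.Fr (F.loc (Z (V\<lparr>carrier := U\<rparr>), restrict f U, X)) (retraction V U)"
proof -
  interpret V: vec R V by (rule E_inj_vec[OF V])
  obtain ys where ys: "set ys \<subseteq> carrier V" "lin R V ys = carrier V"
    using V V.finite_dim_iff by (auto simp: E_inj_obj)
  have "\<exists>u\<in>U. \<exists>w\<in>lin R V ys. v = u \<oplus>\<^bsub>V\<^esub> w" if "v \<in> carrier V" for v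
    using that ys(2) V.submodule_zero[OF U] by (intro bexI[of _ "\<zero>\<^bsub>V\<^esub>"] bexI[of _ v]) auto
  from retraction_exists[OF V U ys(1) this]
  have "\<exists>\<rho>. \<rho> \<in> homs F.Fr (Z V) (Z (V\<lparr>carrier := U\<rparr>)) \<and>
    on_arr \<Psi> \<rho> = pmor R V U (\<lambda>u. u) (V\<lparr>carrier := U\<rparr>) \<and>
    (\<forall>X f. (Z V, f, X) \<in> arr EQ \<longrightarrow> {v \<in> carrier V. f v \<in> rad X} = U \<longrightarrow>
       F.loc (Z V, f, X) = cmp F.Fr (F.loc (Z (V\<lparr>carrier := U\<rparr>), restrict f U, X)) \<rho>)" by auto
  note * = someI_ex[OF this, folded retraction_def]
  show "retraction V U \<in> homs F.Fr (Z V) (Z (V\<lparr>carrier := U\<rparr>))" by (rule conjunct1[OF *])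
  show "on_arr \<Psi> (retraction V U) = pmor R V U (\<lambda>u. u) (V\<lparr>carrier := U\<rparr>)"
    by (rule conjunct1[OF conjunct2[OF *]])
  show "F.loc (Z V, f, X) = cmp F.Fr (F.loc (Z (V\<lparr>carrier := U\<rparr>), restrict f U, X)) (retraction V U)"
    if "(Z V, f, X) \<in> arr EQ" "{v \<in> carrier V. f v \<in> rad X} = U" for X f
    by (rule conjunct2[OF conjunct2[OF *], rule_format, OF that])
qed

definition fraction_of where
  "fraction_of D E U j = cmp F.Fr (F.loc (Z ((Rad D)\<lparr>carrier := U\<rparr>), restrict j U, E))
     (cmp F.Fr (retraction (Rad D) U) (inv_arr F.Fr (F.loc (rad_incl D))))"

lemma \<Psi>_rad_incl:
  assumes D: "D \<in> obj EQ"
  shows "on_arr \<Psi> (F.loc (rad_incl D)) = idn (Sp (E_inj R)) (Rad D)"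
proof -
  have "{v \<in> rad D. (\<lambda>v\<in>rad D. v) v \<in> rad D} = rad D" by auto
  then show ?thesis
    using \<Psi>_loc[OF rad_incl_arr[OF D]] pspan_cong[of "rad D" "\<lambda>v\<in>rad D. v" "\<lambda>v. v"]
    by (simp add: rad_incl_def idn_Sp)
qed

lemma partial_map_arr:
  assumes D: "D \<in> obj EQ" and E: "E \<in> obj EQ" and j: "pmap R (Rad D) U j (Rad E)"
  shows "(Z ((Rad D)\<lparr>carrier := U\<rparr>), restrict j U, E) \<in> arr EQ"
proof -
  interpret E: qspace R E by (rule Eq_qspace[OF E])
  have U: "submodule U R (Rad D)" using j by (simp add: pmap_def)
  note W = isotropic_space_obj[OF E_inj_subspace[OF Rad_obj[OF D] U]]
  have jU: "j u \<in> rad E" if "u \<in> U" for u using pmap_closed[OF j that] by simp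
  have "is_linear R (Z ((Rad D)\<lparr>carrier := U\<rparr>)) E j"
    using j jU E.rad_iff by (auto simp: pmap_def is_linear_def subspace_on_def module.truncate_def)
  from Eq_arr_restrict[OF W E this] show ?thesis
    using j jU E.rad_iff by (simp add: pmap_def subspace_on_def)
qed

text \<open>After precomposition with the inclusion of the radical and writing \<open>\<beta> = t\<inverse> f\<close>, the equation
  \<open>\<Psi> t \<circ> \<Psi> \<beta> = \<Psi> f\<close> of partial maps says that \<open>f\<close> has domain \<open>U\<close> and equals \<open>t j\<close> there. So
  \<open>f\<close> is \<open>t j\<close> after the retraction onto \<open>U\<close>, and \<open>t\<close> cancels.\<close>

lemma fraction_determined:
  assumes \<alpha>: "\<alpha> \<in> homs F.Fr D E" and j: "pmap R (Rad D) U j (Rad E)"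
    and \<Psi>\<alpha>: "on_arr \<Psi> \<alpha> = pmor R (Rad D) U j (Rad E)"
  shows "\<alpha> = fraction_of D E U j"
proof -
  let ?V = "Rad D"
  have D: "D \<in> obj EQ" and E: "E \<in> obj EQ" using F.Fr.homs_obj[OF \<alpha>] by simp_all
  have V: "?V \<in> obj (E_inj R)" by (rule Rad_obj[OF D])
  have U: "submodule U R ?V" using j by (simp add: pmap_def)
  let ?k = "(Z (?V\<lparr>carrier := U\<rparr>), restrict j U, E)"
  have ka: "?k \<in> arr EQ" by (rule partial_map_arr[OF D E j])
  then have kh: "?k \<in> homs EQ (Z (?V\<lparr>carrier := U\<rparr>)) E" by (simp add: homs_iff)
  note \<iota>h = F.loc_homs[OF rad_incl_homs[OF D]] and \<iota>iso = rad_incl_iso[OF D]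
  note \<iota>i = F.Fr.inv_arr(1)[OF \<iota>iso \<iota>h]
  define \<beta> where "\<beta> = cmp F.Fr \<alpha> (F.loc (rad_incl D))"
  have \<beta>: "\<beta> \<in> homs F.Fr (Z ?V) E" unfolding \<beta>_def by (rule F.Fr.cmp_homs[OF \<iota>h \<alpha>])
  have \<alpha>\<beta>: "\<alpha> = cmp F.Fr \<beta> (inv_arr F.Fr (F.loc (rad_incl D)))"
    unfolding \<beta>_def by (rule F.Fr.inv_arr_cancel(3)[OF \<iota>iso \<iota>h \<alpha>, symmetric])
  have \<Psi>\<beta>: "on_arr \<Psi> \<beta> = pmor R ?V U j (Rad E)"
    using \<Psi>.on_arr_cmp[OF \<iota>h \<alpha>] \<Psi>_rad_incl[OF D] \<Psi>.cod.cmp_idn_right[OF \<Psi>_homs[OF \<alpha>]]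
    by (simp add: \<beta>_def \<Psi>\<alpha>)
  obtain X f t where fa: "(Z ?V, f, X) \<in> arr EQ" and ta: "(E, t, X) \<in> arr EQ"
    and tiso: "is_iso F.Fr (F.loc (E, t, X))" and trad: "t ` rad E = rad X"
    and t\<beta>: "cmp F.Fr (F.loc (E, t, X)) \<beta> = F.loc (Z ?V, f, X)"
    using fraction_form[OF \<beta>] by blast
  have th: "(E, t, X) \<in> homs EQ E X" using ta by (simp add: homs_iff)
  have pf: "pmap R ?V {v \<in> carrier ?V. f v \<in> rad X} f (Rad X)"
    using pmap_Psi[OF fa] unfolding isotropic_space_simps Rad_isotropic_space .
  have \<Psi>f: "on_arr \<Psi> (F.loc (Z ?V, f, X)) = pmor R ?V {v \<in> carrier ?V. f v \<in> rad X} f (Rad X)"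
    using \<Psi>_loc[OF fa] unfolding isotropic_space_simps Rad_isotropic_space .
  have dom: "{u \<in> U. j u \<in> {w \<in> carrier E. t w \<in> rad X}} = U"
    using pmap_closed[OF j] trad by (auto simp: rad_def)
  note tj = pmap_comp[OF j pmap_Psi[OF ta], unfolded dom]
  have "pmor R ?V {v \<in> carrier ?V. f v \<in> rad X} f (Rad X) = pmor R ?V U (\<lambda>u. t (j u)) (Rad X)"
    using \<Psi>.on_arr_cmp[OF \<beta> F.loc_homs[OF th]] cmp_pmor[OF j pmap_Psi[OF ta], unfolded dom]
    by (simp only: t\<beta> \<Psi>f \<Psi>\<beta> \<Psi>_loc[OF ta])
  then have same: "pspan R ?V {v \<in> carrier ?V. f v \<in> rad X} f (Rad X) = pspan R ?V U (\<lambda>u. t (j u)) (Rad X)"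
    by (simp only: prod.inject)
  have eq: "{v \<in> carrier ?V. f v \<in> rad X} = U" "\<And>u. u \<in> U \<Longrightarrow> f u = t (j u)"
    using pspan_eqD[OF pf tj same] by blast+
  have ft: "(Z (?V\<lparr>carrier := U\<rparr>), restrict f U, X) = cmp EQ (E, t, X) ?k"
    using eq(2) by (auto simp: compose_def subspace_on_def)
  note d = retraction[OF V U]
  have "cmp F.Fr (F.loc (E, t, X)) \<beta> = cmp F.Fr (cmp F.Fr (F.loc (E, t, X)) (F.loc ?k)) (retraction ?V U)"
    unfolding t\<beta> d(3)[OF fa eq(1)] ft F.loc_cmp[OF kh th] ..
  also have "\<dots> = cmp F.Fr (F.loc (E, t, X)) (cmp F.Fr (F.loc ?k) (retraction ?V U))"
    by (rule F.Fr.cmp_assoc[OF d(1) F.loc_homs[OF kh] F.loc_homs[OF th], symmetric])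
  finally have "\<beta> = cmp F.Fr (F.loc ?k) (retraction ?V U)"
    using F.Fr.inv_arr_cancel(1)[OF tiso F.loc_homs[OF th] \<beta>]
      F.Fr.inv_arr_cancel(1)[OF tiso F.loc_homs[OF th] F.Fr.cmp_homs[OF d(1) F.loc_homs[OF kh]]] by simp
  then show ?thesis
    using \<alpha>\<beta> F.Fr.cmp_assoc[OF \<iota>i d(1) F.loc_homs[OF kh]] by (simp add: fraction_of_def)
qed

lemma \<Psi>_fraction_of:
  assumes D: "D \<in> obj EQ" and E: "E \<in> obj EQ" and j: "pmap R (Rad D) U j (Rad E)"
  shows "fraction_of D E U j \<in> homs F.Fr D E" and "on_arr \<Psi> (fraction_of D E U j) = pmor R (Rad D) U j (Rad E)"
proof -
  let ?V = "Rad D"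
  have V: "?V \<in> obj (E_inj R)" by (rule Rad_obj[OF D])
  have U: "submodule U R ?V" using j by (simp add: pmap_def)
  let ?W = "?V\<lparr>carrier := U\<rparr>"
  let ?k = "(Z ?W, restrict j U, E)"
  have ka: "?k \<in> arr EQ" by (rule partial_map_arr[OF D E j])
  then have kh: "?k \<in> homs EQ (Z ?W) E" by (simp add: homs_iff)
  note \<iota>h = F.loc_homs[OF rad_incl_homs[OF D]] and \<iota>iso = rad_incl_iso[OF D]
  note \<iota>i = F.Fr.inv_arr(1)[OF \<iota>iso \<iota>h]
  note d = retraction[OF V U]
  note di = F.Fr.cmp_homs[OF \<iota>i d(1)]
  show "fraction_of D E U j \<in> homs F.Fr D E" unfolding fraction_of_def by (rule F.Fr.cmp_homs[OF di F.loc_homs[OF kh]])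
  interpret Sp: category "Sp (E_inj R)" by (rule category_Sp)
  have "on_arr \<Psi> (inv_arr F.Fr (F.loc (rad_incl D))) = idn (Sp (E_inj R)) ?V"
  proof -
    have "idn (Sp (E_inj R)) ?V = inv_arr (Sp (E_inj R)) (idn (Sp (E_inj R)) ?V)"
      by (rule Sp.inv_arr_unique[OF Sp.is_iso_idn Sp.idn_homs Sp.idn_homs Sp.cmp_idn_left[OF Sp.idn_homs]])
        (use V in auto)
    then show ?thesis using \<Psi>.is_iso_on_arr(2)[OF \<iota>iso \<iota>h] \<Psi>_rad_incl[OF D] by simp
  qed
  then have 1: "on_arr \<Psi> (cmp F.Fr (retraction ?V U) (inv_arr F.Fr (F.loc (rad_incl D)))) = pmor R ?V U (\<lambda>u. u) ?W"
    using \<Psi>.on_arr_cmp[OF \<iota>i d(1)] Sp.cmp_idn_right[of _ ?V ?W] \<Psi>_homs[OF d(1)] d(2) by simp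
  have W: "carrier ?W = U" by (simp add: subspace_on_def)
  have jU: "j u \<in> rad E" if "u \<in> U" for u using pmap_closed[OF j that] by simp
  then have "{v \<in> U. restrict j U v \<in> rad E} = U" by auto
  then have 2: "on_arr \<Psi> (F.loc ?k) = pmor R ?W U (restrict j U) (Rad E)"
    and p2: "pmap R ?W U (restrict j U) (Rad E)"
    using \<Psi>_loc[OF ka] pmap_Psi[OF ka] W by simp_all
  have p1: "pmap R ?V U (\<lambda>u. u) ?W"
    using V U E_inj_subspace[OF V U] by (auto simp: pmap_def is_linear_id)
  have "on_arr \<Psi> (fraction_of D E U j) = cmp (Sp (E_inj R)) (pmor R ?W U (restrict j U) (Rad E)) (pmor R ?V U (\<lambda>u. u) ?W)"
    unfolding fraction_of_def \<Psi>.on_arr_cmp[OF di F.loc_homs[OF kh]] 1 2 ..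
  also have "\<dots> = pmor R ?V U j (Rad E)"
  proof -
    have "{u \<in> U. u \<in> U} = U" by auto
    moreover have "pspan R ?V U (restrict j U) (Rad E) = pspan R ?V U j (Rad E)"
      by (rule pspan_cong) simp
    ultimately show ?thesis by (simp only: cmp_pmor[OF p1 p2])
  qed
  finally show "on_arr \<Psi> (fraction_of D E U j) = pmor R ?V U j (Rad E)" .
qed

theorem \<Psi>_equivalence: "is_equivalence F.Fr (Sp (E_inj R)) \<Psi>"
proof (rule \<Psi>.is_equivalence_if_fully_faithful[where g = Z])
  show "Z V \<in> obj F.Fr \<and> on_obj \<Psi> (Z V) = V" if "V \<in> obj (Sp (E_inj R))" for V
    using isotropic_space_obj[of V] that \<Psi>_obj by simp
next
  fix D E h assume o: "D \<in> obj F.Fr" "E \<in> obj F.Fr" and h: "h \<in> homs (Sp (E_inj R)) (on_obj \<Psi> D) (on_obj \<Psi> E)"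
  have DE: "D \<in> obj EQ" "E \<in> obj EQ" using o by simp_all
  obtain U j where j: "pmap R (Rad D) U j (Rad E)" "h = pmor R (Rad D) U j (Rad E)"
    using h unfolding \<Psi>_obj[OF DE(1)] \<Psi>_obj[OF DE(2)] Sp_arr by blast
  show "\<exists>\<alpha>\<in>homs F.Fr D E. on_arr \<Psi> \<alpha> = h"
    using \<Psi>_fraction_of[OF DE j(1)] unfolding j(2) by (rule bexI[rotated])
next
  fix D E \<alpha> \<alpha>' assume h: "\<alpha> \<in> homs F.Fr D E" "\<alpha>' \<in> homs F.Fr D E" "on_arr \<Psi> \<alpha> = on_arr \<Psi> \<alpha>'"
  obtain U j where "pmap R (Rad D) U j (Rad E)" "on_arr \<Psi> \<alpha> = pmor R (Rad D) U j (Rad E)"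
    using \<Psi>_homs[OF h(1)] unfolding Sp_arr by blast
  then show "\<alpha> = \<alpha>'" using fraction_determined[OF h(1)] fraction_determined[OF h(2)] h(3) by simp
qed

end

theorem mainTheorem5:
  fixes K :: "('k, 'r) ring_scheme"
  assumes "field K"
  shows "is_functor (Eq_deg K :: (('k, 'x) quad_space, _) cat) (Sp (E_inj K)) (Psi_tilde K) \<and>
    inverts (Eq_deg K :: (('k, 'x) quad_space, _) cat) (perp_H K) (Sp (E_inj K)) (Psi_tilde K) \<and>
    (\<exists>\<Psi>. is_induced_functor (Eq_deg K :: (('k, 'x) quad_space, _) cat) (perp_H K)
             (Sp (E_inj K)) (Psi_tilde K) \<Psi> \<and>
         (\<one>\<^bsub>K\<^esub> \<oplus>\<^bsub>K\<^esub> \<one>\<^bsub>K\<^esub> \<noteq> \<zero>\<^bsub>K\<^esub> \<longrightarrow>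
            is_equivalence (fractions (Eq_deg K) (perp_H K)) (Sp (E_inj K)) \<Psi>))"
proof -
  let ?C = "Eq_deg K :: (('k, 'x) quad_space, _) cat"
  have 1: "is_functor ?C (Sp (E_inj K)) (Psi_tilde K)"
    by (rule field.Psi_functor[OF assms])
  have 2: "inverts ?C (perp_H K) (Sp (E_inj K)) (Psi_tilde K)"
    by (rule field.Psi_inverts[OF assms])
  obtain \<Psi> where \<Psi>: "is_induced_functor ?C (perp_H K) (Sp (E_inj K)) (Psi_tilde K) \<Psi>"
    using fractions_base.induced_functor_exists[OF field.fractions_base_Eq[OF assms] 1 2]
    by (rule exE)
  have "is_equivalence (fractions ?C (perp_H K)) (Sp (E_inj K)) \<Psi>"
    if two: "\<one>\<^bsub>K\<^esub> \<oplus>\<^bsub>K\<^esub> \<one>\<^bsub>K\<^esub> \<noteq> \<zero>\<^bsub>K\<^esub>"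
  proof (rule induced.\<Psi>_equivalence)
    show "induced K \<Psi>"
      using \<Psi> assms two unfolding is_induced_functor_def
      by (intro induced.intro odd_char.intro odd_char_axioms.intro induced_axioms.intro) auto
  qed
  with 1 2 \<Psi> show ?thesis by (intro conjI exI[of _ \<Psi>] impI)
qed

end
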